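(* For every closed seamed surface $F$, the evaluation $\langle F\rangle$ (a priori an element of $\mathbb{Z}[\alpha_1,\alpha_2,(\alpha_1-\alpha_2)^{-1}]$) is a homogeneous symmetric polynomial in $\alpha_1$ and $\alpha_2$ of degree $\deg(F)=-\chi(F)+2d(F)$, where $\deg\alpha_1=\deg\alpha_2=2$.
   Context: A closed seamed surface is a closed compact surface $F$ PL-embedded in $\mathbb{R}^3$ (hence orientable), equipped with finitely many disjoint simple closed curves on $F$ (seams), each with a co-orientation (a preferred side in $F$), and with finitely many dots placed on $F$ away from the seams. Facets are the connected components of the complement of the seams in $F$ (or their closures). A checkerboard coloring $c$ of $F$ is a map from the set of facets to $\{1,2\}$ such that along every seam the two sides have different colors; $\mathrm{adm}(F)$ denotes the (finite, possibly empty) set of these. Given $c$, a seam is colored by the color of the facet into which its co-orientation points. Notation: $\theta(F)$ = number of seams of $F$; $\theta_i(c)$ = number of seams of color $i$; $d(F)$ = number of dots on $F$; $d_i(c)$ = number of dots on facets of color $i$; $F_i(c)$ = union of the closed facets of color $i$; $\overline{F}_1(c)$ = the closed surface obtained from $F_1(c)$ by attaching a disk along each boundary circle, so $\chi(\overline{F}_1(c))=\chi(F_1(c))+\theta(F)$. Define $$s(F,c)=\theta_1(c)+\tfrac12\chi(\overline{F}_1(c))\in\mathbb{Z},\qquad \langle F,c\rangle=(-1)^{s(F,c)}\frac{\alpha_1^{d_1(c)}\alpha_2^{d_2(c)}}{(\alpha_2-\alpha_1)^{\chi(F)/2}},\qquad \langle F\rangle=\sum_{c\in\mathrm{adm}(F)}\langle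 F,c\rangle ,$$ elements of $\mathbb{Z}[\alpha_1,\alpha_2,(\alpha_1-\alpha_2)^{-1}]$, graded with $\deg\alpha_1=\deg\alpha_2=2$. *)

theory Defs
  imports
    "HOL-Analysis.Analysis"
    "HOL-Computational_Algebra.Polynomial_Factorial"
begin

section \<open>Euler characteristic\<close>

text \<open>Abstract simplicial complexes are sets of finite vertex sets; the empty simplex,
  of dimension \<open>-1\<close>, does not contribute.\<close>

definition euler_char :: "'v set set \<Rightarrow> int" where
  "euler_char A = (\<Sum>\<sigma> \<in> A - {{}}. (-1) ^ (card \<sigma> - 1))"

definition vertices_of :: "'a::euclidean_space set \<Rightarrow> 'a set" where
  "vertices_of \<sigma> = {v. v extreme_point_of \<sigma>}"

definition vertex_scheme :: "'a::euclidean_space set set \<Rightarrow> 'a set set" where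
  "vertex_scheme K = vertices_of ` K"


section \<open>Closed PL surfaces in three-space\<close>

type_synonym point = "real ^ 3"
type_synonym cell = "point set"

definition edges :: "cell set \<Rightarrow> cell set" where
  "edges K = {\<sigma> \<in> K. aff_dim \<sigma> = 1}"

definition triangles :: "cell set \<Rightarrow> cell set" where
  "triangles K = {\<sigma> \<in> K. aff_dim \<sigma> = 2}"

definition link_edges :: "cell set \<Rightarrow> point \<Rightarrow> cell set" where
  "link_edges K v = {e \<in> edges K. v \<notin> e \<and> convex hull (insert v e) \<in> triangles K}"

text \<open>The edges of a closed polygon with (at least three) distinct vertices. When they all belong
  to one simplicial complex, two of them meet at most in a common vertex, so that their union is a
  simple closed curve.\<close>

definition edge_cycle :: "cell set \<Rightarrow> bool" where
  "edge_cycle E \<longleftrightarrow>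
     (\<exists>vs. 3 \<le> length vs \<and> distinct vs \<and>
        E = (\<lambda>i. convex hull {vs ! i, vs ! (Suc i mod length vs)}) ` {..<length vs})"

text \<open>A combinatorial 2-manifold without boundary: pure of dimension two, with
  all vertex links circles. The surface need not be connected and may be empty. Orientability
  is a consequence of the embedding and is not assumed.\<close>

definition closed_PL_surface :: "cell set \<Rightarrow> bool" where
  "closed_PL_surface K \<longleftrightarrow>
     simplicial_complex K \<and>
     (\<forall>\<sigma>\<in>K. \<exists>t\<in>triangles K. \<sigma> \<subseteq> t) \<and>
     (\<forall>v. {v} \<in> K \<longrightarrow> edge_cycle (link_edges K v))"


section \<open>Seamed surfaces\<close>

text \<open>A PL surface with PL seams is given by a triangulation in which the seams are
  subcomplexes; a seam is the set of its edges. A co-orientation is recorded by selecting, for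
  every seam edge, the adjacent triangle lying on the preferred side.\<close>

record seamed_surface =
  tri :: "cell set"
  seams :: "cell set set"
  side :: "cell \<Rightarrow> cell"
  dots :: "point set"

definition carrier :: "seamed_surface \<Rightarrow> point set" where
  "carrier F = \<Union>(tri F)"

definition seam_points :: "seamed_surface \<Rightarrow> point set" where
  "seam_points F = \<Union>(\<Union>(seams F))"

text \<open>Two triangles at the vertex \<open>v\<close> of the curve \<open>S\<close> are related if one can pass from one to the
  other by rotating around \<open>v\<close> without crossing \<open>S\<close>.\<close>

definition same_side :: "cell set \<Rightarrow> cell set \<Rightarrow> point \<Rightarrow> (cell \<times> cell) set" where
  "same_side K S v =
     {(t, t'). t \<in> triangles K \<and> t' \<in> triangles K \<and>
        (\<exists>a\<in>edges K. v \<in> a \<and> {v} \<in> K \<and> a \<notin> S \<and> a \<subseteq> t \<and> a \<subseteq> t')}\<^sup>*"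

text \<open>The second condition says that the preferred sides chosen at consecutive edges agree.\<close>

definition co_orientation :: "cell set \<Rightarrow> cell set \<Rightarrow> (cell \<Rightarrow> cell) \<Rightarrow> bool" where
  "co_orientation K S s \<longleftrightarrow>
     (\<forall>e\<in>S. s e \<in> triangles K \<and> e \<subseteq> s e) \<and>
     (\<forall>e\<in>S. \<forall>e'\<in>S. \<forall>v. {v} \<in> K \<and> v \<in> e \<inter> e' \<longrightarrow> (s e, s e') \<in> same_side K S v)"

definition closed_seamed_surface :: "seamed_surface \<Rightarrow> bool" where
  "closed_seamed_surface F \<longleftrightarrow>
     closed_PL_surface (tri F) \<and>
     (\<forall>S\<in>seams F. S \<subseteq> edges (tri F) \<and> edge_cycle S \<and> co_orientation (tri F) S (side F)) \<and>
     (\<forall>S\<in>seams F. \<forall>S'\<in>seams F. S \<noteq> S' \<longrightarrow> \<Union>S \<inter> \<Union>S' = {}) \<and>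
     finite (dots F) \<and> dots F \<subseteq> carrier F - seam_points F"

definition facets :: "seamed_surface \<Rightarrow> point set set" where
  "facets F = components (carrier F - seam_points F)"

text \<open>Used only for nonempty connected sets \<open>X\<close> disjoint from the seams.\<close>

definition facet_at :: "seamed_surface \<Rightarrow> point set \<Rightarrow> point set" where
  "facet_at F X = (THE f. f \<in> facets F \<and> X \<subseteq> f)"


section \<open>Checkerboard colorings\<close>

type_synonym coloring = "point set \<Rightarrow> nat"

definition adm :: "seamed_surface \<Rightarrow> coloring set" where
  "adm F = {c \<in> facets F \<rightarrow>\<^sub>E {1, 2}.
     \<forall>e\<in>\<Union>(seams F). \<forall>t\<in>triangles (tri F). \<forall>t'\<in>triangles (tri F).
       e \<subseteq> t \<and> e \<subseteq> t' \<and> t \<noteq> t' \<longrightarrow>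
         c (facet_at F (rel_interior t)) \<noteq> c (facet_at F (rel_interior t'))}"

definition num_seams :: "seamed_surface \<Rightarrow> coloring \<Rightarrow> nat \<Rightarrow> nat" where
  "num_seams F c i =
     card {S \<in> seams F. \<forall>e\<in>S. c (facet_at F (rel_interior (side F e))) = i}"

definition num_dots :: "seamed_surface \<Rightarrow> coloring \<Rightarrow> nat \<Rightarrow> nat" where
  "num_dots F c i = card {p \<in> dots F. c (facet_at F {p}) = i}"

definition colored_part :: "seamed_surface \<Rightarrow> coloring \<Rightarrow> nat \<Rightarrow> point set" where
  "colored_part F c i = \<Union>{closure f | f. f \<in> facets F \<and> c f = i}"

text \<open>For admissible \<open>c\<close>, the boundary circles of the part of color \<open>i\<close> are precisely all the seams;
  the disk attached along the seam \<open>S\<close> is triangulated as the cone over \<open>S\<close> with a new apex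
  \<open>Inr S\<close>.\<close>

definition capped_part ::
    "seamed_surface \<Rightarrow> coloring \<Rightarrow> nat \<Rightarrow> (point + cell set) set set" where
  "capped_part F c i =
     {Inl ` vertices_of \<sigma> | \<sigma>. \<sigma> \<in> tri F \<and> \<sigma> \<subseteq> colored_part F c i} \<union>
     {insert (Inr S) (Inl ` vertices_of \<tau>) | S \<tau>. S \<in> seams F \<and> \<tau> \<in> tri F \<and> \<tau> \<subseteq> \<Union>S}"


section \<open>The evaluation\<close>

definition surface_euler_char :: "seamed_surface \<Rightarrow> int" where
  "surface_euler_char F = euler_char (vertex_scheme (tri F))"

definition surface_degree :: "seamed_surface \<Rightarrow> int" where
  "surface_degree F = - surface_euler_char F + 2 * int (card (dots F))"

text \<open>The divisions by two below are exact, closed orientable surfaces having even Euler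
  characteristic.\<close>

definition sign_exponent :: "seamed_surface \<Rightarrow> coloring \<Rightarrow> int" where
  "sign_exponent F c = int (num_seams F c 1) + euler_char (capped_part F c 1) div 2"

text \<open>The ring \<open>\<int>[\<alpha>\<^sub>1, \<alpha>\<^sub>2]\<close> is \<open>\<int>[\<alpha>\<^sub>1][\<alpha>\<^sub>2]\<close>: the coefficient of
  \<open>\<alpha>\<^sub>1\<^sup>i \<alpha>\<^sub>2\<^sup>j\<close> in \<open>p\<close> is \<open>coeff (coeff p j) i\<close>. Evaluations are formed in its field of fractions,
  which contains the localization at \<open>\<alpha>\<^sub>1 - \<alpha>\<^sub>2\<close>.\<close>

definition \<alpha>1 :: "int poly poly" where "\<alpha>1 = [:[:0, 1:]:]"
definition \<alpha>2 :: "int poly poly" where "\<alpha>2 = [:0, 1:]"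

definition colored_evaluation :: "seamed_surface \<Rightarrow> coloring \<Rightarrow> int poly poly fract" where
  "colored_evaluation F c =
     (-1) powi sign_exponent F c *
       (to_fract \<alpha>1 ^ num_dots F c 1 * to_fract \<alpha>2 ^ num_dots F c 2 /
        (to_fract \<alpha>2 - to_fract \<alpha>1) powi (surface_euler_char F div 2))"

definition evaluation :: "seamed_surface \<Rightarrow> int poly poly fract" where
  "evaluation F = (\<Sum>c\<in>adm F. colored_evaluation F c)"

definition symmetric_poly :: "int poly poly \<Rightarrow> bool" where
  "symmetric_poly p \<longleftrightarrow> (\<forall>i j. coeff (coeff p j) i = coeff (coeff p i) j)"

text \<open>Both variables have degree two; the zero polynomial is homogeneous of every degree.\<close>

definition homogeneous_of_degree :: "int poly poly \<Rightarrow> int \<Rightarrow> bool" where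
  "homogeneous_of_degree p n \<longleftrightarrow>
     (\<forall>i j. coeff (coeff p j) i \<noteq> 0 \<longrightarrow> int (2 * i + 2 * j) = n)"

end

theory Submission
  imports Defs "HOL-Combinatorics.Permutations"
begin

text \<open>The embedding of \<open>F\<close> matters only through the orientation it induces. Fix a generic direction \<open>u\<close>. For a
  generic point \<open>q\<close> of a triangle count the triangles met by the open ray from \<open>q\<close> in direction
  \<open>u\<close>; the parity of this number depends only on the triangle, and correcting the orientation that
  a triangle inherits from its projection along \<open>u\<close> by this parity gives a coherent orientation.

  On an oriented surface the corners of the triangles of one color are permuted by \<open>rot\<close>, the
  composition of an involution crossing the edges off the seams and the rotation of every triangle.
  The orbits of \<open>rot\<close> are the stars of the inner vertices and the seams, so comparing signs shows
  that the capped part has even Euler characteristic. For a connected component a dual spanning tree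
  bounds the Euler characteristic by \<open>2\<close>.

  All colorings arise from a single one by exchanging the colors on a set of components. Hence the
  evaluation is a product over the components, a component of Euler characteristic \<open>2k\<close> with \<open>a\<close> and
  \<open>b\<close> dots of the two colors contributing, up to sign,
  \<open>(\<alpha>\<^sub>1\<^sup>a \<alpha>\<^sub>2\<^sup>b + (-1)\<^sup>k \<alpha>\<^sub>1\<^sup>b \<alpha>\<^sub>2\<^sup>a) / (\<alpha>\<^sub>2 - \<alpha>\<^sub>1)\<^sup>k\<close>. This is symmetric, and a polynomial because \<open>k \<le> 1\<close>
  and the numerator is antisymmetric for \<open>k = 1\<close>.\<close>

section \<open>The parity of the Euler characteristic\<close>

text \<open>Halving Euler characteristics is where orientability is needed: for a projective plane
  the exponent would not be an integer. The embedding supplies it in the form of \<open>nxt\<close>,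
  a cyclic order on each triangle such that adjacent triangles traverse their common edge in
  opposite directions. A permutation of m points with r orbits has sign (-1)^(m+r). On the corners
  of one color the involution has the edges as orbits, and rotating every triangle has order three,
  hence sign 1. So the number of edges is compared modulo 2 with the number of inner vertices plus
  seams, and no classification of surfaces is involved. Exchanging the colors on a component of
  Euler characteristic 2k with n seams changes its sign exponent from s to s' with s + s' = 2n + k:
  each seam is co-oriented towards color 1 in exactly one of the two cases, and the two capped parts
  have Euler characteristics with sum 2k + 2n. This is the origin of (-1)^k, and the reason why
  parity has to be known for each colored part of each component, not only for the whole
  surface.\<close>

text \<open>In the last hypothesis orbits are expressed by invariant predicates: points with the same label
  cannot be separated by a predicate invariant under \<open>p\<close>.\<close>

lemma sign_eq_card_orbits:
  fixes lab :: "'a \<Rightarrow> 'b"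
  assumes "finite S" "p permutes S"
    and "\<And>x. x \<in> S \<Longrightarrow> lab (p x) = lab x"
    and "\<And>P x y. (\<And>z. z \<in> S \<Longrightarrow> P (p z) = P z) \<Longrightarrow> x \<in> S \<Longrightarrow> y \<in> S \<Longrightarrow> lab x = lab y \<Longrightarrow> P x \<Longrightarrow> P y"
  shows "sign p = (-1) ^ (card S + card (lab ` S))"
  using assms
proof (induction S arbitrary: p rule: finite_induct)
  case empty
  then show ?case by simp
next
  case (insert a S)
  \<comment> \<open>The transposition cuts \<open>a\<close> out of its cycle and joins its two
    neighbors there; the orbits are otherwise unchanged.\<close>
  define q where "q = Transposition.transpose a (p a) \<circ> p"
  have q: "q permutes S"
    unfolding q_def by (rule permutes_insert_lemma[OF insert.prems(1)])
  have q_eq: "q z = (if p z = a then p a else p z)" if "z \<in> S" for z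
  proof -
    have "p z \<noteq> p a"
      using that insert.hyps insert.prems(1) by (metis permutes_def)
    then show ?thesis by (auto simp: q_def transpose_def)
  qed
  have pa: "p a \<in> insert a S"
    using insert.prems(1) permutes_in_image[of p "insert a S" a] by simp
  have p_eq: "p = Transposition.transpose a (p a) \<circ> q"
    by (simp add: q_def fun_eq_iff)
  have sp: "sign p = sign (Transposition.transpose a (p a)) * sign q"
    using q insert.hyps(1) by (metis p_eq sign_compose permutation_swap_id permutes_imp_permutation)
  have IH: "sign q = (-1) ^ (card S + card (lab ` S))"
  proof (rule insert.IH[OF q])
    fix x assume "x \<in> S"
    then show "lab (q x) = lab x"
      using insert.prems(2) by (metis insertCI q_eq)
  next
    fix P x y
    assume inv: "\<And>z. z \<in> S \<Longrightarrow> P (q z) = P z" and xy: "x \<in> S" "y \<in> S" "lab x = lab y" "P x"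
    \<comment> \<open>\<open>a\<close> receives the value at its successor, which makes
      \<open>P'\<close> invariant under \<open>p\<close>.\<close>
    define P' where "P' z = (if z = a then P (p a) else P z)" for z
    have "P' (p z) = P' z" if "z \<in> insert a S" for z
    proof (cases "z = a")
      case True
      then show ?thesis by (auto simp: P'_def)
    next
      case False
      then have "z \<in> S" using that by simp
      then have "P (q z) = P z" by (rule inv)
      then show ?thesis using False q_eq[OF \<open>z \<in> S\<close>] by (auto simp: P'_def)
    qed
    then have "P' x \<Longrightarrow> P' y"
      using insert.prems(3)[of P' x y] xy by blast
    moreover have "x \<noteq> a" "y \<noteq> a" using xy insert.hyps(2) by auto
    ultimately show "P y"
      using xy by (simp add: P'_def)
  qed
  show ?case
  proof (cases "p a = a")
    case True
    have "lab a \<notin> lab ` S"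
    proof
      assume "lab a \<in> lab ` S"
      then obtain y where y: "y \<in> S" "lab a = lab y" by auto
      \<comment> \<open>A fixed point is separated from all others by the invariant predicate of
        being equal to \<open>a\<close>, so its label is new.\<close>
      have "(p z = a) = (z = a)" if "z \<in> insert a S" for z
        using True insert.prems(1) by (metis permutes_def)
      then have "y = a"
        using insert.prems(3)[of "\<lambda>z. z = a" a y] y by auto
      then show False using y insert.hyps by simp
    qed
    then show ?thesis
      using sp IH True insert.hyps by simp
  next
    case False
    then have "p a \<in> S" using pa by simp
    have "lab a = lab (p a)" using insert.prems(2) by simp
    then have "lab ` insert a S = lab ` S"
      using \<open>p a \<in> S\<close> by (auto simp: image_iff)
    then show ?thesis
      using sp IH False insert.hyps by (simp add: sign_swap_id)
  qed
qed

lemma card_2_other: "card e = 2 \<Longrightarrow> v \<in> e \<Longrightarrow> \<exists>w. e = {v, w} \<and> w \<noteq> v"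
  by (metis card_2_iff insert_commute insert_iff singletonD)

section \<open>Abstract closed surfaces, their Euler characteristics and orientations\<close>

definition es :: "'v set set \<Rightarrow> 'v set set" where
  "es A = {e. card e = 2 \<and> (\<exists>t\<in>A. e \<subseteq> t)}"

definition chi :: "'v set set \<Rightarrow> int" where
  "chi A = int (card (\<Union>A)) - int (card (es A)) + int (card A)"

text \<open>A polygon as an abstract graph. Connectedness is phrased through predicates passed on
  between meeting edges, so that using it is an induction along the polygon.\<close>

definition cycle_graph :: "'v set set \<Rightarrow> bool" where
  "cycle_graph S \<longleftrightarrow> finite S \<and> S \<noteq> {} \<and> (\<forall>e\<in>S. card e = 2) \<and> card S = card (\<Union>S) \<and>
     (\<forall>v\<in>\<Union>S. card {e\<in>S. v \<in> e} = 2) \<and>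
     (\<forall>P. (\<forall>e\<in>S. \<forall>e'\<in>S. e \<inter> e' \<noteq> {} \<longrightarrow> P e \<longrightarrow> P e') \<longrightarrow> (\<forall>e\<in>S. \<forall>e'\<in>S. P e \<longrightarrow> P e'))"

lemma cycle_graph_card2: "cycle_graph S \<Longrightarrow> e \<in> S \<Longrightarrow> card e = 2"
  by (simp add: cycle_graph_def)

lemma cycle_graph_connected:
  assumes "cycle_graph S" "\<And>e e'. e \<in> S \<Longrightarrow> e' \<in> S \<Longrightarrow> e \<inter> e' \<noteq> {} \<Longrightarrow> P e \<Longrightarrow> P e'" "a \<in> S" "b \<in> S" "P a"
  shows "P b"
proof -
  have "\<forall>P. (\<forall>e\<in>S. \<forall>e'\<in>S. e \<inter> e' \<noteq> {} \<longrightarrow> P e \<longrightarrow> P e') \<longrightarrow> (\<forall>e\<in>S. \<forall>e'\<in>S. P e \<longrightarrow> P e')"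
    using assms(1) unfolding cycle_graph_def by (elim conjE)
  from mp[OF spec[OF this, of P]] show ?thesis
    using assms(2-) by blast
qed

text \<open>Triangles are their vertex sets. \<open>link\<close> allows turning around
  \<open>v\<close> from any triangle at \<open>v\<close> to any other, which rules out pinched
  vertices; with \<open>two\<close> it makes every vertex link a circle.\<close>

locale surface =
  fixes T :: "'v set set"
  assumes finT: "finite T" and card3: "t \<in> T \<Longrightarrow> card t = 3"
    and two: "t \<in> T \<Longrightarrow> e \<subseteq> t \<Longrightarrow> card e = 2 \<Longrightarrow> card {t'\<in>T. e \<subseteq> t'} = 2"
    and link: "t \<in> T \<Longrightarrow> t' \<in> T \<Longrightarrow> v \<in> t \<Longrightarrow> v \<in> t' \<Longrightarrow>
      (t, t') \<in> {(s, s'). s \<in> T \<and> s' \<in> T \<and> card (s \<inter> s') = 2 \<and> v \<in> s \<inter> s'}\<^sup>*"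
begin

lemma fint: "t \<in> T \<Longrightarrow> finite t"
  using card3 by (metis card.infinite zero_neq_numeral)

lemma fin_es: "A \<subseteq> T \<Longrightarrow> finite (es A)"
  using finT fint by (intro finite_subset[of "es A" "Pow (\<Union>T)"]) (auto simp: es_def)

lemma fin_V: "A \<subseteq> T \<Longrightarrow> finite (\<Union>A)"
  using finT fint by (meson finite_Union finite_subset in_mono)

lemma edge_subset: "v \<in> t \<Longrightarrow> w \<in> t \<Longrightarrow> v \<noteq> w \<Longrightarrow> t \<in> A \<Longrightarrow> {v, w} \<in> es A"
  by (auto simp: es_def)

lemma two_triangles:
  assumes "e \<in> es T"
  obtains t t' where "t \<in> T" "t' \<in> T" "t \<noteq> t'" "{s\<in>T. e \<subseteq> s} = {t, t'}" "e \<subseteq> t" "e \<subseteq> t'"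
proof -
  have "card {s\<in>T. e \<subseteq> s} = 2"
    using assms two by (auto simp: es_def)
  then obtain t t' where *: "{s\<in>T. e \<subseteq> s} = {t, t'}" "t \<noteq> t'"
    by (meson card_2_iff)
  then have "t \<in> {s\<in>T. e \<subseteq> s}" "t' \<in> {s\<in>T. e \<subseteq> s}" by auto
  with * show ?thesis by (intro that) auto
qed

end

text \<open>\<open>nxt t\<close> is a cyclic order of the vertices of \<open>t\<close>, and
  \<open>coherent\<close> makes the two triangles at an edge traverse it in opposite
  directions.\<close>

locale oriented_surface = surface +
  fixes nxt :: "'v set \<Rightarrow> 'v \<Rightarrow> 'v"
  assumes nxt_in: "t \<in> T \<Longrightarrow> v \<in> t \<Longrightarrow> nxt t v \<in> t"
    and nxt_neq: "t \<in> T \<Longrightarrow> v \<in> t \<Longrightarrow> nxt t v \<noteq> v"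
    and nxt3: "t \<in> T \<Longrightarrow> v \<in> t \<Longrightarrow> nxt t (nxt t (nxt t v)) = v"
    and coherent: "t \<in> T \<Longrightarrow> t' \<in> T \<Longrightarrow> t \<noteq> t' \<Longrightarrow> v \<in> t' \<Longrightarrow> v \<in> t \<Longrightarrow> nxt t v \<in> t' \<Longrightarrow> nxt t' (nxt t v) = v"
begin

lemma nxt2_neq: "t \<in> T \<Longrightarrow> v \<in> t \<Longrightarrow> nxt t (nxt t v) \<noteq> v"
  by (metis nxt3 nxt_neq)

lemma nxt_inj: "t \<in> T \<Longrightarrow> v \<in> t \<Longrightarrow> w \<in> t \<Longrightarrow> nxt t v = nxt t w \<Longrightarrow> v = w"
  by (metis nxt3)

lemma nxt_cases:
  assumes "t \<in> T" "v \<in> t" "w \<in> t" "v \<noteq> w"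
  shows "nxt t v = w \<or> nxt t w = v"
proof (rule ccontr)
  assume *: "\<not> ?thesis"
  have "{v, w, nxt t v, nxt t w} \<subseteq> t" using assms nxt_in by blast
  moreover have "nxt t v \<noteq> v" "nxt t w \<noteq> w" "nxt t v \<noteq> w" "nxt t w \<noteq> v" "nxt t v \<noteq> nxt t w"
    using * assms nxt_neq nxt_inj by blast+
  then have "card {v, w, nxt t v, nxt t w} = 4"
    using assms(4) by (auto simp: card_insert_if)
  ultimately show False
    using card_mono[of t "{v, w, nxt t v, nxt t w}"] card3[OF assms(1)] fint[OF assms(1)] by auto
qed

text \<open>The neighbor across the edge from \<open>v\<close> to \<open>nxt t v\<close>. It
  contains \<open>v\<close> again, so iteration turns around \<open>v\<close> in a fixed
  direction.\<close>

definition opp :: "'v set \<Rightarrow> 'v \<Rightarrow> 'v set" where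
  "opp t v = (SOME t'. t' \<in> T \<and> t' \<noteq> t \<and> v \<in> t' \<and> nxt t v \<in> t')"

lemma opp:
  assumes "t \<in> T" "v \<in> t"
  shows "opp t v \<in> T" "opp t v \<noteq> t" "v \<in> opp t v" "nxt t v \<in> opp t v" "nxt (opp t v) (nxt t v) = v"
    and opp_unique: "s \<in> T \<Longrightarrow> v \<in> s \<Longrightarrow> nxt t v \<in> s \<Longrightarrow> s \<noteq> t \<Longrightarrow> s = opp t v"
proof -
  have e: "{v, nxt t v} \<in> es T"
    using assms nxt_in nxt_neq edge_subset by metis
  obtain a b where ab: "a \<in> T" "b \<in> T" "a \<noteq> b" "{s\<in>T. {v, nxt t v} \<subseteq> s} = {a, b}"
    by (rule two_triangles[OF e]) auto
  have ex: "\<exists>t'. t' \<in> T \<and> t' \<noteq> t \<and> v \<in> t' \<and> nxt t v \<in> t'"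
    using ab by (metis (no_types, lifting) insert_subset insertCI mem_Collect_eq)
  note o = someI_ex[OF ex, folded opp_def]
  show "opp t v \<in> T" "opp t v \<noteq> t" "v \<in> opp t v" "nxt t v \<in> opp t v"
    using o by auto
  then show "nxt (opp t v) (nxt t v) = v"
    using coherent[of t "opp t v" v] assms by blast
  assume "s \<in> T" "v \<in> s" "nxt t v \<in> s" "s \<noteq> t"
  then have "s \<in> {a, b}" "t \<in> {a, b}" "opp t v \<in> {a, b}"
    using ab(4) o assms nxt_in[OF assms] by blast+
  then show "s = opp t v" using \<open>s \<noteq> t\<close> o by auto
qed

lemma opp_opp:
  assumes "t \<in> T" "v \<in> t"
  shows "opp (opp t v) (nxt t v) = t"
  using opp[OF assms] opp_unique[of "opp t v" "nxt t v" t] assms nxt_in[OF assms] by metis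

text \<open>Turning around \<open>v\<close> in the direction of \<open>opp\<close> is injective,
  hence on the finite set \<open>W\<close> also surjective. So \<open>W\<close> is closed under
  turning either way, and \<open>link\<close> reaches the whole star.\<close>

lemma star_closed:
  assumes W: "W \<subseteq> {s\<in>T. v \<in> s}" "W \<noteq> {}" and closed: "\<And>s. s \<in> W \<Longrightarrow> opp s v \<in> W"
  shows "W = {s\<in>T. v \<in> s}"
proof -
  have inj: "s = s'" if "s \<in> T" "s' \<in> T" "v \<in> s" "v \<in> s'" "opp s v = opp s' v" for s s'
  proof (rule ccontr)
    assume "s \<noteq> s'"
    have o: "nxt (opp s v) (nxt s v) = v" "nxt (opp s v) (nxt s' v) = v"
      using opp(5)[of s v] opp(5)[of s' v] that by simp_all
    have "nxt s v \<in> opp s v" "nxt s' v \<in> opp s v" "opp s v \<in> T"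
      using opp(1,4)[of s v] opp(1,4)[of s' v] that by simp_all
    then have "nxt s v = nxt s' v"
      using nxt_inj[of "opp s v" "nxt s v" "nxt s' v"] o by presburger
    then have "nxt s' (nxt s' v) = v"
      using coherent[of s s' v] \<open>s \<noteq> s'\<close> that nxt_in[of s' v] by simp
    then show False
      using that nxt2_neq[of s' v] by simp
  qed
  have fW: "finite W" by (rule finite_subset[OF W(1)]) (simp add: finT)
  have "inj_on (\<lambda>s. opp s v) W" using inj W by (auto simp: inj_on_def)
  then have img: "(\<lambda>s. opp s v) ` W = W"
    by (intro endo_inj_surj fW) (use closed in auto)
  have istep: "s' \<in> W" if st: "s \<in> W" "s \<in> T" "s' \<in> T" "card (s \<inter> s') = 2" "v \<in> s \<inter> s'" for s s'
  proof -
    obtain w where w: "s \<inter> s' = {v, w}" "w \<noteq> v"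
      using card_2_other[OF st(4,5)] by blast
    have m: "v \<in> s" "w \<in> s" "v \<in> s'" "w \<in> s'" using w(1) by blast+
    have ne: "s \<noteq> s'" using st(4) card3[OF st(2)] by auto
    have "nxt s v = w \<or> nxt s w = v"
      using nxt_cases[OF st(2) m(1,2)] w(2) by metis
    then show "s' \<in> W"
    proof
      assume "nxt s v = w"
      then have "s' = opp s v"
        using opp_unique[OF st(2) m(1) st(3) m(3)] m(4) ne by metis
      then show ?thesis using closed[OF st(1)] by simp
    next
      \<comment> \<open>Here \<open>s'\<close> precedes \<open>s\<close> in the rotation, and
        surjectivity is what keeps it in \<open>W\<close>.\<close>
      assume "nxt s w = v"
      then have "nxt s' v = w"
        using coherent[OF st(2,3) ne m(4,2)] m(3) by metis
      then have 1: "s = opp s' v"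
        using opp_unique[OF st(3) m(3) st(2) m(1)] m(2) ne by metis
      have "s \<in> (\<lambda>s. opp s v) ` W" using img st(1) by simp
      then obtain r where r: "r \<in> W" "s = opp r v" by blast
      then have "r \<in> T" "v \<in> r" using W by auto
      then have "s' = r" using inj[of s' r] st(3) m(3) 1 r(2) by metis
      then show ?thesis using \<open>r \<in> W\<close> by simp
    qed
  qed
  obtain s where s: "s \<in> W" using W by auto
  have "t \<in> W" if "t \<in> T" "v \<in> t" for t
  proof -
    have "(s, t) \<in> {(s, s'). s \<in> T \<and> s' \<in> T \<and> card (s \<inter> s') = 2 \<and> v \<in> s \<inter> s'}\<^sup>*"
      using link[of s t v] s W that by blast
    then show ?thesis
    proof (induction rule: rtrancl_induct)
      case base
      show ?case by (rule s)
    next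
      case (step y z)
      then show ?case using istep by blast
    qed
  qed
  then show ?thesis using W by auto
qed

end

text \<open>\<open>bd\<close> says that the boundary of \<open>R\<close> consists exactly of the
  seams: of the two triangles at an edge, exactly one lies in \<open>R\<close> just when the edge
  belongs to a seam.\<close>

locale region = oriented_surface T nxt for T :: "'v set set" and nxt +
  fixes R :: "'v set set" and \<S> :: "'v set set set"
  assumes R: "R \<subseteq> T" and fin\<S>: "finite \<S>"
    and cyc: "S \<in> \<S> \<Longrightarrow> cycle_graph S"
    and disj: "S \<in> \<S> \<Longrightarrow> S' \<in> \<S> \<Longrightarrow> S \<noteq> S' \<Longrightarrow> \<Union>S \<inter> \<Union>S' = {}"
    and bd: "e \<in> es T \<Longrightarrow> e \<in> \<Union>\<S> \<longleftrightarrow> card {t\<in>R. e \<subseteq> t} = 1"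
    and \<S>_es: "\<Union>\<S> \<subseteq> es T"
begin

lemma RT: "t \<in> R \<Longrightarrow> t \<in> T" using R by auto

lemma edge: "t \<in> T \<Longrightarrow> v \<in> t \<Longrightarrow> {v, nxt t v} \<in> es T"
  using edge_subset[of v t "nxt t v" T] nxt_in[of t v] nxt_neq[of t v] by simp

lemma triangles_at_edge:
  assumes "t \<in> T" "v \<in> t"
  shows "{s\<in>T. {v, nxt t v} \<subseteq> s} = {t, opp t v}"
  using opp(1-4)[OF assms] opp_unique[OF assms] nxt_in[OF assms] assms by blast

lemma seam_iff:
  assumes "t \<in> R" "v \<in> t"
  shows "{v, nxt t v} \<in> \<Union>\<S> \<longleftrightarrow> opp t v \<notin> R"
proof -
  have "{s\<in>R. {v, nxt t v} \<subseteq> s} = {s\<in>T. {v, nxt t v} \<subseteq> s} \<inter> R"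
    using R by auto
  also have "\<dots> = {t, opp t v} \<inter> R"
    using triangles_at_edge[of t v] assms RT by simp
  also have "card \<dots> = (if opp t v \<in> R then 2 else 1)"
    using assms opp(2)[of t v] RT by (auto simp: Int_insert_left)
  finally show ?thesis
    using bd[of "{v, nxt t v}"] edge[of t v] assms RT by simp
qed

lemma seam_iff':
  assumes "t \<in> T" "t \<notin> R" "v \<in> t"
  shows "{v, nxt t v} \<in> \<Union>\<S> \<longleftrightarrow> opp t v \<in> R"
proof -
  have "{s\<in>R. {v, nxt t v} \<subseteq> s} = {s\<in>T. {v, nxt t v} \<subseteq> s} \<inter> R"
    using R by auto
  also have "\<dots> = {t, opp t v} \<inter> R"
    using triangles_at_edge[of t v] assms RT by simp
  also have "card \<dots> = (if opp t v \<in> R then 1 else 0)"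
    using assms by (auto simp: Int_insert_left)
  finally show ?thesis
    using bd[of "{v, nxt t v}"] edge[of t v] assms RT by simp
qed

section \<open>Permutations of the corners of a region\<close>

definition corners :: "('v set \<times> 'v) set" where
  "corners = {(t, v). t \<in> R \<and> v \<in> t}"

text \<open>A corner \<open>(t, v)\<close> stands for the edge from \<open>v\<close> to
  \<open>nxt t v\<close>, directed by \<open>t\<close>. The image has second component
  \<open>nxt t v\<close> because the opposite triangle directs this edge the other way.\<close>

definition flip :: "'v set \<times> 'v \<Rightarrow> 'v set \<times> 'v" where
  "flip = (\<lambda>(t, v). if (t, v) \<in> corners \<and> {v, nxt t v} \<notin> \<Union>\<S> then (opp t v, nxt t v) else (t, v))"

definition turn :: "'v set \<times> 'v \<Rightarrow> 'v set \<times> 'v" where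
  "turn = (\<lambda>(t, v). if (t, v) \<in> corners then (t, nxt t v) else (t, v))"

lemma fin_corners: "finite corners"
proof -
  have "corners = (SIGMA t:R. t)" by (auto simp: corners_def)
  then show ?thesis
    using finT R fint RT by (auto intro!: finite_SigmaI elim: finite_subset)
qed

lemma card_corners: "card corners = 3 * card R"
proof -
  have "corners = (SIGMA t:R. t)" by (auto simp: corners_def)
  moreover have "finite R" using R finT finite_subset by blast
  ultimately have "card corners = (\<Sum>t\<in>R. card t)"
    using fint RT by (auto intro!: card_SigmaI)
  also have "\<dots> = (\<Sum>t\<in>R. 3)" using card3 RT by (intro sum.cong) auto
  finally show ?thesis by simp
qed

lemma flip_corner:
  assumes "(t, v) \<in> corners"
  shows "flip (t, v) \<in> corners" "flip (flip (t, v)) = (t, v)"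
    "{snd (flip (t, v)), nxt (fst (flip (t, v))) (snd (flip (t, v)))} = {v, nxt t v}"
proof -
  have t: "t \<in> R" "t \<in> T" "v \<in> t" using assms RT by (auto simp: corners_def)
  note o = opp(1-5)[OF t(2,3)] opp_opp[OF t(2,3)]
  have "flip (t, v) \<in> corners \<and> flip (flip (t, v)) = (t, v) \<and>
    {snd (flip (t, v)), nxt (fst (flip (t, v))) (snd (flip (t, v)))} = {v, nxt t v}"
  proof (cases "{v, nxt t v} \<in> \<Union>\<S>")
    case True
    then show ?thesis using assms by (simp add: flip_def del: Union_iff)
  next
    case False
    have f: "flip (t, v) = (opp t v, nxt t v)" using False assms by (simp add: flip_def del: Union_iff)
    have c: "(opp t v, nxt t v) \<in> corners" using o(4) seam_iff[OF t(1,3)] False by (simp add: corners_def)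
    have "{nxt t v, nxt (opp t v) (nxt t v)} = {v, nxt t v}" using o(5) by auto
    moreover from this have "flip (opp t v, nxt t v) = (t, v)"
      using False c o(5) o(6) by (simp add: flip_def insert_commute del: Union_iff)
    ultimately show ?thesis using f c by simp
  qed
  then show "flip (t, v) \<in> corners" "flip (flip (t, v)) = (t, v)"
    "{snd (flip (t, v)), nxt (fst (flip (t, v))) (snd (flip (t, v)))} = {v, nxt t v}"
    by blast+
qed

lemma turn_corner:
  assumes "(t, v) \<in> corners"
  shows "turn (t, v) \<in> corners" "turn (turn (turn (t, v))) = (t, v)"
proof -
  have t: "t \<in> R" "t \<in> T" "v \<in> t" using assms RT by (auto simp: corners_def)
  note n = nxt_in[OF t(2,3)] nxt_in[OF t(2) nxt_in[OF t(2,3)]] nxt3[OF t(2,3)]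
  show "turn (t, v) \<in> corners" "turn (turn (turn (t, v))) = (t, v)"
    using t(1,3) n by (simp_all add: turn_def corners_def)
qed

lemma flip_permutes: "flip permutes corners"
proof (rule bij_imp_permutes)
  show "bij_betw flip corners corners"
    by (rule bij_betw_byWitness[of _ flip]) (use flip_corner in auto)
  show "flip x = x" if "x \<notin> corners" for x
    using that by (auto simp: flip_def split: prod.splits)
qed

lemma turn_permutes: "turn permutes corners"
proof (rule bij_imp_permutes)
  show "bij_betw turn corners corners"
  proof (rule bij_betw_byWitness[of _ "turn \<circ> turn"])
    show "\<forall>x\<in>corners. (turn \<circ> turn) (turn x) = x" "\<forall>x\<in>corners. turn ((turn \<circ> turn) x) = x"
      using turn_corner(2) by auto
    show "turn ` corners \<subseteq> corners" using turn_corner(1) by auto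
    have "turn (turn x) \<in> corners" if "x \<in> corners" for x
      using turn_corner(1) that by (metis surj_pair)
    then show "(turn \<circ> turn) ` corners \<subseteq> corners" by auto
  qed
  show "turn x = x" if "x \<notin> corners" for x
    using that by (auto simp: turn_def split: prod.splits)
qed

text \<open>The third power of \<open>turn\<close> is the identity, so its sign has cube 1.\<close>

lemma sign_turn: "sign turn = 1"
proof -
  have p: "permutation turn"
    using turn_permutes fin_corners permutes_imp_permutation by blast
  have "turn \<circ> (turn \<circ> turn) = id"
  proof
    fix x show "(turn \<circ> (turn \<circ> turn)) x = id x"
      by (cases x; cases "x \<in> corners") (use turn_corner in \<open>auto simp: turn_def\<close>)
  qed
  then have "sign turn * (sign turn * sign turn) = 1"
    using p by (metis sign_compose sign_id permutation_compose)
  then show ?thesis by simp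
qed

text \<open>The corners on an edge form one orbit: two exchanged corners at an edge off the seams, a
  fixed corner at a seam edge. So \<open>flip\<close> has as many orbits as \<open>R\<close> has
  edges.\<close>

lemma sign_flip: "sign flip = (-1) ^ (3 * card R + card (es R))"
proof -
  let ?lab = "\<lambda>(t, v). {v, nxt t v}"
  have img: "?lab ` corners = es R"
  proof (intro equalityI subsetI)
    fix e assume "e \<in> ?lab ` corners"
    then show "e \<in> es R"
      using RT nxt_in nxt_neq edge_subset[of _ _ _ R] by (fastforce simp: corners_def)
  next
    fix e assume "e \<in> es R"
    then obtain t where t: "t \<in> R" "e \<subseteq> t" "card e = 2" by (auto simp: es_def)
    then obtain v w where e: "e = {v, w}" "v \<noteq> w" by (meson card_2_iff)
    have "nxt t v = w \<or> nxt t w = v" using nxt_cases[of t v w] t e RT by auto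
    then have "e = ?lab (t, v) \<or> e = ?lab (t, w)" using e by auto
    moreover have "(t, v) \<in> corners" "(t, w) \<in> corners" using t e by (auto simp: corners_def)
    ultimately show "e \<in> ?lab ` corners" by blast
  qed
  have "sign flip = (-1) ^ (card corners + card (?lab ` corners))"
  proof (rule sign_eq_card_orbits[OF fin_corners flip_permutes])
    fix x assume "x \<in> corners"
    then show "?lab (flip x) = ?lab x"
      using flip_corner(3)[of "fst x" "snd x"] by (cases x) (auto simp: case_prod_beta)
  next
    fix P and x y
    assume P: "\<And>z. z \<in> corners \<Longrightarrow> P (flip z) = P z" and xy: "x \<in> corners" "y \<in> corners" "?lab x = ?lab y" "P x"
    obtain t v s w where x: "x = (t, v)" and y: "y = (s, w)" by (metis surj_pair)
    have t: "t \<in> R" "t \<in> T" "v \<in> t" and s: "s \<in> R" "s \<in> T" "w \<in> s"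
      using xy RT by (auto simp: corners_def x y)
    have eq: "{v, nxt t v} = {w, nxt s w}" using xy by (simp add: x y)
    show "P y"
    proof (cases "s = t")
      case True
      then have "v = w"
        using eq nxt_neq[of t v] nxt2_neq[of t v] t by (metis doubleton_eq_iff)
      then show ?thesis using True xy x y by simp
    next
      case False
      have "s \<in> {s\<in>T. {v, nxt t v} \<subseteq> s}" using eq s nxt_in[of s w] by auto
      then have so: "s = opp t v" using triangles_at_edge[of t v] t False by auto
      then have "{v, nxt t v} \<notin> \<Union>\<S>" using seam_iff[of t v] t s by simp
      then have f: "flip x = (s, nxt t v)" using xy so by (simp add: flip_def x)
      have "w = nxt t v"
      proof (rule ccontr)
        assume "w \<noteq> nxt t v"
        then have "w = v" "nxt s v = nxt t v" using eq by (auto simp: doubleton_eq_iff)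
        moreover have "nxt s (nxt t v) = v" using opp(5)[of t v] so t by simp
        ultimately show False using nxt2_neq[of s v] s by simp
      qed
      then show ?thesis using P[of x] xy f y by simp
    qed
  qed
  then show ?thesis by (simp add: img card_corners)
qed

text \<open>At an edge off the seams \<open>rot\<close> turns around \<open>v\<close> into the next
  triangle; at a seam edge it stays in the triangle and advances to the next vertex of the seam. In
  this way all corners at the vertices of one seam are strung into one orbit.\<close>

definition rot :: "'v set \<times> 'v \<Rightarrow> 'v set \<times> 'v" where
  "rot = turn \<circ> flip"

lemma rot_permutes: "rot permutes corners"
  unfolding rot_def by (rule permutes_compose[OF flip_permutes turn_permutes])

lemma sign_rot: "sign rot = sign flip"
proof -
  have "permutation turn" "permutation flip"
    using turn_permutes flip_permutes fin_corners permutes_imp_permutation by blast+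
  then show ?thesis by (simp add: rot_def sign_compose sign_turn)
qed

lemma rot_inner:
  assumes "t \<in> R" "v \<in> t" "{v, nxt t v} \<notin> \<Union>\<S>"
  shows "rot (t, v) = (opp t v, v)"
proof -
  have c: "(t, v) \<in> corners" using assms by (simp add: corners_def)
  then have f: "flip (t, v) = (opp t v, nxt t v)" using assms(3) by (simp add: flip_def del: Union_iff)
  then have "(opp t v, nxt t v) \<in> corners" using flip_corner(1)[OF c] by simp
  then have "turn (opp t v, nxt t v) = (opp t v, v)"
    using opp(5)[OF RT[OF assms(1)] assms(2)] by (simp add: turn_def)
  then show ?thesis using f by (simp add: rot_def)
qed

lemma rot_seam: "t \<in> R \<Longrightarrow> v \<in> t \<Longrightarrow> {v, nxt t v} \<in> \<Union>\<S> \<Longrightarrow> rot (t, v) = (t, nxt t v)"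
  by (simp add: rot_def flip_def turn_def corners_def del: Union_iff)

lemma nonseam_sides:
  assumes "e \<in> es T" "e \<notin> \<Union>\<S>" "t \<in> T" "t' \<in> T" "e \<subseteq> t" "e \<subseteq> t'" "t \<in> R"
  shows "t' \<in> R"
proof (rule ccontr)
  assume "t' \<notin> R"
  obtain a b where ab: "{s\<in>T. e \<subseteq> s} = {a, b}" by (rule two_triangles[OF assms(1)]) (rule that)
  have "t \<in> {s\<in>T. e \<subseteq> s}" "t' \<in> {s\<in>T. e \<subseteq> s}" using assms(3-6) by blast+
  moreover have "t \<noteq> t'" using assms(7) \<open>t' \<notin> R\<close> by blast
  ultimately have "{s\<in>T. e \<subseteq> s} = {t, t'}" unfolding ab by blast
  then have "{s\<in>R. e \<subseteq> s} = {t}" using R \<open>t' \<notin> R\<close> assms(5,7) by blast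
  then show False using bd[OF assms(1)] assms(2) by simp
qed

lemma unique_seam:
  assumes "v \<in> \<Union>S" "S \<in> \<S>"
  shows "(THE S. S \<in> \<S> \<and> v \<in> \<Union>S) = S"
  using assms disj by (intro the_equality) blast+

section \<open>The orbits of \<open>rot\<close>, seen through invariant predicates\<close>

context
  fixes P :: "'v set \<times> 'v \<Rightarrow> bool"
  assumes P: "\<And>z. z \<in> corners \<Longrightarrow> P (rot z) = P z"
begin

text \<open>Depending on which of the two triangles directs the common edge away from
  \<open>v\<close>, the passage is a step of \<open>rot\<close> or of its inverse.\<close>

lemma P_inner_step:
  assumes "t \<in> R" "t' \<in> T" "t \<inter> t' = {v, w}" "v \<noteq> w" "{v, w} \<notin> \<Union>\<S>"
  shows "t' \<in> R \<and> P (t', v) = P (t, v)"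
proof -
  have vt: "v \<in> t" "w \<in> t" "v \<in> t'" "w \<in> t'" using assms(3) by blast+
  have t'R: "t' \<in> R"
    by (rule nonseam_sides[of "{v, w}" t t']) (use edge_subset[of v t w T] assms(1,2,4,5) vt RT in auto)
  have ne: "t \<noteq> t'"
  proof
    assume "t = t'"
    then have "card t = card {v, w}" using assms(3) by simp
    then show False using card3[OF RT[OF assms(1)]] assms(4) by simp
  qed
  have "nxt t v = w \<or> nxt t w = v"
    using nxt_cases[of t v w] vt assms RT by auto
  then show ?thesis
  proof
    assume w: "nxt t v = w"
    then have "t' = opp t v"
      using opp_unique[of t v t'] vt assms ne RT by auto
    then have "rot (t, v) = (t', v)" using rot_inner[of t v] w assms vt by simp
    then show ?thesis using P[of "(t, v)"] t'R vt assms(1) by (simp add: corners_def)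
  next
    assume "nxt t w = v"
    then have w: "nxt t' v = w"
      using coherent[of t t' w] vt assms(1,2) RT ne by auto
    then have "t = opp t' v"
      using opp_unique[of t' v t] vt assms ne RT by auto
    then have "rot (t', v) = (t, v)" using rot_inner[of t' v] w assms vt t'R by simp
    then show ?thesis using P[of "(t', v)"] t'R vt by (simp add: corners_def)
  qed
qed

lemma P_inner:
  assumes "t \<in> R" "t' \<in> R" "v \<in> t" "v \<in> t'" "v \<notin> \<Union>(\<Union>\<S>)"
  shows "P (t, v) = P (t', v)"
proof -
  have "(t, t') \<in> {(s, s'). s \<in> T \<and> s' \<in> T \<and> card (s \<inter> s') = 2 \<and> v \<in> s \<inter> s'}\<^sup>*"
    using link assms RT by auto
  then have "t' \<in> R \<and> P (t', v) = P (t, v)"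
  proof (induction rule: rtrancl_induct)
    case base
    then show ?case using assms by simp
  next
    case (step y z)
    then obtain w where "y \<inter> z = {v, w}" "w \<noteq> v" using card_2_other[of "y \<inter> z" v] by auto
    moreover from this have "{v, w} \<notin> \<Union>\<S>" using assms by auto
    ultimately show ?case using P_inner_step[of y z v w] step by auto
  qed
  then show ?thesis by simp
qed

text \<open>Without an exit, turning around \<open>v\<close> would never leave \<open>R\<close>, so
  the whole star of \<open>v\<close> would lie in \<open>R\<close>; but a seam edge at
  \<open>v\<close> has a triangle outside \<open>R\<close>.\<close>

lemma exit_exists:
  assumes t: "t \<in> R" "v \<in> t" and v: "v \<in> \<Union>(\<Union>\<S>)"
  shows "\<exists>x\<in>R. v \<in> x \<and> {v, nxt x v} \<in> \<Union>\<S> \<and> P (x, v) = P (t, v)"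
proof (rule ccontr)
  assume no: "\<not> ?thesis"
  define W where "W = {s\<in>R. v \<in> s \<and> P (s, v) = P (t, v)}"
  have "W = {s\<in>T. v \<in> s}"
  proof (rule star_closed)
    show "W \<subseteq> {s\<in>T. v \<in> s}" using RT by (auto simp: W_def)
    show "W \<noteq> {}" using t by (auto simp: W_def)
    fix s assume "s \<in> W"
    then have s: "s \<in> R" "v \<in> s" "P (s, v) = P (t, v)" by (auto simp: W_def)
    then have ns: "{v, nxt s v} \<notin> \<Union>\<S>" using no by blast
    then have "rot (s, v) = (opp s v, v)" using rot_inner s by simp
    then have "P (opp s v, v) = P (t, v)" using P[of "(s, v)"] s by (simp add: corners_def)
    then show "opp s v \<in> W" using seam_iff[of s v] s ns opp(3)[of s v] RT by (auto simp: W_def)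
  qed
  then have all: "{s\<in>T. v \<in> s} \<subseteq> R" by (auto simp: W_def)
  obtain e where e: "e \<in> \<Union>\<S>" "v \<in> e" using v by auto
  then have eT: "e \<in> es T" using \<S>_es by auto
  have "{s\<in>R. e \<subseteq> s} = {s\<in>T. e \<subseteq> s}" using all e R by auto
  then show False
    using bd[OF eT] e two eT by (auto simp: es_def)
qed

text \<open>An exit is the corner at which \<open>rot\<close> leaves the star of \<open>v\<close> and moves on along the seam. If both
  seam edges at \<open>v\<close> belonged to exits, the triangles at \<open>v\<close> outside \<open>R\<close> would be closed under rotation
  and hence form the whole star.\<close>

lemma exit_unique:
  assumes x: "x \<in> R" "v \<in> x" "{v, nxt x v} \<in> \<Union>\<S>" and y: "y \<in> R" "v \<in> y" "{v, nxt y v} \<in> \<Union>\<S>"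
  shows "x = y"
proof (rule ccontr)
  assume "x \<noteq> y"
  have nn: "s = s'" if s: "s \<in> T" "s' \<in> T" "v \<in> s" "v \<in> s'" "nxt s v = nxt s' v" for s s'
  proof (rule ccontr)
    assume "s \<noteq> s'"
    then have "nxt s' (nxt s' v) = v"
      using coherent[of s s' v] s nxt_in[of s' v] by auto
    then show False using nxt2_neq[of s' v] s by auto
  qed
  obtain S where S: "S \<in> \<S>" "{v, nxt x v} \<in> S" using x by auto
  then have vS: "v \<in> \<Union>S" by auto
  have inS: "e \<in> S" if "e \<in> \<Union>\<S>" "v \<in> e" for e
    using disj[of S] S vS that by blast
  have two_edges: "card {e\<in>S. v \<in> e} = 2"
    using cyc[OF S(1)] vS by (auto simp: cycle_graph_def)
  have ne: "{v, nxt x v} \<noteq> {v, nxt y v}"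
    using nn[of x y] \<open>x \<noteq> y\<close> x y RT by (auto simp: doubleton_eq_iff)
  have "{{v, nxt x v}, {v, nxt y v}} = {e\<in>S. v \<in> e}"
  proof (rule card_subset_eq)
    show "finite {e\<in>S. v \<in> e}" using two_edges by (simp add: card_ge_0_finite)
    show "{{v, nxt x v}, {v, nxt y v}} \<subseteq> {e\<in>S. v \<in> e}" using S inS y by auto
    show "card {{v, nxt x v}, {v, nxt y v}} = card {e\<in>S. v \<in> e}" using ne two_edges by simp
  qed
  then have all: "e \<in> {{v, nxt x v}, {v, nxt y v}}" if "e \<in> \<Union>\<S>" "v \<in> e" for e
    using inS that by blast
  define W where "W = {s\<in>T. v \<in> s \<and> s \<notin> R}"
  have "W = {s\<in>T. v \<in> s}"
  proof (rule star_closed)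
    show "W \<subseteq> {s\<in>T. v \<in> s}" by (auto simp: W_def)
    have "opp x v \<in> W"
      using seam_iff[of x v] x opp(1-5)[of x v] RT by (auto simp: W_def)
    then show "W \<noteq> {}" by auto
    fix s assume "s \<in> W"
    then have s: "s \<in> T" "v \<in> s" "s \<notin> R" by (auto simp: W_def)
    have "{v, nxt s v} \<notin> \<Union>\<S>"
    proof
      assume "{v, nxt s v} \<in> \<Union>\<S>"
      then have "{v, nxt s v} \<in> {{v, nxt x v}, {v, nxt y v}}" using all by blast
      then have "nxt s v = nxt x v \<or> nxt s v = nxt y v" by (auto simp: doubleton_eq_iff)
      then have "s = x \<or> s = y" using nn s x y RT by blast
      then show False using s x y by auto
    qed
    then show "opp s v \<in> W"
      using seam_iff'[of s v] s opp(1-5)[of s v] by (auto simp: W_def)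
  qed
  then show False using x RT by (auto simp: W_def)
qed

text \<open>Turning around \<open>v\<close> from any of its corners in \<open>R\<close> ends at the
  same exit.\<close>

lemma P_seam_vertex:
  assumes "t \<in> R" "t' \<in> R" "v \<in> t" "v \<in> t'" "v \<in> \<Union>(\<Union>\<S>)"
  shows "P (t, v) = P (t', v)"
  using exit_exists[of t v] exit_exists[of t' v] exit_unique assms by metis

lemma P_seam_edge:
  assumes "{v, w} \<in> \<Union>\<S>" "t \<in> R" "v \<in> t" "w \<in> t" "v \<noteq> w"
  shows "P (t, v) = P (t, w)"
proof -
  have "nxt t v = w \<or> nxt t w = v"
    using nxt_cases[of t v w] assms RT by auto
  then show ?thesis
  proof
    assume "nxt t v = w"
    then show ?thesis
      using rot_seam[of t v] P[of "(t, v)"] assms by (simp add: corners_def del: Union_iff)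
  next
    assume "nxt t w = v"
    then show ?thesis
      using rot_seam[of t w] P[of "(t, w)"] assms by (simp add: corners_def insert_commute del: Union_iff)
  qed
qed

lemma P_seam:
  assumes S: "S \<in> \<S>" and t: "t \<in> R" "v \<in> t" "v \<in> \<Union>S" and t': "t' \<in> R" "v' \<in> t'" "v' \<in> \<Union>S"
    and "P (t, v)"
  shows "P (t', v')"
proof -
  have vs: "u \<in> \<Union>(\<Union>\<S>)" if "u \<in> \<Union>S" for u using that S by auto
  have side: "\<exists>s. s \<in> R \<and> e \<subseteq> s" if "e \<in> S" for e
  proof -
    have "card {s\<in>R. e \<subseteq> s} = 1" using bd[of e] \<S>_es that S by auto
    then show ?thesis by (metis (mono_tags, lifting) card_1_singletonE insertI1 mem_Collect_eq)
  qed
  \<comment> \<open>This is what passes from one edge of the seam to the next: along an edge by a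
    step of \<open>rot\<close> in the triangle of \<open>R\<close> at it, at a common vertex by the
    common exit.\<close>
  define X where "X e \<longleftrightarrow> (\<forall>s\<in>R. \<forall>u\<in>e. u \<in> s \<longrightarrow> P (s, u))" for e
  have X: "X e" if e: "e \<in> S" "u \<in> e" "s \<in> R" "u \<in> s" "P (s, u)" for e u s
    unfolding X_def
  proof (intro ballI impI)
    fix s' u' assume s': "s' \<in> R" "u' \<in> e" "u' \<in> s'"
    obtain r where r: "r \<in> R" "e \<subseteq> r" using side e by blast
    have "P (r, u)" using P_seam_vertex[of s r u] e r vs by auto
    then have "P (r, u')"
    proof (cases "u = u'")
      case False
      then have "e = {u, u'}"
        using cyc[OF S] e s' card_2_other[of e u] by (auto simp: cycle_graph_def)
      then show ?thesis using P_seam_edge[of u u' r] r e S False \<open>P (r, u)\<close> by auto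
    qed simp
    then show "P (s', u')" using P_seam_vertex[of s' r u'] s' r e vs by auto
  qed
  obtain e where e: "e \<in> S" "v \<in> e" using t by auto
  obtain e' where e': "e' \<in> S" "v' \<in> e'" using t' by auto
  have Xe: "X e" using X[of e v t] e t assms by auto
  have step: "X b" if ab: "a \<in> S" "b \<in> S" "a \<inter> b \<noteq> {}" "X a" for a b
  proof -
    obtain u where u: "u \<in> a" "u \<in> b" using ab by auto
    obtain r where r: "r \<in> R" "a \<subseteq> r" using side[OF ab(1)] by blast
    then have "P (r, u)" using ab(4) u by (auto simp: X_def)
    moreover obtain r' where r': "r' \<in> R" "b \<subseteq> r'" using side[OF ab(2)] by blast
    ultimately have "P (r', u)" using P_seam_vertex[of r r' u] u r r' vs[of u] ab(1) by blast
    then show ?thesis using X[of b u r'] ab u r' by auto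
  qed
  have "X e'" using step by (rule cycle_graph_connected[where P = X, OF cyc[OF S] _ e(1) e'(1) Xe])
  then show ?thesis using t' e' by (auto simp: X_def)
qed

end

text \<open>The labels of corners are the vertices of the surface obtained from \<open>R\<close> by
  shrinking every seam to a point, which has the same Euler characteristic as capping the seams by
  disks.\<close>

definition vlab :: "'v set \<times> 'v \<Rightarrow> 'v + 'v set set" where
  "vlab = (\<lambda>(t, v). if v \<in> \<Union>(\<Union>\<S>) then Inr (THE S. S \<in> \<S> \<and> v \<in> \<Union>S) else Inl v)"

lemma sign_rot': "sign rot = (-1) ^ (3 * card R + card (vlab ` corners))"
  unfolding card_corners[symmetric]
proof (rule sign_eq_card_orbits[OF fin_corners rot_permutes])
  fix x assume "x \<in> corners"
  then obtain t v where x: "x = (t, v)" "t \<in> R" "v \<in> t" by (auto simp: corners_def)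
  show "vlab (rot x) = vlab x"
  proof (cases "{v, nxt t v} \<in> \<Union>\<S>")
    case True
    then obtain S where S: "S \<in> \<S>" "{v, nxt t v} \<in> S" by auto
    then have "v \<in> \<Union>S" "nxt t v \<in> \<Union>S" by auto
    then show ?thesis using x rot_seam[of t v] True S unique_seam by (auto simp: vlab_def)
  next
    case False
    then show ?thesis using x rot_inner[of t v] by (simp add: vlab_def)
  qed
next
  fix P and x y
  assume P: "\<And>z. z \<in> corners \<Longrightarrow> P (rot z) = P z" and xy: "x \<in> corners" "y \<in> corners" "vlab x = vlab y" "P x"
  obtain t v s w where x: "x = (t, v)" "t \<in> R" "v \<in> t" and y: "y = (s, w)" "s \<in> R" "w \<in> s"
    using xy by (auto simp: corners_def)
  show "P y"
  proof (cases "v \<in> \<Union>(\<Union>\<S>)")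
    case True
    then obtain S where S: "S \<in> \<S>" "v \<in> \<Union>S" by auto
    have w: "w \<in> \<Union>(\<Union>\<S>)" using xy(3) True by (auto simp: vlab_def x y split: if_splits)
    then obtain S' where S': "S' \<in> \<S>" "w \<in> \<Union>S'" by auto
    have "S = S'"
      using xy(3) True w unique_seam S S' by (auto simp: vlab_def x y)
    then show ?thesis using P_seam[where P = P, OF P, of S t v s w] xy S S' x y by auto
  next
    case False
    then have "v = w" using xy(3) by (auto simp: vlab_def x y split: if_splits)
    then show ?thesis using P_inner[where P = P, OF P, of t s v] False xy x y by auto
  qed
qed

lemma vlab_image: "vlab ` corners = Inl ` (\<Union>R - \<Union>(\<Union>\<S>)) \<union> Inr ` \<S>"
proof (intro equalityI subsetI)
  fix l assume "l \<in> vlab ` corners"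
  then obtain t v where l: "l = vlab (t, v)" "t \<in> R" "v \<in> t" by (auto simp: corners_def)
  then show "l \<in> Inl ` (\<Union>R - \<Union>(\<Union>\<S>)) \<union> Inr ` \<S>"
    using unique_seam by (auto simp: vlab_def)
next
  fix l assume "l \<in> Inl ` (\<Union>R - \<Union>(\<Union>\<S>)) \<union> Inr ` \<S>"
  then consider v t where "l = Inl v" "v \<in> t" "t \<in> R" "v \<notin> \<Union>(\<Union>\<S>)" | S where "l = Inr S" "S \<in> \<S>"
    by blast
  then show "l \<in> vlab ` corners"
  proof cases
    case 1
    then have "l = vlab (t, v)" "(t, v) \<in> corners" by (auto simp: vlab_def corners_def)
    then show ?thesis by blast
  next
    case 2
    obtain e where e: "e \<in> S" using cyc[OF 2(2)] by (auto simp: cycle_graph_def)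
    then have "card e = 2" using cyc[OF 2(2)] by (auto simp: cycle_graph_def)
    then obtain v where v: "v \<in> e" by (metis card.empty equals0I zero_neq_numeral)
    have "card {s\<in>R. e \<subseteq> s} = 1" using bd[of e] \<S>_es e 2 by auto
    then obtain t where t: "t \<in> R" "e \<subseteq> t" by (metis (mono_tags, lifting) card_1_singletonE insertI1 mem_Collect_eq)
    have "l = vlab (t, v)" using unique_seam[of v S] v e 2 by (auto simp: vlab_def)
    moreover have "(t, v) \<in> corners" using t v by (auto simp: corners_def)
    ultimately show ?thesis by blast
  qed
qed

section \<open>Counting the cells of a region\<close>

lemma card_seam_vertices: "card (\<Union>(\<Union>\<S>)) = card (\<Union>\<S>)"
proof -
  have fS: "finite S" "finite (\<Union>S)" "card S = card (\<Union>S)" if "S \<in> \<S>" for S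
  proof -
    show "finite S" "card S = card (\<Union>S)" using cyc[OF that] by (auto simp: cycle_graph_def)
    have "finite e" if "e \<in> S" for e 
      using cyc[OF \<open>S \<in> \<S>\<close>] that by (metis card.infinite cycle_graph_def zero_neq_numeral)
    then show "finite (\<Union>S)" using \<open>finite S\<close> by auto
  qed
  have dis: "S \<inter> S' = {}" if "S \<in> \<S>" "S' \<in> \<S>" "S \<noteq> S'" for S S'
  proof (rule ccontr)
    assume "S \<inter> S' \<noteq> {}"
    then obtain e where e: "e \<in> S" "e \<in> S'" by auto
    have "card e = 2" by (rule cycle_graph_card2[OF cyc[OF that(1)] e(1)])
    then have "e \<noteq> {}" by auto
    then show False using disj[OF that] e by blast
  qed
  have 1: "\<Union>(\<Union>\<S>) = (\<Union>S\<in>\<S>. \<Union>S)" by blast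
  have "card (\<Union>(\<Union>\<S>)) = (\<Sum>S\<in>\<S>. card (\<Union>S))"
    unfolding 1 by (rule card_UN_disjoint) (use fin\<S> fS(2) disj in blast)+
  also have "\<dots> = (\<Sum>S\<in>\<S>. card S)" by (intro sum.cong refl) (simp add: fS(3))
  also have "\<dots> = card (\<Union>\<S>)"
    by (rule card_Union_disjoint[symmetric]) (use fS(1) dis in \<open>auto simp: pairwise_def disjnt_def\<close>)
  finally show ?thesis .
qed

text \<open>Double counting of the incidences between edges and triangles of \<open>R\<close>: three
  edges at each triangle, two triangles at each edge, but only one at a seam edge.\<close>

lemma card_seams: "3 * card R + card (\<Union>\<S>) = 2 * card (es R)"
proof -
  have fR: "finite R" using R finT finite_subset by blast
  have fe: "finite (es R)" using fin_es R by simp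
  have "(\<Sum>e\<in>es R. card {t\<in>R. e \<subseteq> t}) = (\<Sum>t\<in>R. card {e\<in>es R. e \<subseteq> t})"
    using sum_multicount_gen[of R "es R" "\<lambda>t e. e \<subseteq> t" "\<lambda>e. card {t\<in>R. e \<subseteq> t}"] fR fe by simp
  moreover have "(\<Sum>t\<in>R. card {e\<in>es R. e \<subseteq> t}) = (\<Sum>t\<in>R. 3)"
  proof (rule sum.cong)
    fix t assume "t \<in> R"
    then have "{e\<in>es R. e \<subseteq> t} = {e. e \<subseteq> t \<and> card e = 2}" by (auto simp: es_def)
    moreover have "card {e. e \<subseteq> t \<and> card e = 2} = 3 choose 2"
      using n_subsets[of t 2] fint[of t] card3[of t] RT \<open>t \<in> R\<close> by simp
    moreover have "(3::nat) choose 2 = 3" by (simp add: numeral_eq_Suc)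
    ultimately show "card {e\<in>es R. e \<subseteq> t} = 3" by simp
  qed simp
  moreover have "\<Union>\<S> \<subseteq> es R"
  proof
    fix e assume e: "e \<in> \<Union>\<S>"
    then have "card {s\<in>R. e \<subseteq> s} = 1" using bd[of e] \<S>_es by auto
    then obtain t where t: "t \<in> R" "e \<subseteq> t" by (metis (mono_tags, lifting) card_1_singletonE insertI1 mem_Collect_eq)
    then show "e \<in> es R" using e \<S>_es by (auto simp: es_def)
  qed
  moreover have "(\<Sum>e\<in>es R. card {t\<in>R. e \<subseteq> t}) + card (\<Union>\<S>) = (\<Sum>e\<in>es R. card {t\<in>R. e \<subseteq> t} + (if e \<in> \<Union>\<S> then 1 else 0))"
    using sum.inter_restrict[OF fe, of "\<lambda>_. 1::nat" "\<Union>\<S>"] \<open>\<Union>\<S> \<subseteq> es R\<close>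
    by (simp add: sum.distrib Int_absorb1 del: Union_iff)
  moreover have "\<dots> = (\<Sum>e\<in>es R. 2)"
  proof (rule sum.cong)
    fix e assume e: "e \<in> es R"
    then have eT: "e \<in> es T" using R unfolding es_def by blast
    have "card {t\<in>R. e \<subseteq> t} \<le> card {t\<in>T. e \<subseteq> t}"
      using R finT by (intro card_mono) auto
    moreover have "card {t\<in>T. e \<subseteq> t} = 2" using two eT by (auto simp: es_def)
    moreover have "card {t\<in>R. e \<subseteq> t} \<noteq> 0" using e fR by (auto simp: es_def)
    moreover have "e \<in> \<Union>\<S> \<longleftrightarrow> card {t\<in>R. e \<subseteq> t} = 1" by (rule bd[OF eT])
    ultimately show "card {t\<in>R. e \<subseteq> t} + (if e \<in> \<Union>\<S> then 1 else 0) = 2" by auto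
  qed simp
  ultimately show ?thesis by simp
qed

lemma seam_vertices_subset: "\<Union>(\<Union>\<S>) \<subseteq> \<Union>R"
proof
  fix v assume "v \<in> \<Union>(\<Union>\<S>)"
  then obtain e where e: "e \<in> \<Union>\<S>" "v \<in> e" by auto
  then have "card {s\<in>R. e \<subseteq> s} = 1" using bd[of e] \<S>_es by auto
  then obtain t where t: "t \<in> R" "e \<subseteq> t" by (metis (mono_tags, lifting) card_1_singletonE insertI1 mem_Collect_eq)
  then show "v \<in> \<Union>R" using e by auto
qed

text \<open>The two values of the sign show that, modulo 2, the edges number as many as the inner
  vertices plus the seams. What remains are the triangles and the seam vertices, and these have
  equal parity by \<open>card_seams\<close>, a seam having as many vertices as edges.\<close>

theorem even_chi: "even (chi R + int (card \<S>))"
proof -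
  have fV: "finite (\<Union>R)" using fin_V R by simp
  have "card (vlab ` corners) = card (\<Union>R - \<Union>(\<Union>\<S>)) + card \<S>"
    unfolding vlab_image using fV fin\<S> by (subst card_Un_disjoint) (auto simp: card_image)
  then have "(-1::int) ^ (3 * card R + (card (\<Union>R - \<Union>(\<Union>\<S>)) + card \<S>)) = (-1) ^ (3 * card R + card (es R))"
    using sign_rot sign_rot' sign_flip by simp
  then have "even (card (\<Union>R - \<Union>(\<Union>\<S>)) + card \<S> + card (es R))"
    by (auto simp: minus_one_power_iff split: if_splits)
  moreover have "card (\<Union>R) = card (\<Union>R - \<Union>(\<Union>\<S>)) + card (\<Union>\<S>)"
    using card_seam_vertices seam_vertices_subset fV
    by (metis card_Diff_subset card_mono finite_subset le_add_diff_inverse2)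
  ultimately show ?thesis
    using card_seams unfolding chi_def by presburger
qed

end

section \<open>Components and colorings\<close>

locale seamed = oriented_surface T nxt for T :: "'v set set" and nxt +
  fixes SS :: "'v set set set" and sd :: "'v set \<Rightarrow> 'v set"
  assumes finSS: "finite SS"
    and cyc: "S \<in> SS \<Longrightarrow> cycle_graph S"
    and disj: "S \<in> SS \<Longrightarrow> S' \<in> SS \<Longrightarrow> S \<noteq> S' \<Longrightarrow> \<Union>S \<inter> \<Union>S' = {}"
    and SS_es: "\<Union>SS \<subseteq> es T"
    and sd: "S \<in> SS \<Longrightarrow> e \<in> S \<Longrightarrow> sd e \<in> T \<and> e \<subseteq> sd e"
    and sd_coherent: "S \<in> SS \<Longrightarrow> e \<in> S \<Longrightarrow> e' \<in> S \<Longrightarrow> v \<in> e \<Longrightarrow> v \<in> e' \<Longrightarrow>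
      (sd e, sd e') \<in> {(t, t'). t \<in> T \<and> t' \<in> T \<and> (\<exists>a. card a = 2 \<and> v \<in> a \<and> a \<notin> S \<and> a \<subseteq> t \<and> a \<subseteq> t')}\<^sup>*"
begin

section \<open>Components and checkerboard sets of triangles\<close>

definition adj :: "('v set \<times> 'v set) set" where
  "adj = {(t, t'). t \<in> T \<and> t' \<in> T \<and> card (t \<inter> t') = 2}"

definition component :: "'v set \<Rightarrow> 'v set set" where
  "component t = {t'\<in>T. (t, t') \<in> adj\<^sup>*}"

definition Q :: "'v set set set" where
  "Q = component ` T"

text \<open>The triangles of color 1 in an admissible coloring: the boundary condition is that of
  \<open>region\<close>, and the other color is \<open>T - A\<close>.\<close>

definition checker :: "'v set set \<Rightarrow> bool" where
  "checker A \<longleftrightarrow> A \<subseteq> T \<and> (\<forall>e\<in>es T. e \<in> \<Union>SS \<longleftrightarrow> card {t\<in>A. e \<subseteq> t} = 1)"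

definition SSq :: "'v set set \<Rightarrow> 'v set set set" where
  "SSq q = {S\<in>SS. \<exists>e\<in>S. \<exists>t\<in>q. e \<subseteq> t}"

lemma adj_sym: "sym (adj\<^sup>*)"
  by (rule sym_rtrancl) (auto simp: adj_def sym_def Int_commute)

lemma component_self: "t \<in> T \<Longrightarrow> t \<in> component t"
  by (simp add: component_def)

lemma component_eq:
  assumes "(t, t') \<in> adj\<^sup>*" shows "component t = component t'"
proof -
  have "(t', t) \<in> adj\<^sup>*" using assms adj_sym by (simp add: sym_def)
  then show ?thesis using assms unfolding component_def by (auto intro: rtrancl_trans)
qed

lemma Q_eq: "q \<in> Q \<Longrightarrow> t \<in> q \<Longrightarrow> q = component t \<and> t \<in> T"
  using component_eq by (auto simp: Q_def component_def)

lemma Q_subset: "q \<in> Q \<Longrightarrow> q \<subseteq> T"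
  by (auto simp: Q_def component_def)

lemma Q_adj: "q \<in> Q \<Longrightarrow> t \<in> q \<Longrightarrow> t' \<in> T \<Longrightarrow> (t, t') \<in> adj\<^sup>* \<Longrightarrow> t' \<in> q"
  using Q_eq[of q t] by (simp add: component_def)

lemma Q_disj: "q \<in> Q \<Longrightarrow> q' \<in> Q \<Longrightarrow> q \<noteq> q' \<Longrightarrow> q \<inter> q' = {}"
  using Q_eq by blast

lemma finQ: "finite Q"
  using finT by (simp add: Q_def)

lemma UnQ: "\<Union>Q = T"
proof
  show "\<Union>Q \<subseteq> T" using Q_subset by blast
  show "T \<subseteq> \<Union>Q" using component_self by (auto simp: Q_def)
qed

lemma vertex_adj:
  assumes "t \<in> T" "t' \<in> T" "v \<in> t" "v \<in> t'"
  shows "(t, t') \<in> adj\<^sup>*"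
proof -
  have "(t, t') \<in> {(s, s'). s \<in> T \<and> s' \<in> T \<and> card (s \<inter> s') = 2 \<and> v \<in> s \<inter> s'}\<^sup>*" by (rule link[OF assms])
  moreover have "{(s, s'). s \<in> T \<and> s' \<in> T \<and> card (s \<inter> s') = 2 \<and> v \<in> s \<inter> s'} \<subseteq> adj" by (auto simp: adj_def)
  ultimately show ?thesis using rtrancl_mono by blast
qed

lemma edge_nonempty: "card e = 2 \<Longrightarrow> \<exists>v. v \<in> e"
  by (metis card.empty equals0I zero_neq_numeral)

lemma edge_adj:
  assumes "t \<in> T" "t' \<in> T" "card e = 2" "e \<subseteq> t" "e \<subseteq> t'"
  shows "(t, t') \<in> adj\<^sup>*"
  using edge_nonempty[OF assms(3)] vertex_adj[OF assms(1,2)] assms(4,5) by blast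

text \<open>Consecutive edges of a seam share a vertex, and all triangles at a vertex lie in one
  component; so a seam cannot leave its component.\<close>

lemma seam_adj:
  assumes S: "S \<in> SS" and "e \<in> S" "e' \<in> S" "t \<in> T" "e \<subseteq> t" "t' \<in> T" "e' \<subseteq> t'"
  shows "(t, t') \<in> adj\<^sup>*"
proof -
  define X where "X a \<longleftrightarrow> (\<forall>s\<in>T. a \<subseteq> s \<longrightarrow> (t, s) \<in> adj\<^sup>*)" for a
  have c2: "card a = 2" if "a \<in> S" for a using cycle_graph_card2[OF cyc[OF S] that] .
  have "X e'"
  proof (rule cycle_graph_connected[where P = X, OF cyc[OF S]])
    show "e \<in> S" "e' \<in> S" by fact+
    show "X e" unfolding X_def using edge_adj[OF assms(4) _ c2[OF assms(2)] assms(5)] by blast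
    fix a b assume ab: "a \<in> S" "b \<in> S" "a \<inter> b \<noteq> {}" "X a"
    obtain v where v: "v \<in> a" "v \<in> b" using ab(3) by blast
    obtain r where r: "r \<in> T" "a \<subseteq> r" using ab(1) S SS_es by (auto simp: es_def)
    have "(t, r) \<in> adj\<^sup>*" using ab(4) r by (auto simp: X_def)
    show "X b"
      unfolding X_def
    proof (intro ballI impI)
      fix s assume s: "s \<in> T" "b \<subseteq> s"
      have "(r, s) \<in> adj\<^sup>*" using vertex_adj[OF r(1) s(1), of v] v r s by blast
      then show "(t, s) \<in> adj\<^sup>*" using \<open>(t, r) \<in> adj\<^sup>*\<close> by (rule rtrancl_trans[rotated])
    qed
  qed
  then show ?thesis using assms(6,7) by (simp add: X_def)
qed

lemma SSq_triangle:
  assumes q: "q \<in> Q" and "S \<in> SSq q" "e \<in> S" "t \<in> T" "e \<subseteq> t" shows "t \<in> q"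
proof -
  obtain e' t' where e': "S \<in> SS" "e' \<in> S" "t' \<in> q" "e' \<subseteq> t'" using assms(2) unfolding SSq_def by blast
  then have "t' \<in> T" using Q_subset[OF q] by blast
  then have "(t', t) \<in> adj\<^sup>*" using seam_adj[OF e'(1,2) assms(3) _ e'(4) assms(4,5)] by blast
  then show ?thesis by (rule Q_adj[OF q e'(3) assms(4)])
qed

lemma SSq_I:
  assumes "q \<in> Q" "S \<in> SS" "e \<in> S" "t \<in> q" "e \<subseteq> t" shows "S \<in> SSq q"
  using assms by (auto simp: SSq_def)

lemma checker_subset: "checker A \<Longrightarrow> A \<subseteq> T" by (simp add: checker_def)

lemma fin_sub: "A \<subseteq> T \<Longrightarrow> finite A" using finT finite_subset by blast

lemma sides:
  assumes "t \<in> T" "t' \<in> T" "t \<noteq> t'" "e \<subseteq> t" "e \<subseteq> t'" "card e = 2"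
  shows "{s\<in>T. e \<subseteq> s} = {t, t'}"
proof (rule sym, rule card_subset_eq)
  show "finite {s\<in>T. e \<subseteq> s}" using finT by simp
  show "{t, t'} \<subseteq> {s\<in>T. e \<subseteq> s}" using assms by blast
  show "card {t, t'} = card {s\<in>T. e \<subseteq> s}" using two[OF assms(1,4,6)] assms(3) by simp
qed

lemma sides_A:
  assumes "t \<in> T" "t' \<in> T" "t \<noteq> t'" "e \<subseteq> t" "e \<subseteq> t'" "card e = 2" "A \<subseteq> T"
  shows "card {s\<in>A. e \<subseteq> s} = of_bool (t \<in> A) + of_bool (t' \<in> A)"
proof -
  have "{s\<in>A. e \<subseteq> s} = {s\<in>T. e \<subseteq> s} \<inter> A" using assms(7) by blast
  then show ?thesis unfolding sides[OF assms(1-6)] using assms(3) by (simp add: Int_insert_left)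
qed

lemma checker_adj:
  assumes "checker A" "t \<in> T" "t' \<in> T" "t \<noteq> t'" "e \<subseteq> t" "e \<subseteq> t'" "card e = 2"
  shows "e \<in> \<Union>SS \<longleftrightarrow> (t \<in> A) \<noteq> (t' \<in> A)"
proof -
  have "e \<in> es T" using assms by (auto simp: es_def)
  then have "e \<in> \<Union>SS \<longleftrightarrow> card {s\<in>A. e \<subseteq> s} = 1" using assms(1) unfolding checker_def by blast
  then show ?thesis unfolding sides_A[OF assms(2-7) checker_subset[OF assms(1)]] by simp
qed

lemma two_sides:
  assumes "e \<in> es T"
  obtains t t' where "t \<in> T" "t' \<in> T" "t \<noteq> t'" "e \<subseteq> t" "e \<subseteq> t'" "card e = 2"
proof -
  have "card e = 2" using assms by (simp add: es_def)
  then show ?thesis using that two_triangles[OF assms] by metis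
qed

lemma checkerI:
  assumes "A \<subseteq> T" "\<And>t t' e. t \<in> T \<Longrightarrow> t' \<in> T \<Longrightarrow> t \<noteq> t' \<Longrightarrow> e \<subseteq> t \<Longrightarrow> e \<subseteq> t' \<Longrightarrow> card e = 2 \<Longrightarrow>
    e \<in> \<Union>SS \<longleftrightarrow> (t \<in> A) \<noteq> (t' \<in> A)"
  shows "checker A"
  unfolding checker_def
proof (intro conjI ballI)
  fix e assume "e \<in> es T"
  then obtain t t' where t: "t \<in> T" "t' \<in> T" "t \<noteq> t'" "e \<subseteq> t" "e \<subseteq> t'" "card e = 2" by (rule two_sides)
  show "e \<in> \<Union>SS \<longleftrightarrow> card {s\<in>A. e \<subseteq> s} = 1"
    unfolding sides_A[OF t assms(1)] assms(2)[OF t] by simp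
qed (rule assms(1))

lemma checker_compl: "checker A \<Longrightarrow> checker (T - A)"
proof (rule checkerI)
  fix t t' e assume A: "checker A" and t: "t \<in> T" "t' \<in> T" "t \<noteq> t'" "e \<subseteq> t" "e \<subseteq> t'" "card e = 2"
  show "e \<in> \<Union>SS \<longleftrightarrow> (t \<in> T - A) \<noteq> (t' \<in> T - A)"
    using t(1,2) unfolding checker_adj[OF A t] by simp
qed simp

text \<open>Cutting down to a component creates no new boundary, since both triangles at an edge lie
  in the same component.\<close>

lemma region_q:
  assumes A: "checker A" and q: "q \<in> Q"
  shows "region T nxt (A \<inter> q) (SSq q)"
proof (unfold_locales)
  show "A \<inter> q \<subseteq> T" using Q_subset[OF q] by blast
  show "finite (SSq q)" using finSS by (simp add: SSq_def)
  show "cycle_graph S" if "S \<in> SSq q" for S using cyc that by (simp add: SSq_def)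
  show "\<Union>S \<inter> \<Union>S' = {}" if "S \<in> SSq q" "S' \<in> SSq q" "S \<noteq> S'" for S S'
    using disj[of S S'] that by (simp add: SSq_def)
  show "\<Union>(SSq q) \<subseteq> es T" using SS_es by (auto simp: SSq_def)
  fix e assume e: "e \<in> es T"
  obtain t t' where t: "t \<in> T" "t' \<in> T" "t \<noteq> t'" "e \<subseteq> t" "e \<subseteq> t'" "card e = 2" using e by (rule two_sides)
  have tt': "t' \<in> q \<longleftrightarrow> t \<in> q"
    using Q_adj[OF q] edge_adj[OF t(1,2,6,4,5)] edge_adj[OF t(2,1,6,5,4)] t(1,2) by blast
  have "A \<inter> q \<subseteq> T" using Q_subset[OF q] by blast
  note c = sides_A[OF t this]
  have "e \<in> \<Union>(SSq q) \<longleftrightarrow> e \<in> \<Union>SS \<and> t \<in> q"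
  proof
    assume "e \<in> \<Union>(SSq q)"
    then obtain S where S: "S \<in> SSq q" "e \<in> S" by blast
    then have "t \<in> q" using SSq_triangle[OF q] t by blast
    then show "e \<in> \<Union>SS \<and> t \<in> q" using S by (auto simp: SSq_def)
  next
    assume "e \<in> \<Union>SS \<and> t \<in> q"
    then show "e \<in> \<Union>(SSq q)" using SSq_I[OF q] t(4) by blast
  qed
  then show "e \<in> \<Union>(SSq q) \<longleftrightarrow> card {t\<in>A \<inter> q. e \<subseteq> t} = 1"
    unfolding c checker_adj[OF A t] using tt' by auto
qed

lemma region_compl:
  assumes A: "checker A" and q: "q \<in> Q"
  shows "region T nxt (q - A) (SSq q)"
proof -
  have "(T - A) \<inter> q = q - A" using Q_subset[OF q] by blast
  then show ?thesis using region_q[OF checker_compl[OF A] q] by simp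
qed

lemma even_chi_q:
  assumes "checker A" "q \<in> Q"
  shows "even (chi (A \<inter> q) + int (card (SSq q)))" "even (chi (q - A) + int (card (SSq q)))"
  using region.even_chi[OF region_q[OF assms]] region.even_chi[OF region_compl[OF assms]] .

text \<open>The two colored parts of a component overlap in the seams only, and circles have Euler
  characteristic 0.\<close>

lemma chi_split:
  assumes A: "checker A" and q: "q \<in> Q"
  shows "chi (A \<inter> q) + chi (q - A) = chi q"
proof -
  note r1 = region_q[OF A q] and r2 = region_compl[OF A q]
  have qT: "q \<subseteq> T" using Q_subset[OF q] .
  then have sub: "A \<inter> q \<subseteq> T" "q - A \<subseteq> T" by blast+
  \<comment> \<open>Around a vertex off the seams no edge changes the color, so a vertex common to
    both parts lies on a seam.\<close>
  have V: "\<Union>(A \<inter> q) \<inter> \<Union>(q - A) = \<Union>(\<Union>(SSq q))"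
  proof (intro equalityI subsetI)
    fix v assume "v \<in> \<Union>(\<Union>(SSq q))"
    then show "v \<in> \<Union>(A \<inter> q) \<inter> \<Union>(q - A)"
      using region.seam_vertices_subset[OF r1] region.seam_vertices_subset[OF r2] by blast
  next
    fix v assume "v \<in> \<Union>(A \<inter> q) \<inter> \<Union>(q - A)"
    then obtain t t' where t: "t \<in> A" "t \<in> q" "v \<in> t" "t' \<in> q" "t' \<notin> A" "v \<in> t'" by blast
    show "v \<in> \<Union>(\<Union>(SSq q))"
    proof (rule ccontr)
      assume no: "v \<notin> \<Union>(\<Union>(SSq q))"
      have "(t, t') \<in> {(s, s'). s \<in> T \<and> s' \<in> T \<and> card (s \<inter> s') = 2 \<and> v \<in> s \<inter> s'}\<^sup>*"
        using link[of t t' v] t qT by blast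
      then have "t' \<in> A \<and> t' \<in> q"
      proof (induction rule: rtrancl_induct)
        case base
        then show ?case using t by simp
      next
        case (step y z)
        then have yz: "y \<in> T" "z \<in> T" "card (y \<inter> z) = 2" "v \<in> y \<inter> z" "y \<in> A" "y \<in> q" by auto
        have "y \<inter> z \<notin> \<Union>SS"
        proof
          assume "y \<inter> z \<in> \<Union>SS"
          then have "y \<inter> z \<in> \<Union>(SSq q)" using SSq_I[OF q _ _ yz(6)] by blast
          then show False using no yz(4) by blast
        qed
        moreover have "y \<noteq> z" using yz(3) card3[OF yz(1)] by auto
        ultimately have "z \<in> A" using checker_adj[OF A yz(1,2), of "y \<inter> z"] yz(3,5) by blast
        moreover have "z \<in> q"
          using Q_adj[OF q yz(6,2)] edge_adj[OF yz(1,2,3)] by blast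
        ultimately show ?case by blast
      qed
      then show False using t by simp
    qed
  qed
  have E: "es (A \<inter> q) \<inter> es (q - A) = \<Union>(SSq q)"
  proof (intro equalityI subsetI)
    fix e assume "e \<in> es (A \<inter> q) \<inter> es (q - A)"
    then obtain t t' where t: "card e = 2" "t \<in> A" "t \<in> q" "e \<subseteq> t" "t' \<in> q" "t' \<notin> A" "e \<subseteq> t'"
      by (auto simp: es_def)
    then have tt: "t \<in> T" "t' \<in> T" "t \<noteq> t'" using qT by auto
    have "e \<in> \<Union>SS" using checker_adj[OF A tt t(4,7,1)] t(2,6) by simp
    then obtain S where "S \<in> SS" "e \<in> S" by blast
    then show "e \<in> \<Union>(SSq q)" using SSq_I[OF q _ _ t(3,4)] by blast
  next
    fix e assume e: "e \<in> \<Union>(SSq q)"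
    then have eT: "e \<in> es T" using region.\<S>_es[OF r1] by blast
    then have "card {t\<in>A \<inter> q. e \<subseteq> t} = 1" "card {t\<in>q - A. e \<subseteq> t} = 1"
      using region.bd[OF r1 eT] region.bd[OF r2 eT] e by simp_all
    then have "{t\<in>A \<inter> q. e \<subseteq> t} \<noteq> {}" "{t\<in>q - A. e \<subseteq> t} \<noteq> {}" by (metis card.empty zero_neq_one)+
    moreover have "card e = 2" using eT by (simp add: es_def)
    ultimately show "e \<in> es (A \<inter> q) \<inter> es (q - A)" unfolding es_def by blast
  qed
  have UV: "\<Union>(A \<inter> q) \<union> \<Union>(q - A) = \<Union>q" by blast
  have UE: "es (A \<inter> q) \<union> es (q - A) = es q" unfolding es_def by blast
  have "card (A \<inter> q) + card (q - A) = card q"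
    using card_Int_Diff[OF fin_sub[OF qT], of A] by (simp add: Int_commute)
  moreover have "card (\<Union>(A \<inter> q)) + card (\<Union>(q - A)) = card (\<Union>q) + card (\<Union>(\<Union>(SSq q)))"
    using card_Un_Int[OF fin_V[OF sub(1)] fin_V[OF sub(2)]] unfolding V UV .
  moreover have "card (es (A \<inter> q)) + card (es (q - A)) = card (es q) + card (\<Union>(SSq q))"
    using card_Un_Int[OF fin_es[OF sub(1)] fin_es[OF sub(2)]] unfolding E UE .
  ultimately show ?thesis
    using region.card_seam_vertices[OF r1] unfolding chi_def by linarith
qed

lemma even_chi_component:
  assumes "checker A" "q \<in> Q"
  shows "even (chi q)"
  using even_chi_q[OF assms] chi_split[OF assms] by presburger

text \<open>Distinct components share no vertex, because triangles at a common vertex are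
  connected.\<close>

lemma chi_sum:
  assumes A: "A \<subseteq> T"
  shows "chi A = (\<Sum>q\<in>Q. chi (A \<inter> q))"
proof -
  have sub: "A \<inter> q \<subseteq> T" for q using A by blast
  have 1: "A = (\<Union>q\<in>Q. A \<inter> q)" using UnQ A by blast
  have c1: "card A = (\<Sum>q\<in>Q. card (A \<inter> q))"
    using card_UN_disjoint[of Q "\<lambda>q. A \<inter> q"] finQ fin_sub[OF sub] Q_disj 1 by (metis (no_types, lifting) Int_assoc inf.left_commute inf_bot_right)
  have 2: "\<Union>A = (\<Union>q\<in>Q. \<Union>(A \<inter> q))" using UnQ A by blast
  have d2: "\<Union>(A \<inter> q) \<inter> \<Union>(A \<inter> q') = {}" if "q \<in> Q" "q' \<in> Q" "q \<noteq> q'" for q q'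
  proof (rule ccontr)
    assume "\<not> ?thesis"
    then obtain t t' v where "t \<in> q" "t' \<in> q'" "v \<in> t" "v \<in> t'" by blast
    then have "t' \<in> q" using vertex_adj[of t t' v] Q_adj[OF that(1), of t t'] Q_subset that by blast
    then show False using Q_disj[OF that] \<open>t' \<in> q'\<close> by blast
  qed
  have c2: "card (\<Union>A) = (\<Sum>q\<in>Q. card (\<Union>(A \<inter> q)))"
    by (subst 2, rule card_UN_disjoint) (use finQ fin_V[OF sub] d2 in blast)+
  have 3: "es A = (\<Union>q\<in>Q. es (A \<inter> q))"
  proof (intro equalityI subsetI)
    fix e assume "e \<in> es A"
    then obtain t where t: "card e = 2" "t \<in> A" "e \<subseteq> t" by (auto simp: es_def)
    then obtain q where "q \<in> Q" "t \<in> q" using UnQ A by blast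
    then show "e \<in> (\<Union>q\<in>Q. es (A \<inter> q))" using t unfolding es_def by blast
  qed (auto simp: es_def)
  have d3: "es (A \<inter> q) \<inter> es (A \<inter> q') = {}" if "q \<in> Q" "q' \<in> Q" "q \<noteq> q'" for q q'
  proof (rule ccontr)
    assume "\<not> ?thesis"
    then obtain e where e: "e \<in> es (A \<inter> q)" "e \<in> es (A \<inter> q')" by blast
    then have "card e = 2" by (simp add: es_def)
    then obtain v where "v \<in> e" using edge_nonempty by blast
    then have "v \<in> \<Union>(A \<inter> q) \<inter> \<Union>(A \<inter> q')" using e unfolding es_def by blast
    then show False using d2[OF that] by blast
  qed
  have c3: "card (es A) = (\<Sum>q\<in>Q. card (es (A \<inter> q)))"
    by (subst 3, rule card_UN_disjoint) (use finQ fin_es[OF sub] d3 in blast)+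
  show ?thesis
    unfolding chi_def c1 c2 c3 by (simp add: sum.distrib sum_subtractf)
qed

lemma chi_T: "chi T = (\<Sum>q\<in>Q. chi q)"
  using chi_sum[OF subset_refl] Q_subset by (simp add: Int_absorb1)

lemma SS_Union: "SS = (\<Union>q\<in>Q. SSq q)"
proof
  show "(\<Union>q\<in>Q. SSq q) \<subseteq> SS" by (auto simp: SSq_def)
  show "SS \<subseteq> (\<Union>q\<in>Q. SSq q)"
  proof
    fix S assume S: "S \<in> SS"
    then obtain e where e: "e \<in> S" using cyc[OF S] by (auto simp: cycle_graph_def)
    then obtain t where t: "t \<in> T" "e \<subseteq> t" using S SS_es by (auto simp: es_def)
    then obtain q where "q \<in> Q" "t \<in> q" using UnQ by blast
    then show "S \<in> (\<Union>q\<in>Q. SSq q)" using SSq_I S e t by blast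
  qed
qed

lemma SSq_disj:
  assumes "q \<in> Q" "q' \<in> Q" "q \<noteq> q'" shows "SSq q \<inter> SSq q' = {}"
proof (rule ccontr)
  assume "\<not> ?thesis"
  then obtain S where S: "S \<in> SSq q" "S \<in> SSq q'" by blast
  then obtain e t where "e \<in> S" "t \<in> q" "e \<subseteq> t" by (auto simp: SSq_def)
  then have "t \<in> q'" using SSq_triangle[OF assms(2) S(2)] Q_subset[OF assms(1)] by blast
  then show False using Q_disj[OF assms] \<open>t \<in> q\<close> by blast
qed

lemma card_SS_sum: "card {S\<in>SS. X S} = (\<Sum>q\<in>Q. card {S\<in>SSq q. X S})"
proof -
  have "{S\<in>SS. X S} = (\<Union>q\<in>Q. {S\<in>SSq q. X S})" using SS_Union by blast
  moreover have "card (\<Union>q\<in>Q. {S\<in>SSq q. X S}) = (\<Sum>q\<in>Q. card {S\<in>SSq q. X S})"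
  proof (rule card_UN_disjoint)
    show "\<forall>q\<in>Q. finite {S\<in>SSq q. X S}" using finSS by (simp add: SSq_def)
    show "\<forall>q\<in>Q. \<forall>q'\<in>Q. q \<noteq> q' \<longrightarrow> {S\<in>SSq q. X S} \<inter> {S\<in>SSq q'. X S} = {}" using SSq_disj by blast
  qed (rule finQ)
  ultimately show ?thesis by simp
qed

text \<open>The rotation comparing the preferred sides at a vertex crosses no edge of
  \<open>S\<close>, and edges of other seams do not contain this vertex since seams are disjoint; so
  it never changes the color.\<close>

lemma side_const:
  assumes A: "checker A" and S: "S \<in> SS" and e: "e \<in> S" "e' \<in> S"
  shows "sd e \<in> A \<longleftrightarrow> sd e' \<in> A"
proof -
  have "(sd e' \<in> A) = (sd e \<in> A)"
  proof (rule cycle_graph_connected[where P = "\<lambda>a. (sd a \<in> A) = (sd e \<in> A)", OF cyc[OF S] _ e])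
    fix a b assume ab: "a \<in> S" "b \<in> S" "a \<inter> b \<noteq> {}" "(sd a \<in> A) = (sd e \<in> A)"
    obtain v where v: "v \<in> a" "v \<in> b" using ab(3) by blast
    have "(sd a, sd b) \<in> {(t, t'). t \<in> T \<and> t' \<in> T \<and> (\<exists>a. card a = 2 \<and> v \<in> a \<and> a \<notin> S \<and> a \<subseteq> t \<and> a \<subseteq> t')}\<^sup>*"
      by (rule sd_coherent[OF S ab(1,2) v])
    then have "(sd b \<in> A) = (sd a \<in> A)"
    proof (induction rule: rtrancl_induct)
      case base
      show ?case by simp
    next
      case (step y z)
      then obtain d where d: "y \<in> T" "z \<in> T" "card d = 2" "v \<in> d" "d \<notin> S" "d \<subseteq> y" "d \<subseteq> z" by blast
      have "d \<notin> \<Union>SS"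
      proof
        assume "d \<in> \<Union>SS"
        then obtain S' where "S' \<in> SS" "d \<in> S'" by blast
        then show False using disj[OF S, of S'] d(4,5) v(1) ab(1) by blast
      qed
      then have "y \<noteq> z \<Longrightarrow> (y \<in> A) = (z \<in> A)"
        using checker_adj[OF A d(1,2) _ d(6,7,3)] by blast
      then show ?case using step.IH by blast
    qed
    then show "(sd b \<in> A) = (sd e \<in> A)" using ab(4) by simp
  qed simp
  then show ?thesis by simp
qed

text \<open>Each seam of the component points into exactly one of the two colors, so exchanging the
  colors complements the set of seams of color 1.\<close>

lemma side_count:
  assumes A: "checker A" and q: "q \<in> Q"
  shows "card {S\<in>SSq q. \<forall>e\<in>S. sd e \<in> A \<inter> q} + card {S\<in>SSq q. \<forall>e\<in>S. sd e \<in> q - A} = card (SSq q)"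
proof -
  have ne: "S \<noteq> {}" if "S \<in> SSq q" for S using that cyc by (auto simp: SSq_def cycle_graph_def)
  have inq: "sd e \<in> q" if "S \<in> SSq q" "e \<in> S" for S e
    using SSq_triangle[OF q that] sd[of S e] that by (auto simp: SSq_def)
  have const: "sd e \<in> A \<longleftrightarrow> sd e' \<in> A" if "S \<in> SSq q" "e \<in> S" "e' \<in> S" for S e e'
    using side_const[OF A _ that(2,3)] that(1) by (auto simp: SSq_def)
  have "{S\<in>SSq q. \<forall>e\<in>S. sd e \<in> A \<inter> q} \<union> {S\<in>SSq q. \<forall>e\<in>S. sd e \<in> q - A} = SSq q"
    using inq const by blast
  moreover have "{S\<in>SSq q. \<forall>e\<in>S. sd e \<in> A \<inter> q} \<inter> {S\<in>SSq q. \<forall>e\<in>S. sd e \<in> q - A} = {}"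
    using ne by blast
  moreover have "finite (SSq q)" using finSS by (simp add: SSq_def)
  ultimately show ?thesis
    by (metis (no_types, lifting) card_Un_disjoint finite_Un)
qed

lemma side_q: "q \<in> Q \<Longrightarrow> S \<in> SSq q \<Longrightarrow> (\<forall>e\<in>S. sd e \<in> A) \<longleftrightarrow> (\<forall>e\<in>S. sd e \<in> A \<inter> q)"
proof -
  assume "q \<in> Q" "S \<in> SSq q"
  then have "sd e \<in> q" if "e \<in> S" for e
    using SSq_triangle[of q S e "sd e"] sd[of S e] that by (simp add: SSq_def)
  then show ?thesis by blast
qed

definition switch :: "'v set set \<Rightarrow> 'v set set set \<Rightarrow> 'v set set" where
  "switch A J = (A - \<Union>J) \<union> (\<Union>J - A)"

lemma switch_q: "J \<subseteq> Q \<Longrightarrow> q \<in> Q \<Longrightarrow> switch A J \<inter> q = (if q \<in> J then q - A else A \<inter> q)"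
proof -
  assume J: "J \<subseteq> Q" "q \<in> Q"
  have "\<Union>J \<inter> q = (if q \<in> J then q else {})"
  proof (cases "q \<in> J")
    case False
    then have "q' \<inter> q = {}" if "q' \<in> J" for q' using Q_disj[of q' q] that J by blast
    then show ?thesis using False by auto
  qed auto
  then show ?thesis unfolding switch_def by (simp split: if_splits) blast+
qed

lemma checker_switch:
  assumes A: "checker A" and J: "J \<subseteq> Q"
  shows "checker (switch A J)"
proof (rule checkerI)
  show "switch A J \<subseteq> T" using checker_subset[OF A] J UnQ unfolding switch_def by blast
  fix t t' e assume t: "t \<in> T" "t' \<in> T" "t \<noteq> t'" "e \<subseteq> t" "e \<subseteq> t'" "card e = 2"
  have "t \<in> \<Union>J \<longleftrightarrow> t' \<in> \<Union>J"
    using Q_adj edge_adj[OF t(1,2,6,4,5)] edge_adj[OF t(2,1,6,5,4)] t(1,2) J by blast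
  then show "e \<in> \<Union>SS \<longleftrightarrow> (t \<in> switch A J) \<noteq> (t' \<in> switch A J)"
    unfolding checker_adj[OF A t] switch_def by blast
qed

text \<open>Crossing an edge changes membership in \<open>A\<close> exactly when it changes
  membership in \<open>B\<close>, namely at seam edges. Hence agreement of the two is constant on
  each component.\<close>

lemma checker_eq_switch:
  assumes A: "checker A" and B: "checker B"
  shows "\<exists>J\<subseteq>Q. B = switch A J"
proof (intro exI conjI)
  let ?J = "{q\<in>Q. \<exists>t\<in>q. (t \<in> A) \<noteq> (t \<in> B)}"
  show "?J \<subseteq> Q" by blast
  have const: "(t \<in> A) = (t \<in> B) \<longleftrightarrow> (t' \<in> A) = (t' \<in> B)" if "(t, t') \<in> adj\<^sup>*" for t t'
    using that
  proof (induction rule: rtrancl_induct)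
    case base
    show ?case by simp
  next
    case (step y z)
    then have yz: "y \<in> T" "z \<in> T" "card (y \<inter> z) = 2" by (auto simp: adj_def)
    have "y \<noteq> z" using yz(3) card3[OF yz(1)] by auto
    then have "(y \<in> A) \<noteq> (z \<in> A) \<longleftrightarrow> (y \<in> B) \<noteq> (z \<in> B)"
      using checker_adj[OF A yz(1,2) _ Int_lower1 Int_lower2 yz(3)] checker_adj[OF B yz(1,2) _ Int_lower1 Int_lower2 yz(3)]
      by blast
    then show ?case using step.IH by blast
  qed
  have J: "t \<in> \<Union>?J \<longleftrightarrow> (t \<in> A) \<noteq> (t \<in> B)" if t: "t \<in> T" for t
  proof
    assume "t \<in> \<Union>?J"
    then obtain q s where q: "q \<in> Q" "t \<in> q" "s \<in> q" "(s \<in> A) \<noteq> (s \<in> B)" by blast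
    then have "(t, s) \<in> adj\<^sup>*" using Q_eq[OF q(1,2)] by (simp add: component_def)
    then show "(t \<in> A) \<noteq> (t \<in> B)" using const q(4) by blast
  next
    assume "(t \<in> A) \<noteq> (t \<in> B)"
    moreover obtain q where "q \<in> Q" "t \<in> q" using UnQ t by blast
    ultimately show "t \<in> \<Union>?J" by blast
  qed
  show "B = switch A ?J"
    using J checker_subset[OF A] checker_subset[OF B] UnQ unfolding switch_def by blast
qed

lemma switch_inj:
  assumes "A \<subseteq> T" shows "inj_on (switch A) (Pow Q)"
proof (rule inj_onI)
  fix J K assume JK: "J \<in> Pow Q" "K \<in> Pow Q" "switch A J = switch A K"
  have "\<Union>J = \<Union>K" using JK(3) unfolding switch_def by blast
  have sub: "J' \<subseteq> K'" if JK': "J' \<subseteq> Q" "K' \<subseteq> Q" "\<Union>J' = \<Union>K'" for J' K'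
  proof
    fix q assume q: "q \<in> J'"
    then have "q \<in> Q" using JK'(1) by blast
    then obtain t where t: "t \<in> q" using component_self by (auto simp: Q_def)
    then obtain q' where q': "q' \<in> K'" "t \<in> q'" using q JK'(3) by blast
    then have "q = q'" using Q_disj[of q q'] \<open>q \<in> Q\<close> JK'(2) t by blast
    then show "q \<in> K'" using q'(1) by simp
  qed
  show "J = K" using sub[of J K] sub[of K J] JK \<open>\<Union>J = \<Union>K\<close> by blast
qed

lemma checkers: "checker A \<Longrightarrow> {B. checker B} = switch A ` Pow Q"
  using checker_switch checker_eq_switch by blast

end

section \<open>The upper bound for the Euler characteristic of a component\<close>

lemma const_edge: "\<forall>e\<in>H. \<forall>x\<in>e. \<forall>y\<in>e. f x = f y \<Longrightarrow> e \<in> H \<Longrightarrow> x \<in> e \<Longrightarrow> y \<in> e \<Longrightarrow> f x = f y"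
  by meson

text \<open>A graph on \<open>V\<close> with edge set \<open>H\<close> has at least
  \<open>card V - card H\<close> components: \<open>f\<close> names the component of a vertex, and
  adding an edge merges at most two names.\<close>

lemma edge_labelling:
  fixes H :: "'v set set"
  assumes "finite H" "\<And>e. e \<in> H \<Longrightarrow> card e = 2" "finite V"
  shows "\<exists>f::'v \<Rightarrow> 'v. (\<forall>e\<in>H. \<forall>x\<in>e. \<forall>y\<in>e. f x = f y) \<and> card V \<le> card (f ` V) + card H"
  using assms(1,2)
proof (induction H rule: finite_induct)
  case empty
  show ?case by (intro exI[of _ "\<lambda>v. v"]) simp
next
  case (insert e H)
  then obtain f :: "'v \<Rightarrow> 'v" where f: "\<forall>e\<in>H. \<forall>x\<in>e. \<forall>y\<in>e. f x = f y" "card V \<le> card (f ` V) + card H" by auto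
  obtain a b where e: "e = {a, b}" using insert.prems[of e] by (auto simp: card_2_iff)
  define g where "g v = (if f v = f b then f a else f v)" for v
  have "f ` V \<subseteq> insert (f b) (g ` V)" by (auto simp: g_def)
  then have "card (f ` V) \<le> card (insert (f b) (g ` V))" using assms(3) by (intro card_mono) auto
  also have "\<dots> \<le> card (g ` V) + 1" by (simp add: card_insert_le_m1 card_insert_if assms(3))
  finally have "card V \<le> card (g ` V) + card (insert e H)" using f(2) insert.hyps by simp
  moreover have "g x = g y" if "d \<in> insert e H" "x \<in> d" "y \<in> d" for d x y
  proof (cases "d = e")
    case True
    then show ?thesis using that e by (auto simp: g_def)
  next
    case False
    then have "f x = f y" using that f(1) by blast
    then show ?thesis by (simp add: g_def)
  qed
  ultimately show ?case by (intro exI[of _ g]) blast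
qed

context seamed
begin

text \<open>The dual tree argument: the triangles of \<open>A\<close> can be glued successively along the edges in \<open>R\<close>, and
  the remaining edges still connect all vertices.\<close>

definition grown :: "'v set set \<Rightarrow> bool" where
  "grown A \<longleftrightarrow> A \<subseteq> T \<and> (\<exists>R\<subseteq>es A. card R + 1 = card A \<and> (\<forall>e\<in>R. \<forall>t\<in>T. e \<subseteq> t \<longrightarrow> t \<in> A) \<and>
     (\<forall>f::'v \<Rightarrow> 'v. (\<forall>e\<in>es A - R. \<forall>x\<in>e. \<forall>y\<in>e. f x = f y) \<longrightarrow> (\<forall>x\<in>\<Union>A. \<forall>y\<in>\<Union>A. f x = f y)))"

lemma grown_single:
  assumes "t \<in> T" shows "grown {t}"
  unfolding grown_def
proof (intro conjI exI[of _ "{}"] allI impI ballI)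
  fix f :: "'v \<Rightarrow> 'v" and x y
  assume f: "\<forall>e\<in>es {t} - {}. \<forall>x\<in>e. \<forall>y\<in>e. f x = f y" and xy: "x \<in> \<Union>{t}" "y \<in> \<Union>{t}"
  show "f x = f y"
  proof (cases "x = y")
    case False
    then have "{x, y} \<in> es {t} - {}" using xy by (auto simp: es_def)
    from const_edge[OF f this] show ?thesis by blast
  qed simp
qed (use assms in auto)

text \<open>The edge at which \<open>t\<close> is glued joins the dual tree. Its ends remain
  connected through the third vertex of \<open>t\<close>.\<close>

lemma grown_step:
  assumes A: "grown A" and t: "t \<in> T" "t \<notin> A" "t' \<in> A" "card (t \<inter> t') = 2"
  shows "grown (insert t A)"
proof -
  obtain R where R: "A \<subseteq> T" "R \<subseteq> es A" "card R + 1 = card A" "\<forall>e\<in>R. \<forall>t\<in>T. e \<subseteq> t \<longrightarrow> t \<in> A"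
    and con: "\<forall>f::'v \<Rightarrow> 'v. (\<forall>e\<in>es A - R. \<forall>x\<in>e. \<forall>y\<in>e. f x = f y) \<longrightarrow> (\<forall>x\<in>\<Union>A. \<forall>y\<in>\<Union>A. f x = f y)"
    using A unfolding grown_def by (elim conjE exE) (rule that)
  define e where "e = t \<inter> t'"
  have e: "card e = 2" "e \<subseteq> t" "e \<subseteq> t'" using t(4) by (auto simp: e_def)
  have t'T: "t' \<in> T" "t \<noteq> t'" using R(1) t by auto
  have eR: "e \<notin> R" using R(4) t(1,2) e(2) by blast
  have eA: "e \<in> es A" using e t(3) by (auto simp: es_def)
  have es_ins: "es (insert t A) = es A \<union> es {t}" by (auto simp: es_def)
  have finR: "finite R" using R(1,2) fin_es finite_subset by blast
  have "card (t - e) = 1"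
    using card3[OF t(1)] e fint[OF t(1)] by (simp add: card_Diff_subset finite_subset)
  then obtain c where c: "t - e = {c}" by (meson card_1_singletonE)
  obtain a b where ab: "e = {a, b}" "a \<noteq> b" using e(1) by (auto simp: card_2_iff)
  have tabc: "t = {a, b, c}" "c \<noteq> a" "c \<noteq> b" using c e(2) ab by auto
  \<comment> \<open>An edge of \<open>R\<close> has all its triangles in \<open>A\<close>, which
    does not contain \<open>t\<close>.\<close>
  have nR: "d \<notin> R" if "d \<subseteq> t" for d using R(4) t that by blast
  show ?thesis
    unfolding grown_def
  proof (intro conjI exI[of _ "insert e R"] allI impI)
    show "insert t A \<subseteq> T" using R(1) t(1) by simp
    show "insert e R \<subseteq> es (insert t A)" using R(2) eA es_ins by blast
    have "finite A" using R(1) finT finite_subset by blast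
    then show "card (insert e R) + 1 = card (insert t A)" using R(3) eR finR t(2) by simp
    show "\<forall>d\<in>insert e R. \<forall>s\<in>T. d \<subseteq> s \<longrightarrow> s \<in> insert t A"
    proof (intro ballI impI)
      fix d s assume d: "d \<in> insert e R" "s \<in> T" "d \<subseteq> s"
      show "s \<in> insert t A"
      proof (cases "d = e")
        case True
        then have "s \<in> {t, t'}" using sides[OF t(1) t'T(1,2) e(2,3,1)] d by blast
        then show ?thesis using t(3) by blast
      next
        case False
        then show ?thesis using R(4) d by blast
      qed
    qed
    fix f :: "'v \<Rightarrow> 'v"
    assume f: "\<forall>d\<in>es (insert t A) - insert e R. \<forall>x\<in>d. \<forall>y\<in>d. f x = f y"
    have "{a, c} \<in> es (insert t A) - insert e R" "{b, c} \<in> es (insert t A) - insert e R"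
      using tabc nR[of "{a, c}"] nR[of "{b, c}"] ab by (auto simp: es_def doubleton_eq_iff)
    from const_edge[OF f this(1)] const_edge[OF f this(2)] have abc: "f a = f c" "f b = f c" by blast+
    have "\<forall>d\<in>es A - R. \<forall>x\<in>d. \<forall>y\<in>d. f x = f y"
    proof (intro ballI)
      fix d x y assume d: "d \<in> es A - R" "x \<in> d" "y \<in> d"
      show "f x = f y"
      proof (cases "d = e")
        case True
        then show ?thesis using abc d ab by auto
      next
        case False
        then have "d \<in> es (insert t A) - insert e R" using d(1) es_ins by blast
        from const_edge[OF f this d(2,3)] show ?thesis .
      qed
    qed
    from mp[OF spec[OF con] this] have cA: "\<forall>x\<in>\<Union>A. \<forall>y\<in>\<Union>A. f x = f y" .
    have aA: "a \<in> \<Union>A" using ab e(3) t(3) by auto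
    have all: "f x = f a" if "x \<in> \<Union>(insert t A)" for x
    proof (cases "x \<in> \<Union>A")
      case True
      show ?thesis using bspec[OF bspec[OF cA True] aA] .
    next
      case False
      then have "x \<in> {a, b, c}" using that tabc(1) by blast
      then show ?thesis using abc by auto
    qed
    then show "\<forall>x\<in>\<Union>(insert t A). \<forall>y\<in>\<Union>(insert t A). f x = f y" by simp
  qed
qed

lemma grown_component:
  assumes q: "q \<in> Q" shows "grown q"
proof -
  have "grown q" if "A \<subseteq> q" "grown A" for A
    using that
  proof (induction "card (q - A)" arbitrary: A rule: less_induct)
    case less
    show ?case
    proof (cases "A = q")
      case False
      then obtain s where s: "s \<in> q" "s \<notin> A" using less.prems by blast
      have "A \<noteq> {}" using less.prems(2) unfolding grown_def by auto
      then obtain t where t: "t \<in> A" by blast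
      then have "(t, s) \<in> adj\<^sup>*" using Q_eq[OF q, of t] less.prems(1) s by (auto simp: component_def)
      then have "s \<in> A \<or> (\<exists>y z. y \<in> A \<and> z \<notin> A \<and> (y, z) \<in> adj)"
        by (induction rule: rtrancl_induct) (use t in blast)+
      then obtain y z where yz: "y \<in> A" "z \<notin> A" "(y, z) \<in> adj" using s by blast
      then have zq: "z \<in> q" "z \<in> T" "card (z \<inter> y) = 2"
        using Q_adj[OF q, of y z] less.prems(1) by (auto simp: adj_def Int_commute)
      have "finite (q - A)" using fin_sub[OF Q_subset[OF q]] by simp
      then have "card (q - insert z A) < card (q - A)"
        using zq(1) yz(2) by (intro psubset_card_mono) auto
      then show ?thesis
        using less.hyps[of "insert z A"] grown_step[OF less.prems(2) zq(2) yz(2,1) zq(3)] less.prems(1) zq(1) by simp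
    qed (use less.prems in simp)
  qed
  moreover obtain t where "t \<in> q" "t \<in> T" using q component_self by (auto simp: Q_def)
  ultimately show ?thesis using grown_single[of t] by blast
qed

text \<open>The dual tree \<open>R\<close> uses one edge less than there are triangles, and the
  remaining edges connect all vertices, so they number at least the vertices minus one. These edges
  may also close cycles, whence only an inequality.\<close>

lemma chi_le_2:
  assumes q: "q \<in> Q" shows "chi q \<le> 2"
proof -
  obtain R where R: "q \<subseteq> T" "R \<subseteq> es q" "card R + 1 = card q" "\<forall>e\<in>R. \<forall>t\<in>T. e \<subseteq> t \<longrightarrow> t \<in> q"
    and con: "\<forall>f::'v \<Rightarrow> 'v. (\<forall>e\<in>es q - R. \<forall>x\<in>e. \<forall>y\<in>e. f x = f y) \<longrightarrow> (\<forall>x\<in>\<Union>q. \<forall>y\<in>\<Union>q. f x = f y)"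
    using grown_component[OF q] unfolding grown_def by (elim conjE exE) (rule that)
  have fin: "finite (es q)" "finite (\<Union>q)" using fin_es fin_V R(1) by blast+
  obtain f :: "'v \<Rightarrow> 'v" where f: "\<forall>e\<in>es q - R. \<forall>x\<in>e. \<forall>y\<in>e. f x = f y" "card (\<Union>q) \<le> card (f ` \<Union>q) + card (es q - R)"
    using edge_labelling[OF finite_Diff[OF fin(1)] _ fin(2), of R] unfolding es_def by blast
  have c: "\<forall>x\<in>\<Union>q. \<forall>y\<in>\<Union>q. f x = f y" by (rule mp[OF spec[OF con] f(1)])
  have "f ` \<Union>q \<subseteq> {f (SOME x. x \<in> \<Union>q)}"
  proof (intro image_subsetI singletonI)
    fix x assume x: "x \<in> \<Union>q"
    have "f x = f (SOME x. x \<in> \<Union>q)" by (rule bspec[OF bspec[OF c x] someI[of "\<lambda>x. x \<in> \<Union>q", OF x]])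
    then show "f x \<in> {f (SOME x. x \<in> \<Union>q)}" by (rule ssubst) (rule singletonI)
  qed
  then have "\<exists>c. f ` \<Union>q \<subseteq> {c}" by (rule exI)
  then have "card (f ` \<Union>q) \<le> 1" by (metis card_mono finite.emptyI finite.insertI is_singletonI is_singleton_altdef)
  moreover have "card (es q - R) + card R = card (es q)"
    using R(2) fin by (metis card_Diff_subset card_mono finite_subset le_add_diff_inverse2)
  ultimately show ?thesis using f(2) R(3) unfolding chi_def by linarith
qed

end

section \<open>The sum over colorings as a product over components\<close>

lemma prod_power_int:
  fixes z :: "'k::field"
  assumes "z \<noteq> 0"
  shows "(\<Prod>q\<in>Q. z powi f q) = z powi (\<Sum>q\<in>Q. f q)"
  by (induction Q rule: infinite_finite_induct) (simp_all add: power_int_add assms)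

lemma sum_div_2:
  fixes f :: "'a \<Rightarrow> int"
  assumes "\<And>q. q \<in> Q \<Longrightarrow> even (f q)"
  shows "(\<Sum>q\<in>Q. f q) div 2 = (\<Sum>q\<in>Q. f q div 2)"
proof -
  have "(\<Sum>q\<in>Q. f q) = (\<Sum>q\<in>Q. 2 * (f q div 2))" using assms by (intro sum.cong) auto
  then show ?thesis by (simp add: sum_distrib_left[symmetric])
qed

context seamed
begin

text \<open>\<open>R\<close> is the color 1 part of \<open>q\<close>, and the number that is halved
  is the Euler characteristic of this part after capping all seams of \<open>q\<close>.\<close>

definition sexp :: "'v set set \<Rightarrow> 'v set set \<Rightarrow> int" where
  "sexp R q = int (card {S\<in>SSq q. \<forall>e\<in>S. sd e \<in> R}) + (chi R + int (card (SSq q))) div 2"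

text \<open>The share of one component in \<open>weight\<close>. \<open>P\<close> stands for the
  dots, and \<open>tr\<close> for the choice of a triangle containing each of them.\<close>

definition factor :: "'k::field \<Rightarrow> 'k \<Rightarrow> 'p set \<Rightarrow> ('p \<Rightarrow> 'v set) \<Rightarrow> 'v set set \<Rightarrow> 'v set set \<Rightarrow> 'k" where
  "factor x y P tr R q = (-1) powi sexp R q *
     (x ^ card {p\<in>P. tr p \<in> R} * y ^ card {p\<in>P. tr p \<in> q - R} / (y - x) powi (chi q div 2))"

definition weight :: "'k::field \<Rightarrow> 'k \<Rightarrow> 'p set \<Rightarrow> ('p \<Rightarrow> 'v set) \<Rightarrow> 'v set set \<Rightarrow> 'k" where
  "weight x y P tr A = (-1) powi (int (card {S\<in>SS. \<forall>e\<in>S. sd e \<in> A}) + (chi A + int (card SS)) div 2) *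
     (x ^ card {p\<in>P. tr p \<in> A} * y ^ card {p\<in>P. tr p \<in> T - A} / (y - x) powi (chi T div 2))"

lemma card_P_sum:
  assumes "finite P"
  shows "card {p\<in>P. tr p \<in> A \<inter> T} = (\<Sum>q\<in>Q. card {p\<in>P. tr p \<in> A \<inter> q})"
proof -
  have "{p\<in>P. tr p \<in> A \<inter> T} = (\<Union>q\<in>Q. {p\<in>P. tr p \<in> A \<inter> q})" using UnQ by blast
  moreover have "card (\<Union>q\<in>Q. {p\<in>P. tr p \<in> A \<inter> q}) = (\<Sum>q\<in>Q. card {p\<in>P. tr p \<in> A \<inter> q})"
  proof (rule card_UN_disjoint)
    show "\<forall>q\<in>Q. finite {p\<in>P. tr p \<in> A \<inter> q}" using assms by simp
    show "\<forall>q\<in>Q. \<forall>q'\<in>Q. q \<noteq> q' \<longrightarrow> {p\<in>P. tr p \<in> A \<inter> q} \<inter> {p\<in>P. tr p \<in> A \<inter> q'} = {}"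
      using Q_disj by blast
  qed (rule finQ)
  ultimately show ?thesis by simp
qed

text \<open>All exponents are additive over components. For the two halved ones this needs every
  summand to be even, and here parity for single components enters.\<close>

lemma weight_prod:
  assumes A: "checker A" and P: "finite P" and xy: "x \<noteq> y"
  shows "weight x y P tr A = (\<Prod>q\<in>Q. factor x y P tr (A \<inter> q) q)"
proof -
  have AT: "A \<inter> T = A" "(T - A) \<inter> T = T - A" using checker_subset[OF A] by blast+
  have qA: "(T - A) \<inter> q = q - A \<inter> q" if "q \<in> Q" for q using Q_subset[OF that] by blast
  have c1: "card {p\<in>P. tr p \<in> A} = (\<Sum>q\<in>Q. card {p\<in>P. tr p \<in> A \<inter> q})"
    using card_P_sum[OF P, of tr A] unfolding AT .
  have "card {p\<in>P. tr p \<in> T - A} = (\<Sum>q\<in>Q. card {p\<in>P. tr p \<in> (T - A) \<inter> q})"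
    using card_P_sum[OF P, of tr "T - A"] unfolding AT .
  also have "\<dots> = (\<Sum>q\<in>Q. card {p\<in>P. tr p \<in> q - A \<inter> q})" by (intro sum.cong refl) (simp only: qA)
  finally have c2: "card {p\<in>P. tr p \<in> T - A} = (\<Sum>q\<in>Q. card {p\<in>P. tr p \<in> q - A \<inter> q})" .
  have "card {S\<in>SS. \<forall>e\<in>S. sd e \<in> A} = (\<Sum>q\<in>Q. card {S\<in>SSq q. \<forall>e\<in>S. sd e \<in> A})" by (rule card_SS_sum)
  also have "\<dots> = (\<Sum>q\<in>Q. card {S\<in>SSq q. \<forall>e\<in>S. sd e \<in> A \<inter> q})"
    by (intro sum.cong refl arg_cong[where f = card] Collect_cong conj_cong side_q)
  finally have c3: "card {S\<in>SS. \<forall>e\<in>S. sd e \<in> A} = (\<Sum>q\<in>Q. card {S\<in>SSq q. \<forall>e\<in>S. sd e \<in> A \<inter> q})" .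
  have "chi A + int (card SS) = (\<Sum>q\<in>Q. chi (A \<inter> q) + int (card (SSq q)))"
    using chi_sum[OF checker_subset[OF A]] card_SS_sum[of "\<lambda>_. True"] by (simp add: sum.distrib)
  then have c4: "(chi A + int (card SS)) div 2 = (\<Sum>q\<in>Q. (chi (A \<inter> q) + int (card (SSq q))) div 2)"
    using even_chi_q(1)[OF A] by (simp add: sum_div_2)
  have c5: "chi T div 2 = (\<Sum>q\<in>Q. chi q div 2)"
    unfolding chi_T using even_chi_component[OF A] by (rule sum_div_2)
  have s: "int (card {S\<in>SS. \<forall>e\<in>S. sd e \<in> A}) + (chi A + int (card SS)) div 2 = (\<Sum>q\<in>Q. sexp (A \<inter> q) q)"
    unfolding c3 c4 sexp_def by (simp add: sum.distrib)
  have "y - x \<noteq> 0" using xy by simp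
  then show ?thesis
    unfolding weight_def s c1 c2 c5 factor_def
    by (simp add: prod.distrib prod_dividef prod_power_int power_sum)
qed

text \<open>Expanding the product selects one summand for each component; selecting the exchanged
  colors on the components in \<open>J\<close> yields the weight of
  \<open>switch A J\<close>.\<close>

theorem sum_weights:
  assumes A: "checker A" and P: "finite P" and xy: "x \<noteq> y"
  shows "(\<Sum>B | checker B. weight x y P tr B) = (\<Prod>q\<in>Q. factor x y P tr (A \<inter> q) q + factor x y P tr (q - A) q)"
proof -
  have "(\<Sum>B | checker B. weight x y P tr B) = (\<Sum>J\<in>Pow Q. weight x y P tr (switch A J))"
    unfolding checkers[OF A] by (rule sum.reindex[OF switch_inj[OF checker_subset[OF A]], unfolded o_def])
  also have "\<dots> = (\<Sum>J\<in>Pow Q. (\<Prod>q\<in>J. factor x y P tr (q - A) q) * (\<Prod>q\<in>Q - J. factor x y P tr (A \<inter> q) q))"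
  proof (rule sum.cong[OF refl])
    fix J assume "J \<in> Pow Q"
    then have J: "J \<subseteq> Q" by simp
    have "weight x y P tr (switch A J) = (\<Prod>q\<in>Q. factor x y P tr (if q \<in> J then q - A else A \<inter> q) q)"
      unfolding weight_prod[OF checker_switch[OF A J] P xy]
      by (intro prod.cong refl) (simp only: switch_q[OF J])
    also have "\<dots> = (\<Prod>q\<in>Q - J. factor x y P tr (if q \<in> J then q - A else A \<inter> q) q) * (\<Prod>q\<in>J. factor x y P tr (if q \<in> J then q - A else A \<inter> q) q)"
      by (rule prod.subset_diff[OF J finQ])
    finally show "weight x y P tr (switch A J) = (\<Prod>q\<in>J. factor x y P tr (q - A) q) * (\<Prod>q\<in>Q - J. factor x y P tr (A \<inter> q) q)"
      by (simp add: mult.commute)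
  qed
  also have "\<dots> = (\<Prod>q\<in>Q. factor x y P tr (q - A) q + factor x y P tr (A \<inter> q) q)"
    by (rule prod_add[OF finQ, symmetric])
  finally show ?thesis by (simp add: add.commute)
qed

end

section \<open>Symmetric homogeneous polynomials\<close>

definition bc :: "int poly poly \<Rightarrow> nat \<Rightarrow> nat \<Rightarrow> int" where
  "bc p i j = coeff (coeff p j) i"

lemma bc_mult: "bc (p * q) i j = (\<Sum>l\<le>j. \<Sum>k\<le>i. bc p k l * bc q (i - k) (j - l))"
  by (simp add: bc_def coeff_mult coeff_sum)

lemma bc_simps [simp]:
  "bc (p + q) i j = bc p i j + bc q i j" "bc (p - q) i j = bc p i j - bc q i j"
  "bc (- p) i j = - bc p i j" "bc 0 i j = 0" "bc (\<Sum>k\<in>A. f k) i j = (\<Sum>k\<in>A. bc (f k) i j)"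
  by (simp_all add: bc_def coeff_sum)

lemma bc_monom: "bc (\<alpha>1 ^ a * \<alpha>2 ^ b) i j = of_bool (i = a \<and> j = b)"
proof -
  have 1: "\<alpha>1 ^ a = [:monom 1 a:]"
  proof (induction a)
    case (Suc a)
    have "[:0, 1:] * monom 1 a = (monom 1 (Suc a) :: int poly)" by (simp add: monom_Suc)
    then show ?case using Suc by (simp add: \<alpha>1_def)
  qed (simp add: \<alpha>1_def one_pCons)
  have 2: "\<alpha>2 ^ b = monom 1 b"
  proof (induction b)
    case (Suc b)
    then show ?case by (simp add: \<alpha>2_def monom_Suc)
  qed simp
  show ?thesis unfolding 1 2 bc_def by (auto simp: smult_monom)
qed

text \<open>Exchanging the variables multiplies \<open>p\<close> by \<open>s\<close>; with
  \<open>s = -1\<close> this covers the antisymmetric factors as well.\<close>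

definition signed_symmetric :: "int \<Rightarrow> int poly poly \<Rightarrow> bool" where
  "signed_symmetric s p \<longleftrightarrow> (\<forall>i j. bc p i j = s * bc p j i)"

text \<open>Here both variables have degree one; the factor two enters only in the final comparison
  of degrees.\<close>

definition homogen :: "nat \<Rightarrow> int poly poly \<Rightarrow> bool" where
  "homogen n p \<longleftrightarrow> (\<forall>i j. bc p i j \<noteq> 0 \<longrightarrow> i + j = n)"

lemma signed_symmetric_mult:
  assumes "signed_symmetric s p" "signed_symmetric t q"
  shows "signed_symmetric (s * t) (p * q)"
  unfolding signed_symmetric_def
proof (intro allI)
  fix i j
  have "bc (p * q) i j = (\<Sum>l\<le>j. \<Sum>k\<le>i. (s * bc p l k) * (t * bc q (j - l) (i - k)))"
    unfolding bc_mult using assms unfolding signed_symmetric_def by (intro sum.cong refl) metis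
  also have "\<dots> = s * t * (\<Sum>l\<le>j. \<Sum>k\<le>i. bc p l k * bc q (j - l) (i - k))"
    by (simp add: sum_distrib_left mult_ac)
  also have "(\<Sum>l\<le>j. \<Sum>k\<le>i. bc p l k * bc q (j - l) (i - k)) = bc (p * q) j i"
    unfolding bc_mult by (rule sum.swap)
  finally show "bc (p * q) i j = s * t * bc (p * q) j i" .
qed

lemma homogen_mult:
  assumes "homogen m p" "homogen n q"
  shows "homogen (m + n) (p * q)"
  unfolding homogen_def
proof (intro allI impI)
  fix i j assume "bc (p * q) i j \<noteq> 0"
  then obtain l where l: "l \<le> j" "(\<Sum>k\<le>i. bc p k l * bc q (i - k) (j - l)) \<noteq> 0"
    unfolding bc_mult by (metis (no_types, lifting) atMost_iff sum.not_neutral_contains_not_neutral)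
  then obtain k where k: "k \<le> i" "bc p k l * bc q (i - k) (j - l) \<noteq> 0"
    by (metis (no_types, lifting) atMost_iff sum.not_neutral_contains_not_neutral)
  then have "k + l = m" "(i - k) + (j - l) = n" using assms by (auto simp: homogen_def)
  then show "i + j = m + n" using k l by simp
qed

lemma signed_symmetric_power: "signed_symmetric s p \<Longrightarrow> signed_symmetric (s ^ n) (p ^ n)"
proof (induction n)
  case 0
  have "bc 1 i j = of_bool (i = 0 \<and> j = 0)" for i j
    using bc_monom[of 0 0 i j] by simp
  then show ?case by (auto simp: signed_symmetric_def)
qed (simp add: signed_symmetric_mult)

lemma homogen_power: "homogen m p \<Longrightarrow> homogen (m * n) (p ^ n)"
proof (induction n)
  case 0
  have "bc 1 i j = of_bool (i = 0 \<and> j = 0)" for i j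
    using bc_monom[of 0 0 i j] by simp
  then show ?case by (simp add: homogen_def)
qed (simp add: homogen_mult)

lemma homogen_monom: "homogen (a + b) (\<alpha>1 ^ a * \<alpha>2 ^ b)"
  by (simp add: homogen_def bc_monom)

lemma homogen_add: "homogen n p \<Longrightarrow> homogen n q \<Longrightarrow> homogen n (p + q)"
proof -
  assume pq: "homogen n p" "homogen n q"
  have "i + j = n" if "bc p i j + bc q i j \<noteq> 0" for i j
  proof -
    have "bc p i j \<noteq> 0 \<or> bc q i j \<noteq> 0" using that by auto
    then show ?thesis using pq unfolding homogen_def by blast
  qed
  then show ?thesis by (simp add: homogen_def)
qed

lemma homogen_uminus: "homogen n p \<Longrightarrow> homogen n (- p)"
  by (simp add: homogen_def)

lemma signed_symmetric_uminus: "signed_symmetric s p \<Longrightarrow> signed_symmetric s (- p)"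
  unfolding signed_symmetric_def bc_simps mult_minus_right neg_equal_iff_equal .

lemma signed_symmetric_binomial:
  assumes "s * s = 1"
  shows "signed_symmetric s (\<alpha>1 ^ a * \<alpha>2 ^ b + of_int s * (\<alpha>1 ^ b * \<alpha>2 ^ a))"
proof -
  have "s = 1 \<or> s = -1" using assms by (metis abs_mult_self_eq abs_1 mult.commute zmult_eq_1_iff)
  then show ?thesis
  proof
    assume s: "s = 1"
    show ?thesis
      unfolding s signed_symmetric_def of_int_1 mult_1 bc_simps bc_monom by (simp add: conj_commute)
  next
    assume s: "s = - 1"
    show ?thesis
      unfolding s signed_symmetric_def of_int_minus of_int_1 mult_minus1 bc_simps bc_monom by (simp add: conj_commute)
  qed
qed

lemma homogen_binomial:
  assumes "s = 1 \<or> s = - 1"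
  shows "homogen (a + b) (\<alpha>1 ^ a * \<alpha>2 ^ b + of_int s * (\<alpha>1 ^ b * \<alpha>2 ^ a))"
proof -
  have h: "homogen (a + b) (\<alpha>1 ^ b * \<alpha>2 ^ a)" using homogen_monom[of b a] by (simp add: add.commute)
  show ?thesis using assms
  proof
    assume "s = 1"
    then show ?thesis using homogen_add[OF homogen_monom h] by simp
  next
    assume "s = - 1"
    then show ?thesis using homogen_add[OF homogen_monom homogen_uminus[OF h]] by simp
  qed
qed

text \<open>The complete homogeneous symmetric polynomial of degree \<open>m - 1\<close>, which is
  the quotient of \<open>\<alpha>2 ^ m - \<alpha>1 ^ m\<close> by
  \<open>\<alpha>2 - \<alpha>1\<close>; it is 0 for \<open>m = 0\<close>.\<close>

definition complete_sum :: "nat \<Rightarrow> int poly poly" where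
  "complete_sum m = (\<Sum>l<m. \<alpha>1 ^ l * \<alpha>2 ^ (m - Suc l))"

lemma bc_complete_sum: "bc (complete_sum m) i j = of_bool (i + j + 1 = m)"
proof -
  have "bc (complete_sum m) i j = (\<Sum>l<m. if l = i then of_bool (j = m - Suc i) else 0)"
    unfolding complete_sum_def bc_simps bc_monom by (intro sum.cong) auto
  also have "\<dots> = of_bool (i + j + 1 = m)" by (auto simp: sum.delta)
  finally show ?thesis .
qed

lemma complete_sum: "\<alpha>2 ^ m - \<alpha>1 ^ m = (\<alpha>2 - \<alpha>1) * complete_sum m"
proof -
  have "complete_sum m = (\<Sum>i<m. \<alpha>2 ^ (m - Suc i) * \<alpha>1 ^ i)"
    by (simp add: complete_sum_def mult.commute)
  then have "\<alpha>1 ^ m - \<alpha>2 ^ m = (\<alpha>1 - \<alpha>2) * complete_sum m"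
    by (simp only: power_diff_sumr2)
  then show ?thesis by (metis minus_diff_eq minus_mult_left)
qed

lemma symmetric_complete_sum: "signed_symmetric 1 (complete_sum m)"
  by (simp add: signed_symmetric_def bc_complete_sum add.commute)

lemma homogen_complete_sum: "homogen (m - 1) (complete_sum m)"
  by (auto simp: homogen_def bc_complete_sum)

text \<open>The degree is an integer because it can be negative: a sphere without dots has degree
  -1, and then \<open>p\<close> must be 0.\<close>

definition symmetric_homogen :: "int \<Rightarrow> int poly poly fract \<Rightarrow> bool" where
  "symmetric_homogen n f \<longleftrightarrow> (\<exists>p. f = to_fract p \<and> signed_symmetric 1 p \<and>
     (\<forall>i j. bc p i j \<noteq> 0 \<longrightarrow> int (i + j) = n))"

lemma symmetric_homogenI:
  "signed_symmetric 1 p \<Longrightarrow> homogen m p \<Longrightarrow> int m = n \<or> p = 0 \<Longrightarrow> symmetric_homogen n (to_fract p)"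
  by (auto simp: symmetric_homogen_def homogen_def simp del: of_nat_add)

lemma symmetric_homogen_one: "symmetric_homogen 0 1"
proof -
  have 1: "bc 1 i j = of_bool (i = 0 \<and> j = 0)" for i j
    using bc_monom[of 0 0 i j] by simp
  show ?thesis
    unfolding symmetric_homogen_def signed_symmetric_def 1 by (intro exI[of _ 1]) (simp add: 1 conj_commute)
qed

lemma symmetric_homogen_prod:
  "(\<And>q. q \<in> Q \<Longrightarrow> symmetric_homogen (n q) (f q)) \<Longrightarrow> symmetric_homogen (\<Sum>q\<in>Q. n q) (\<Prod>q\<in>Q. f q)"
proof (induction Q rule: infinite_finite_induct)
  case (insert q Q)
  obtain p where p: "f q = to_fract p" "signed_symmetric 1 p" "\<forall>i j. bc p i j \<noteq> 0 \<longrightarrow> int (i + j) = n q"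
    using insert.prems[OF insertI1] unfolding symmetric_homogen_def by blast
  have "symmetric_homogen (sum n Q) (prod f Q)" using insert.IH insert.prems by simp
  then  obtain r where r: "prod f Q = to_fract r" "signed_symmetric 1 r" "\<forall>i j. bc r i j \<noteq> 0 \<longrightarrow> int (i + j) = sum n Q"
    unfolding symmetric_homogen_def by blast
  have "int (i + j) = n q + sum n Q" if "bc (p * r) i j \<noteq> 0" for i j
  proof -
    obtain l where l: "l \<le> j" "(\<Sum>k\<le>i. bc p k l * bc r (i - k) (j - l)) \<noteq> 0"
      using \<open>bc (p * r) i j \<noteq> 0\<close>
      unfolding bc_mult by (metis (no_types, lifting) atMost_iff sum.not_neutral_contains_not_neutral)
    then obtain k where k: "k \<le> i" "bc p k l * bc r (i - k) (j - l) \<noteq> 0"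
      by (metis (no_types, lifting) atMost_iff sum.not_neutral_contains_not_neutral)
    then have "bc p k l \<noteq> 0" "bc r (i - k) (j - l) \<noteq> 0" by auto
    then have "int (k + l) = n q" "int ((i - k) + (j - l)) = sum n Q" using p(3) r(3) by blast+
    then show ?thesis using k l by simp
  qed
  then show ?case
    using insert.hyps p(1) r(1) signed_symmetric_mult[OF p(2) r(2)]
    unfolding symmetric_homogen_def by (intro exI[of _ "p * r"]) simp
next
  case (infinite Q)
  then show ?case by (simp add: symmetric_homogen_one)
next
  case empty
  then show ?case by (simp add: symmetric_homogen_one)
qed

section \<open>The polynomial contributed by one component\<close>

lemma to_fract_power [simp]: "to_fract (p ^ n) = to_fract p ^ n"
  by (induction n) simp_all

lemma power_int_minus_one_cases: "(-1 :: 'k::field) powi s = (if even s then 1 else - 1)"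
  by (cases "s \<ge> 0") (auto simp: power_int_def minus_one_power_iff even_nat_iff)

lemma alpha_neq: "to_fract \<alpha>1 \<noteq> to_fract \<alpha>2"
  by (simp add: \<alpha>1_def \<alpha>2_def)

text \<open>For \<open>k \<le> 0\<close> the difference \<open>y - x\<close> appears with exponent
  \<open>-k\<close> in the numerator, and its sign under exchange of the variables compensates that
  of the binomial. For \<open>k = 1\<close> the binomial is
  \<open>x ^ a * y ^ b - x ^ b * y ^ a\<close>, which \<open>y - x\<close> divides.\<close>

lemma component_factor:
  assumes k: "k \<le> 1" and par: "even (s1 + s2 - k)"
  defines "x \<equiv> to_fract \<alpha>1" and "y \<equiv> to_fract \<alpha>2"
  shows "symmetric_homogen (int (a + b) - k)
    ((-1) powi s1 * (x ^ a * y ^ b / (y - x) powi k) + (-1) powi s2 * (x ^ b * y ^ a / (y - x) powi k))"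
proof -
  \<comment> \<open>\<open>s\<close> is the sign of \<open>k\<close> and \<open>e\<close> that of
    \<open>s1\<close>; by \<open>par\<close> the sign of \<open>s2\<close> is then
    \<open>e * s\<close>.\<close>
  define s :: int where "s = (if even k then 1 else - 1)"
  define e :: int where "e = (if even s1 then 1 else - 1)"
  have se: "s = 1 \<or> s = -1" "e = 1 \<or> e = -1" "s * s = 1" by (auto simp: s_def e_def)
  have yx: "y - x \<noteq> 0" using alpha_neq by (simp add: x_def y_def)
  have "(-1) powi s2 = (of_int e * of_int s :: int poly poly fract)"
    "(-1) powi s1 = (of_int e :: int poly poly fract)"
    using par by (auto simp: power_int_minus_one_cases s_def e_def)
  then have eq: "(-1) powi s1 * (x ^ a * y ^ b / (y - x) powi k) + (-1) powi s2 * (x ^ b * y ^ a / (y - x) powi k)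
     = of_int e * ((x ^ a * y ^ b + of_int s * (x ^ b * y ^ a)) / (y - x) powi k)"
    by (simp add: algebra_simps add_divide_distrib)
  let ?B = "\<alpha>1 ^ a * \<alpha>2 ^ b + of_int s * (\<alpha>1 ^ b * \<alpha>2 ^ a)"
  have sgn: "symmetric_homogen n (of_int e * f)" if f: "symmetric_homogen n f" for f n
  proof -
    obtain p where p: "f = to_fract p" "signed_symmetric 1 p" "\<forall>i j. bc p i j \<noteq> 0 \<longrightarrow> int (i + j) = n"
      using f by (auto simp: symmetric_homogen_def)
    have "of_int e * f = to_fract (if e = 1 then p else - p)" using se(2) p(1) by auto
    then show ?thesis using p signed_symmetric_uminus[OF p(2)] unfolding symmetric_homogen_def
      by (intro exI[of _ "if e = 1 then p else - p"]) auto
  qed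
  have "symmetric_homogen (int (a + b) - k) ((x ^ a * y ^ b + of_int s * (x ^ b * y ^ a)) / (y - x) powi k)"
  proof (cases "k \<le> 0")
    case True
    define n where "n = nat (- k)"
    have kn: "k = - int n" using True by (simp add: n_def)
    have sn: "s = (-1) ^ n" by (simp add: s_def kn minus_one_power_iff)
    have eq1: "(x ^ a * y ^ b + of_int s * (x ^ b * y ^ a)) / (y - x) powi k = to_fract (?B * (\<alpha>2 - \<alpha>1) ^ n)"
      using se(1) by (auto simp: kn power_int_minus x_def y_def divide_inverse)
    have "signed_symmetric (s * (-1) ^ n) (?B * (\<alpha>2 - \<alpha>1) ^ n)"
    proof (intro signed_symmetric_mult signed_symmetric_binomial signed_symmetric_power se(3))
      show "signed_symmetric (-1) (\<alpha>2 - \<alpha>1)"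
        using bc_monom[of 1 0] bc_monom[of 0 1] by (auto simp: signed_symmetric_def)
    qed
    moreover have "homogen (a + b + 1 * n) (?B * (\<alpha>2 - \<alpha>1) ^ n)"
    proof (intro homogen_mult homogen_binomial homogen_power se(1))
      show "homogen 1 (\<alpha>2 - \<alpha>1)"
        using bc_monom[of 1 0] bc_monom[of 0 1] by (auto simp: homogen_def)
    qed
    moreover have "s * (-1) ^ n = 1" using se(3) sn by simp
    ultimately show ?thesis
      unfolding eq1 by (intro symmetric_homogenI[where m = "a + b + 1 * n"]) (simp_all add: kn)
  next
    case False
    then have k1: "k = 1" using k by simp
    then have s1: "s = -1" by (simp add: s_def)
    \<comment> \<open>The common factor \<open>(x * y) ^ a\<close> leaves a difference of two
      \<open>m\<close>-th powers. The case \<open>a > b\<close> will follow by a change of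
      sign.\<close>
    have main: "symmetric_homogen (int (a + b) - 1) ((x ^ a * y ^ b - x ^ b * y ^ a) / (y - x))" if "a \<le> b" for a b
    proof -
      define m where "m = b - a"
      have b: "b = a + m" using that by (simp add: m_def)
      have "x ^ a * y ^ b - x ^ b * y ^ a = to_fract (\<alpha>1 ^ a * \<alpha>2 ^ a * (\<alpha>2 ^ m - \<alpha>1 ^ m))"
        by (simp add: x_def y_def b power_add algebra_simps)
      also have "\<dots> = (y - x) * to_fract (\<alpha>1 ^ a * \<alpha>2 ^ a * complete_sum m)"
        unfolding complete_sum by (simp add: x_def y_def)
      finally have q: "(x ^ a * y ^ b - x ^ b * y ^ a) / (y - x) = to_fract (\<alpha>1 ^ a * \<alpha>2 ^ a * complete_sum m)"
        using yx by simp
      have A: "signed_symmetric (1 * 1) (\<alpha>1 ^ a * \<alpha>2 ^ a * complete_sum m)"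
        by (rule signed_symmetric_mult[OF _ symmetric_complete_sum]) (auto simp: signed_symmetric_def bc_monom)
      have B: "homogen ((a + a) + (m - 1)) (\<alpha>1 ^ a * \<alpha>2 ^ a * complete_sum m)"
        by (rule homogen_mult[OF homogen_monom homogen_complete_sum])
      \<comment> \<open>For \<open>m = 0\<close> truncated subtraction in \<open>m - 1\<close> gives
        a wrong degree, but then the polynomial vanishes.\<close>
      have C: "int (a + a + (m - 1)) = int (a + b) - 1 \<or> \<alpha>1 ^ a * \<alpha>2 ^ a * complete_sum m = 0"
        by (cases m) (simp_all add: b complete_sum_def)
      show ?thesis unfolding q by (rule symmetric_homogenI[OF A[unfolded mult_1] B C])
    qed
    show ?thesis
    proof (cases "a \<le> b")
      case True
      then show ?thesis using main[of a b] by (simp add: k1 s1)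
    next
      case False
      then have "symmetric_homogen (int (b + a) - 1) ((x ^ b * y ^ a - x ^ a * y ^ b) / (y - x))"
        using main[of b a] by simp
      then obtain p where p: "(x ^ b * y ^ a - x ^ a * y ^ b) / (y - x) = to_fract p" "signed_symmetric 1 p"
        "\<forall>i j. bc p i j \<noteq> 0 \<longrightarrow> int (i + j) = int (b + a) - 1"
        by (auto simp: symmetric_homogen_def)
      have "(x ^ a * y ^ b - x ^ b * y ^ a) / (y - x) = - ((x ^ b * y ^ a - x ^ a * y ^ b) / (y - x))"
        by (simp add: minus_divide_left)
      also have "\<dots> = to_fract (- p)" using p(1) by simp
      finally have eqp: "(x ^ a * y ^ b - x ^ b * y ^ a) / (y - x) = to_fract (- p)" .
      have "symmetric_homogen (int (a + b) - 1) ((x ^ a * y ^ b - x ^ b * y ^ a) / (y - x))"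
        unfolding symmetric_homogen_def eqp
        using signed_symmetric_uminus[OF p(2)] p(3) by (intro exI[of _ "- p"]) (simp add: add.commute)
      then show ?thesis by (simp add: k1 s1)
    qed
  qed
  then show ?thesis unfolding eq by (rule sgn)
qed

section \<open>Orientability of embedded surfaces\<close>

unbundle cross3_syntax

text \<open>The determinant of \<open>u\<close>, \<open>p\<close>, \<open>q\<close>: up to scale,
  the signed area spanned by the shadows of \<open>p\<close> and \<open>q\<close> in a plane
  transverse to \<open>u\<close>.\<close>

definition D :: "real^3 \<Rightarrow> real^3 \<Rightarrow> real^3 \<Rightarrow> real" where
  "D u p q = u \<bullet> (p \<times> q)"

lemma D_simps:
  "D u (x + y) z = D u x z + D u y z" "D u z (x + y) = D u z x + D u z y"
  "D u (x - y) z = D u x z - D u y z" "D u z (x - y) = D u z x - D u z y"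
  "D u (k *\<^sub>R x) z = k * D u x z" "D u z (k *\<^sub>R x) = k * D u z x"
  "D u (- x) z = - D u x z" "D u z (- x) = - D u z x"
  "D u x x = 0" "D u u x = 0" "D u x u = 0" "D u 0 x = 0" "D u x 0 = 0"
  by (simp_all add: D_def cross_add_left cross_add_right inner_add_right inner_diff_right
      Cross3.left_diff_distrib Cross3.right_diff_distrib cross_mult_left cross_mult_right dot_cross_self)

lemma D_skew: "D u x y = - D u y x"
  unfolding D_def by (subst cross_skew) simp

text \<open>Along the curve of vectors \<open>(s, s^2, 1)\<close> the inner product with a nonzero
  \<open>n\<close> is a nonzero polynomial in \<open>s\<close>, so only finitely many
  \<open>s\<close> are excluded.\<close>

lemma generic_vector:
  assumes "finite N" "0 \<notin> N"
  shows "\<exists>u::real^3. \<forall>n\<in>N. u \<bullet> n \<noteq> 0"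
proof -
  define p where "p n = [:n$3, n$1, n$2:]" for n :: "real^3"
  have p0: "p n \<noteq> 0" if "n \<in> N" for n
  proof
    assume "p n = 0"
    then have "n $ i = 0" for i using exhaust_3[of i] by (auto simp: p_def)
    then have "n = 0" by (simp add: vec_eq_iff)
    then show False using that assms by auto
  qed
  have "finite (\<Union>n\<in>N. {s. poly (p n) s = 0})"
    using assms(1) p0 poly_roots_finite by blast
  then obtain s where s: "s \<notin> (\<Union>n\<in>N. {s. poly (p n) s = 0})"
    using ex_new_if_finite[OF infinite_UNIV_char_0] by blast
  have "(vector [s, s^2, 1] :: real^3) \<bullet> n = poly (p n) s" for n
    by (simp add: p_def inner_vec_def sum_3 vector_3 power2_eq_square algebra_simps)
  then show ?thesis using s by (intro exI[of _ "vector [s, s^2, 1]"]) auto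
qed

text \<open>Cramer's rule without denominators for the point where the line through \<open>q\<close>
  in direction \<open>u\<close> meets the plane of \<open>a\<close>, \<open>b\<close>,
  \<open>c\<close>; in coordinates it is a polynomial identity.\<close>

lemma bary_mult:
  "D u (b - a) (c - a) *\<^sub>R q + (((b - a) \<times> (c - a)) \<bullet> (a - q)) *\<^sub>R u =
   D u (c - b) (q - b) *\<^sub>R a + D u (a - c) (q - c) *\<^sub>R b + D u (b - a) (q - a) *\<^sub>R c"
  unfolding D_def by (simp add: vec_eq_iff forall_3 inner_vec_def sum_3 cross3_def vector_3) (intro conjI; algebra)

lemma bary_sum: "D u (c - b) (q - b) + D u (a - c) (q - c) + D u (b - a) (q - a) = D u (b - a) (c - a)"
  using D_skew[of u a b] D_skew[of u a c] D_skew[of u b c] D_skew[of u a q] D_skew[of u b q] D_skew[of u c q]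
  by (simp add: D_simps algebra_simps)

text \<open>The barycentric coordinate belonging to \<open>c\<close> of the point where the line
  through \<open>q\<close> in direction \<open>u\<close> meets the plane of the triangle. Cyclic
  permutation of the arguments gives the coordinates belonging to \<open>a\<close> and
  \<open>b\<close>.\<close>

definition lam :: "real^3 \<Rightarrow> real^3 \<Rightarrow> real^3 \<Rightarrow> real^3 \<Rightarrow> real^3 \<Rightarrow> real" where
  "lam u a b c q = D u (b - a) (q - a) / D u (b - a) (c - a)"

text \<open>The parameter \<open>s\<close> at which \<open>q + s *\<^sub>R u\<close> lies in the
  plane of the triangle; it is positive when the plane is above \<open>q\<close>.\<close>

definition ht :: "real^3 \<Rightarrow> real^3 \<Rightarrow> real^3 \<Rightarrow> real^3 \<Rightarrow> real^3 \<Rightarrow> real" where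
  "ht u a b c q = ((b - a) \<times> (c - a)) \<bullet> (a - q) / D u (b - a) (c - a)"

lemma D_rot: "D u (c - b) (a - b) = D u (b - a) (c - a)"
  using D_skew[of u a b] D_skew[of u a c] D_skew[of u b c] by (simp add: D_simps)

lemma D_swap: "D u (a - b) (c - b) = - D u (b - a) (c - a)"
  using D_skew[of u a b] D_skew[of u a c] D_skew[of u b c] by (simp add: D_simps)

lemma bary:
  assumes "D u (b - a) (c - a) \<noteq> 0"
  shows "q + ht u a b c q *\<^sub>R u = lam u b c a q *\<^sub>R a + lam u c a b q *\<^sub>R b + lam u a b c q *\<^sub>R c"
    and "lam u b c a q + lam u c a b q + lam u a b c q = 1"
proof -
  let ?d = "D u (b - a) (c - a)"
  have r: "D u (c - b) (a - b) = ?d" "D u (a - c) (b - c) = ?d"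
    using D_rot[of u] by simp_all
  show "lam u b c a q + lam u c a b q + lam u a b c q = 1"
    using bary_sum[of u c b q a] assms by (simp add: lam_def r add_divide_distrib[symmetric])
  have "?d *\<^sub>R (q + ht u a b c q *\<^sub>R u) = ?d *\<^sub>R (lam u b c a q *\<^sub>R a + lam u c a b q *\<^sub>R b + lam u a b c q *\<^sub>R c)"
    using bary_mult[of u b a c q] assms by (simp add: lam_def ht_def r scaleR_add_right)
  then show "q + ht u a b c q *\<^sub>R u = lam u b c a q *\<^sub>R a + lam u c a b q *\<^sub>R b + lam u a b c q *\<^sub>R c"
    using assms by simp
qed

lemma bary_unique:
  assumes d: "D u (b - a) (c - a) \<noteq> 0"
    and eq: "q + s *\<^sub>R u = x *\<^sub>R a + y *\<^sub>R b + z *\<^sub>R c" and sum: "x + y + z = 1"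
  shows "s = ht u a b c q" "x = lam u b c a q" "y = lam u c a b q" "z = lam u a b c q"
proof -
  have u0: "u \<noteq> 0" using d by (auto simp: D_def)
  have x: "x = 1 - y - z" using sum by simp
  have "q + s *\<^sub>R u = a + y *\<^sub>R (b - a) + z *\<^sub>R (c - a)"
    unfolding eq x by (simp add: algebra_simps)
  then have q: "q = a + y *\<^sub>R (b - a) + z *\<^sub>R (c - a) - s *\<^sub>R u"
    by (simp add: algebra_simps)
  have "D u (b - a) (q - a) = z * D u (b - a) (c - a)"
    using D_skew[of u a b] unfolding q by (simp add: D_simps algebra_simps)
  then show z: "z = lam u a b c q" using d by (simp add: lam_def)
  have "D u (a - c) (b - c) = D u (b - a) (c - a)" "D u (c - b) (a - b) = D u (b - a) (c - a)"
    using D_rot[of u] by simp_all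
  have "q - c = y *\<^sub>R (b - a) + (1 - z) *\<^sub>R (a - c) - s *\<^sub>R u"
    unfolding q by (simp add: algebra_simps)
  then have "D u (a - c) (q - c) = y * D u (a - c) (b - a)"
    by (simp add: D_simps)
  also have "D u (a - c) (b - a) = D u (b - a) (c - a)"
    using D_skew[of u "a - c" "b - a"] by (simp add: D_simps)
  finally show y: "y = lam u c a b q"
    using d \<open>D u (a - c) (b - c) = D u (b - a) (c - a)\<close> by (simp add: lam_def)
  show x: "x = lam u b c a q" using bary(2)[OF d, of q] sum y z by simp
  have "s *\<^sub>R u = ht u a b c q *\<^sub>R u"
    using bary(1)[OF d, of q] eq unfolding x y z by (metis add_left_cancel)
  then show "s = ht u a b c q" using u0 by simp
qed

lemma ray_mem_triangle:
  assumes d: "D u (b - a) (c - a) \<noteq> 0"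
  shows "q + s *\<^sub>R u \<in> convex hull {a, b, c} \<longleftrightarrow>
    s = ht u a b c q \<and> lam u b c a q \<ge> 0 \<and> lam u c a b q \<ge> 0 \<and> lam u a b c q \<ge> 0" (is "?l \<longleftrightarrow> ?r")
proof
  assume ?l
  then obtain x y z where *: "q + s *\<^sub>R u = x *\<^sub>R a + y *\<^sub>R b + z *\<^sub>R c" "x + y + z = 1" "0 \<le> x" "0 \<le> y" "0 \<le> z"
    by (auto simp: convex_hull_3)
  show ?r using bary_unique[OF d *(1,2)] *(3-5) by simp
next
  assume ?r
  then show ?l using bary[OF d, of q] by (auto simp: convex_hull_3)
qed

lemma ray_mem_edge:
  assumes d: "D u (b - a) (c - a) \<noteq> 0"
  shows "q + s *\<^sub>R u \<in> convex hull {a, b} \<longleftrightarrow>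
    s = ht u a b c q \<and> lam u b c a q \<ge> 0 \<and> lam u c a b q \<ge> 0 \<and> lam u a b c q = 0" (is "?l \<longleftrightarrow> ?r")
proof
  assume ?l
  then obtain x y where *: "q + s *\<^sub>R u = x *\<^sub>R a + y *\<^sub>R b" "x + y = 1" "0 \<le> x" "0 \<le> y"
    by (auto simp: convex_hull_2)
  show ?r using bary_unique[OF d, of q s x y 0] * by simp
next
  assume ?r
  then show ?l using bary[OF d, of q] by (force simp: convex_hull_2)
qed

lemma lam_affine: "\<exists>w k. \<forall>q. lam u a b c q = w \<bullet> q + k"
proof (intro exI allI)
  fix q
  have "D u (b - a) (q - a) = (u \<times> (b - a)) \<bullet> (q - a)"
    unfolding D_def by (metis cross_triple inner_commute)
  then show "lam u a b c q = ((1 / D u (b - a) (c - a)) *\<^sub>R (u \<times> (b - a))) \<bullet> q + (- (u \<times> (b - a)) \<bullet> a / D u (b - a) (c - a))"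
    by (simp add: lam_def inner_diff_right diff_divide_distrib)
qed

lemma ht_affine: "\<exists>w k. \<forall>q. ht u a b c q = w \<bullet> q + k"
proof (intro exI allI)
  fix q
  show "ht u a b c q = (- (1 / D u (b - a) (c - a)) *\<^sub>R ((b - a) \<times> (c - a))) \<bullet> q + ((b - a) \<times> (c - a)) \<bullet> a / D u (b - a) (c - a)"
    by (simp add: ht_def inner_diff_right diff_divide_distrib)
qed

section \<open>Stability of ray intersections under small displacements\<close>

lemma tendsto_affine:
  fixes f :: "real^3 \<Rightarrow> real"
  assumes "\<exists>w k. \<forall>q. f q = w \<bullet> q + k"
  shows "(f \<longlongrightarrow> f q0) (nhds q0)"
proof -
  obtain w k where "f = (\<lambda>q. w \<bullet> q + k)" using assms by blast
  then show ?thesis by (auto intro!: tendsto_intros filterlim_ident)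
qed

lemmas tendsto_lam = tendsto_affine[OF lam_affine] and tendsto_ht = tendsto_affine[OF ht_affine]

lemma affine_segment:
  fixes f :: "real^3 \<Rightarrow> real"
  assumes "\<exists>w k. \<forall>q. f q = w \<bullet> q + k"
  shows "f (m + d *\<^sub>R (x - m)) = (1 - d) * f m + d * f x"
proof -
  obtain w k where "f = (\<lambda>q. w \<bullet> q + k)" using assms by blast
  then show ?thesis by (simp add: inner_add_right inner_diff_right algebra_simps)
qed

text \<open>The ray is open, so a triangle containing \<open>q\<close> does not count as met at
  \<open>q\<close> itself.\<close>

definition hit :: "real^3 \<Rightarrow> (real^3) set \<Rightarrow> real^3 \<Rightarrow> bool" where
  "hit u t q \<longleftrightarrow> (\<exists>s>0. q + s *\<^sub>R u \<in> convex hull t)"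

lemma hit_iff:
  assumes d: "D u (b - a) (c - a) \<noteq> 0"
  shows "hit u {a, b, c} q \<longleftrightarrow> ht u a b c q > 0 \<and> lam u b c a q \<ge> 0 \<and> lam u c a b q \<ge> 0 \<and> lam u a b c q \<ge> 0"
  unfolding hit_def ray_mem_triangle[OF d] by auto

text \<open>Either some inequality of \<open>hit_iff\<close> fails strictly, or all hold strictly:
  otherwise a vanishing coordinate would put a point of the ray on an edge, and a vanishing height
  would put \<open>q0\<close> on the triangle. Strict inequalities of affine functions persist
  nearby.\<close>

lemma hit_stable:
  assumes d: "D u (b - a) (c - a) \<noteq> 0"
    and q0: "q0 \<notin> convex hull {a, b, c}"
    and edges: "\<And>s e. s > 0 \<Longrightarrow> e \<in> {{a, b}, {b, c}, {c, a}} \<Longrightarrow> q0 + s *\<^sub>R u \<notin> convex hull e"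
  shows "\<forall>\<^sub>F q in nhds q0. hit u {a, b, c} q \<longleftrightarrow> hit u {a, b, c} q0"
proof -
  let ?A = "lam u b c a" and ?B = "lam u c a b" and ?C = "lam u a b c" and ?h = "ht u a b c"
  have r: "D u (c - b) (a - b) \<noteq> 0" "D u (a - c) (b - c) \<noteq> 0"
    using d D_rot[of u] by simp_all
  note t = tendsto_lam[of u b c a q0] tendsto_lam[of u c a b q0] tendsto_lam[of u a b c q0] tendsto_ht[of u a b c q0]
  consider "?h q0 < 0" | "?A q0 < 0" | "?B q0 < 0" | "?C q0 < 0"
    | "?h q0 \<ge> 0" "?A q0 \<ge> 0" "?B q0 \<ge> 0" "?C q0 \<ge> 0" by linarith
  then show ?thesis
  proof cases
    case 1
    then have "\<forall>\<^sub>F q in nhds q0. ?h q < 0" using order_tendstoD(2)[OF t(4)] by blast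
    then show ?thesis by eventually_elim (use 1 in \<open>simp add: hit_iff[OF d]\<close>)
  next
    case 2
    then have "\<forall>\<^sub>F q in nhds q0. ?A q < 0" using order_tendstoD(2)[OF t(1)] by blast
    then show ?thesis by eventually_elim (use 2 in \<open>simp add: hit_iff[OF d]\<close>)
  next
    case 3
    then have "\<forall>\<^sub>F q in nhds q0. ?B q < 0" using order_tendstoD(2)[OF t(2)] by blast
    then show ?thesis by eventually_elim (use 3 in \<open>simp add: hit_iff[OF d]\<close>)
  next
    case 4
    then have "\<forall>\<^sub>F q in nhds q0. ?C q < 0" using order_tendstoD(2)[OF t(3)] by blast
    then show ?thesis by eventually_elim (use 4 in \<open>simp add: hit_iff[OF d]\<close>)
  next
    case 5
    have mem: "q0 + ?h q0 *\<^sub>R u \<in> convex hull {a, b, c}"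
      using 5 ray_mem_triangle[OF d] by blast
    have h: "?h q0 > 0"
      using mem q0 5(1) by (cases "?h q0 = 0") auto
    have hb: "?h q0 = ht u b c a q0" "?h q0 = ht u c a b q0"
      using ray_mem_triangle[OF r(1), of q0 "?h q0"] ray_mem_triangle[OF r(2), of q0 "?h q0"] mem
      by (auto simp: insert_commute)
    have "?C q0 \<noteq> 0" using edges[OF h, of "{a, b}"] ray_mem_edge[OF d, of q0 "?h q0"] 5 by auto
    moreover have "?A q0 \<noteq> 0"
      using edges[OF h, of "{b, c}"] ray_mem_edge[OF r(1), of q0 "?h q0"] 5 hb by auto
    moreover have "?B q0 \<noteq> 0"
      using edges[OF h, of "{c, a}"] ray_mem_edge[OF r(2), of q0 "?h q0"] 5 hb by auto
    ultimately have pos: "?A q0 > 0" "?B q0 > 0" "?C q0 > 0" using 5 by auto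
    have "\<forall>\<^sub>F q in nhds q0. ?A q > 0" "\<forall>\<^sub>F q in nhds q0. ?B q > 0" "\<forall>\<^sub>F q in nhds q0. ?C q > 0" "\<forall>\<^sub>F q in nhds q0. ?h q > 0"
      using order_tendstoD(1)[OF t(1) pos(1)] order_tendstoD(1)[OF t(2) pos(2)]
        order_tendstoD(1)[OF t(3) pos(3)] order_tendstoD(1)[OF t(4) h] by blast+
    then show ?thesis
      by eventually_elim (use pos h in \<open>simp add: hit_iff[OF d]\<close>)
  qed
qed

lemma near_edge:
  assumes d: "D u (b - a) (c - a) \<noteq> 0"
    and m: "q0 + s *\<^sub>R u \<in> convex hull {a, b}" "q0 + s *\<^sub>R u \<noteq> a" "q0 + s *\<^sub>R u \<noteq> b"
  shows "\<forall>\<^sub>F q in nhds q0. lam u b c a q > 0 \<and> lam u c a b q > 0"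
proof -
  have *: "s = ht u a b c q0" "lam u b c a q0 \<ge> 0" "lam u c a b q0 \<ge> 0" "lam u a b c q0 = 0"
    using ray_mem_edge[OF d] m(1) by blast+
  have eq: "q0 + s *\<^sub>R u = lam u b c a q0 *\<^sub>R a + lam u c a b q0 *\<^sub>R b" "lam u b c a q0 + lam u c a b q0 = 1"
    using bary[OF d, of q0] * by auto
  have "lam u b c a q0 \<noteq> 0" "lam u c a b q0 \<noteq> 0"
    using eq m(2,3) by auto
  then have pos: "lam u b c a q0 > 0" "lam u c a b q0 > 0" using * by auto
  show ?thesis
    using order_tendstoD(1)[OF tendsto_lam pos(1)] order_tendstoD(1)[OF tendsto_lam pos(2)]
    by eventually_elim simp
qed

text \<open>A ray that misses the edge violates one of the conditions of \<open>ray_mem_edge\<close>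
  by a strict inequality or by a nonzero coordinate, and both persist nearby.\<close>

lemma ray_misses_edge_stable:
  assumes d: "D u (b - a) (c - a) \<noteq> 0"
    and "\<And>s. s \<ge> 0 \<Longrightarrow> q0 + s *\<^sub>R u \<notin> convex hull {a, b}"
  shows "\<forall>\<^sub>F q in nhds q0. \<forall>s\<ge>0. q + s *\<^sub>R u \<notin> convex hull {a, b}"
proof -
  let ?A = "lam u b c a" and ?B = "lam u c a b" and ?C = "lam u a b c" and ?h = "ht u a b c"
  note t = tendsto_lam[of u b c a q0] tendsto_lam[of u c a b q0] tendsto_lam[of u a b c q0] tendsto_ht[of u a b c q0]
  consider "?h q0 < 0" | "?A q0 < 0" | "?B q0 < 0" | "?C q0 \<noteq> 0"
    using assms(2)[of "?h q0"] ray_mem_edge[OF d, of q0 "?h q0"] by fastforce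
  then have "\<forall>\<^sub>F q in nhds q0. ?h q < 0 \<or> ?A q < 0 \<or> ?B q < 0 \<or> ?C q \<noteq> 0"
  proof cases
    case 1
    show ?thesis using order_tendstoD(2)[OF t(4) 1] by eventually_elim simp
  next
    case 2
    show ?thesis using order_tendstoD(2)[OF t(1) 2] by eventually_elim simp
  next
    case 3
    show ?thesis using order_tendstoD(2)[OF t(2) 3] by eventually_elim simp
  next
    case 4
    show ?thesis using tendsto_imp_eventually_ne[OF t(3) 4] by eventually_elim simp
  qed
  then show ?thesis by eventually_elim (auto simp: ray_mem_edge[OF d])
qed

section \<open>Embedded triangulated surfaces and a generic direction\<close>

locale embedded =
  fixes T :: "(real^3) set set"
  assumes finT: "finite T" and card3: "t \<in> T \<Longrightarrow> card t = 3"
    and two: "t \<in> T \<Longrightarrow> e \<subseteq> t \<Longrightarrow> card e = 2 \<Longrightarrow> card {t'\<in>T. e \<subseteq> t'} = 2"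
    and indep: "t \<in> T \<Longrightarrow> \<not> affine_dependent t"
    and meet: "t \<in> T \<Longrightarrow> t' \<in> T \<Longrightarrow> s \<subseteq> t \<Longrightarrow> s' \<subseteq> t' \<Longrightarrow>
      convex hull s \<inter> convex hull s' = convex hull (s \<inter> s')"

text \<open>Two consequences matter: no triangle is parallel to \<open>u\<close>, and lines through
  vertices whose shadows along \<open>u\<close> are parallel are themselves parallel.\<close>

locale generic_embedded = embedded +
  fixes u :: "real^3"
  assumes generic: "a \<in> \<Union>T \<Longrightarrow> b \<in> \<Union>T \<Longrightarrow> c \<in> \<Union>T \<Longrightarrow> d \<in> \<Union>T \<Longrightarrow>
      (b - a) \<times> (d - c) \<noteq> 0 \<Longrightarrow> D u (b - a) (d - c) \<noteq> 0"

lemma (in embedded) generic_exists: "\<exists>u. generic_embedded T u"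
proof -
  let ?V = "\<Union>T"
  let ?N = "(\<Union>a\<in>?V. \<Union>b\<in>?V. \<Union>c\<in>?V. \<Union>d\<in>?V. {(b - a) \<times> (d - c)}) - {0}"
  have "finite ?V" using finT card3 by (metis card.infinite finite_Union zero_neq_numeral)
  then have "finite ?N" by (intro finite_Diff finite_UN_I) auto
  then obtain u where u: "\<forall>n\<in>?N. u \<bullet> n \<noteq> 0" using generic_vector[of ?N] by auto
  have "generic_embedded T u"
  proof (unfold_locales)
    fix a b c d assume *: "a \<in> ?V" "b \<in> ?V" "c \<in> ?V" "d \<in> ?V" "(b - a) \<times> (d - c) \<noteq> 0"
    then have "(b - a) \<times> (d - c) \<in> ?N" by blast
    then show "D u (b - a) (d - c) \<noteq> 0" using u unfolding D_def by blast
  qed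
  then show ?thesis by blast
qed

context generic_embedded
begin

definition E :: "(real^3) set set" where
  "E = {e. card e = 2 \<and> (\<exists>t\<in>T. e \<subseteq> t)}"

lemma fint: "t \<in> T \<Longrightarrow> finite t"
  using card3 by (metis card.infinite zero_neq_numeral)

lemma finE: "finite E"
  using finT fint by (intro finite_subset[of E "Pow (\<Union>T)"]) (auto simp: E_def)

lemma tri_D:
  assumes t: "{a, b, c} \<in> T"
  shows "D u (b - a) (c - a) \<noteq> 0" "a \<noteq> b" "a \<noteq> c" "b \<noteq> c"
proof -
  show d: "a \<noteq> b" "a \<noteq> c" "b \<noteq> c"
    using card3[OF t] by (auto simp: card_insert_if split: if_splits)
  have "\<not> collinear {a, b, c}"
    using indep[OF t] d by (simp add: collinear_3_eq_affine_dependent)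
  then have "\<not> collinear {b, a, c}" by (simp add: insert_commute)
  moreover have "collinear {b, a, c} = collinear {0, b - a, c - a}"
    by (rule collinear_3) (simp add: NO_MATCH_def)
  ultimately have "\<not> collinear {0, b - a, c - a}" by simp
  then have "(b - a) \<times> (c - a) \<noteq> 0" by (simp add: cross_eq_0)
  then show "D u (b - a) (c - a) \<noteq> 0" using generic[of a b a c] t by blast
qed

lemma edge_triangle:
  assumes "e \<in> E" "t \<in> T" "e \<subseteq> t"
  obtains a b c where "e = {a, b}" "t = {a, b, c}" "a \<noteq> b" "c \<notin> e"
proof -
  obtain a b where e: "e = {a, b}" "a \<noteq> b" using assms(1) by (auto simp: E_def card_2_iff)
  have "card (t - e) = 1"
    using assms card3[of t] e by (subst card_Diff_subset) auto
  then obtain c where c: "t - e = {c}" by (meson card_1_singletonE)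
  then have "t = {a, b, c}" "c \<notin> e" using assms(3) e by auto
  then show ?thesis using that e by blast
qed

lemma E_triangle:
  assumes "e \<in> E"
  obtains a b c where "e = {a, b}" "{a, b, c} \<in> T" "a \<noteq> b" "c \<notin> e"
proof -
  obtain t where "t \<in> T" "e \<subseteq> t" using assms by (auto simp: E_def)
  then show ?thesis using edge_triangle[OF assms] that by metis
qed

lemma edges_of_triangle: "{a, b, c} \<in> T \<Longrightarrow> e \<in> {{a, b}, {b, c}, {c, a}} \<Longrightarrow> e \<in> E \<and> e \<subseteq> {a, b, c}"
  using tri_D(2-4)[of a b c] unfolding E_def by (auto simp: card_insert_if intro!: bexI[of _ "{a, b, c}"])

lemma not_vertical: "t \<in> T \<Longrightarrow> q \<in> convex hull t \<Longrightarrow> q + s *\<^sub>R u \<in> convex hull t \<Longrightarrow> s = 0"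
proof -
  assume t: "t \<in> T" and q: "q \<in> convex hull t" "q + s *\<^sub>R u \<in> convex hull t"
  obtain a b c where abc: "t = {a, b, c}" using card3[OF t] by (auto simp: card_3_iff)
  have d: "D u (b - a) (c - a) \<noteq> 0" using tri_D t abc by simp
  show "s = 0"
    using ray_mem_triangle[OF d, of q 0] ray_mem_triangle[OF d, of q s] q abc by simp
qed

text \<open>By \<open>meet\<close> the edge and the simplex intersect in the hull of at most one
  vertex.\<close>

lemma edge_inter_vertex:
  assumes "e \<in> E" "s \<subseteq> t" "t \<in> T" "\<not> e \<subseteq> s" "x \<in> convex hull e" "x \<in> convex hull s"
  shows "x \<in> e"
proof -
  obtain t' where t': "t' \<in> T" "e \<subseteq> t'" using assms(1) by (auto simp: E_def)
  have x: "x \<in> convex hull (e \<inter> s)"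
    using meet[OF t'(1) assms(3) t'(2) assms(2)] assms(5,6) by auto
  have fe: "finite e" "card e = 2" using assms(1) by (auto simp: E_def card_ge_0_finite)
  have "card (e \<inter> s) < 2"
    using assms(4) fe psubset_card_mono[of e "e \<inter> s"] by auto
  then have "card (e \<inter> s) = 0 \<or> card (e \<inter> s) = 1" by linarith
  then show ?thesis
  proof
    assume "card (e \<inter> s) = 0"
    then have "e \<inter> s = {}" using fe by simp
    then show ?thesis using x by simp
  next
    assume "card (e \<inter> s) = 1"
    then obtain y where "e \<inter> s = {y}" by (meson card_1_singletonE)
    then show ?thesis using x by auto
  qed
qed

text \<open>\<open>s\<close> may have either sign: it does not matter whether \<open>e'\<close>
  passes above or below.\<close>

definition crossing :: "(real^3) set \<Rightarrow> (real^3) set \<Rightarrow> (real^3) set" where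
  "crossing e e' = {x \<in> convex hull e. \<exists>s. s \<noteq> 0 \<and> x + s *\<^sub>R u \<in> convex hull e'}"

text \<open>Two crossings would make the shadows of the edges overlap along a segment. Genericity
  then forces the edges to be parallel and, applied to \<open>c - a\<close>, to lie on one line; so
  \<open>u\<close> would be parallel to an edge and hence to a triangle.\<close>

lemma crossing_unique:
  assumes "e \<in> E" "e' \<in> E" "x \<in> crossing e e'" "y \<in> crossing e e'"
  shows "x = y"
proof (rule ccontr)
  assume "x \<noteq> y"
  obtain a b a' where ab: "e = {a, b}" "{a, b, a'} \<in> T" using E_triangle[OF assms(1)] by metis
  obtain c d c' where cd: "e' = {c, d}" "{c, d, c'} \<in> T" using E_triangle[OF assms(2)] by metis
  obtain s where s: "x \<in> convex hull e" "s \<noteq> 0" "x + s *\<^sub>R u \<in> convex hull e'"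
    using assms(3) by (auto simp: crossing_def)
  obtain r where r: "y \<in> convex hull e" "r \<noteq> 0" "y + r *\<^sub>R u \<in> convex hull e'"
    using assms(4) by (auto simp: crossing_def)
  have seg: "\<exists>k. z = p + k *\<^sub>R (q - p)" if "z \<in> convex hull {p, q}" for z p q :: "real^3"
    using that by (auto simp: convex_hull_2_alt)
  obtain k1 where k1: "x = a + k1 *\<^sub>R (b - a)" using seg s(1) ab(1) by blast
  obtain k2 where k2: "y = a + k2 *\<^sub>R (b - a)" using seg r(1) ab(1) by blast
  obtain l1 where l1: "x + s *\<^sub>R u = c + l1 *\<^sub>R (d - c)" using seg s(3) cd(1) by blast
  obtain l2 where l2: "y + r *\<^sub>R u = c + l2 *\<^sub>R (d - c)" using seg r(3) cd(1) by blast
  define p where "p = b - a"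
  have V: "a \<in> \<Union>T" "b \<in> \<Union>T" "c \<in> \<Union>T" "d \<in> \<Union>T"
    using UnionI[OF ab(2), of a] UnionI[OF ab(2), of b] UnionI[OF cd(2), of c] UnionI[OF cd(2), of d] by simp_all
  have up: "\<not> (\<exists>k. k \<noteq> 0 \<and> k *\<^sub>R u \<times> p = 0)"
  proof
    assume "\<exists>k. k \<noteq> 0 \<and> k *\<^sub>R u \<times> p = 0"
    then have "u \<times> p = 0" by (auto simp: cross_mult_left)
    then have "D u p (a' - a) = 0"
      unfolding D_def by (metis cross_triple inner_commute inner_zero_left)
    then show False using tri_D(1)[OF ab(2)] by (simp add: p_def)
  qed
  define k l where "k = k2 - k1" and "l = l2 - l1"
  have k: "k *\<^sub>R p + (r - s) *\<^sub>R u = l *\<^sub>R (d - c)"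
  proof -
    have "l *\<^sub>R (d - c) = (y + r *\<^sub>R u) - (x + s *\<^sub>R u)"
      unfolding l1 l2 l_def by (simp add: algebra_simps)
    also have "\<dots> = k *\<^sub>R p + (r - s) *\<^sub>R u"
      unfolding k1 k2 k_def p_def by (simp add: algebra_simps)
    finally show ?thesis by simp
  qed
  have "k \<noteq> 0" using \<open>x \<noteq> y\<close> k1 k2 by (auto simp: k_def)
  have "l \<noteq> 0"
  proof
    assume "l = 0"
    then have "k *\<^sub>R p = (s - r) *\<^sub>R u" using k by (simp add: algebra_simps)
    then have "D u (k *\<^sub>R p) (a' - a) = 0" by (simp add: D_simps)
    then show False using \<open>k \<noteq> 0\<close> tri_D(1)[OF ab(2)] by (simp add: D_simps p_def)
  qed
  have "D u (l *\<^sub>R (d - c)) p = 0" unfolding k[symmetric] by (simp add: D_simps)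
  then have "D u p (d - c) = 0" using \<open>l \<noteq> 0\<close> D_skew[of u p "d - c"] by (simp only: D_simps) simp
  then have par: "p \<times> (d - c) = 0" using generic[OF V] by (auto simp: p_def)
  have "((r - s) *\<^sub>R u) \<times> p = (l *\<^sub>R (d - c) - k *\<^sub>R p) \<times> p"
    using k by (metis add_diff_cancel_left')
  also have "\<dots> = 0"
    using par by (simp add: Cross3.left_diff_distrib Cross3.right_diff_distrib cross_mult_left cross_mult_right cross_skew[of _ p])
  finally have "r = s" using up by (auto simp: cross_mult_left)
  have "x + s *\<^sub>R u - x = (c - a) + l1 *\<^sub>R (d - c) - k1 *\<^sub>R p"
    unfolding l1 by (simp add: k1 p_def)
  then have su: "s *\<^sub>R u = (c - a) + l1 *\<^sub>R (d - c) - k1 *\<^sub>R p" by simp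
  have dc: "l *\<^sub>R (d - c) = k *\<^sub>R p" using k \<open>r = s\<close> by simp
  then have dc': "d - c = (k / l) *\<^sub>R p"
    using \<open>l \<noteq> 0\<close> by (metis (no_types, lifting) divide_inverse_commute inverse_eq_divide left_inverse scaleR_one scaleR_scaleR)
  have su': "s *\<^sub>R u = (c - a) + (l1 * (k / l) - k1) *\<^sub>R p"
    unfolding su dc' by (simp add: scaleR_left_diff_distrib)
  have "D u p (s *\<^sub>R u) = 0" by (simp add: D_simps)
  then have "D u p (c - a) = 0" unfolding su' by (simp add: D_simps)
  then have "p \<times> (c - a) = 0" using generic[of a b a c] V by (auto simp: p_def)
  then have "(s *\<^sub>R u) \<times> p = 0"
    unfolding su' by (simp add: cross_add_left cross_add_right cross_mult_left cross_mult_right cross_skew[of _ p])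
  then show False using up s(2) by (auto simp: cross_mult_left)
qed

text \<open>Vertices, and edge points aligned with a further edge. \<open>bad\<close> collects the
  points strictly below them, so that a ray starting off \<open>bad\<close> meets at most one
  edge.\<close>

definition CX :: "(real^3) set" where
  "CX = \<Union>T \<union> (\<Union>e\<in>E. \<Union>e'\<in>E. crossing e e')"

lemma finite_CX: "finite CX"
proof -
  have "finite (crossing e e')" if "e \<in> E" "e' \<in> E" for e e'
  proof -
    have "\<exists>x. crossing e e' \<subseteq> {x}" using crossing_unique[OF that] by blast
    then show ?thesis by (meson finite.emptyI finite.insertI finite_subset)
  qed
  then show ?thesis using finT fint finE by (auto simp: CX_def)
qed

definition bad :: "(real^3) set" where
  "bad = {q. \<exists>x\<in>CX. \<exists>s>0. x = q + s *\<^sub>R u}"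

text \<open>A line along \<open>u\<close> meets a triangle at most once, so each point of the finite
  set \<open>CX\<close> makes at most one point of \<open>t\<close> bad.\<close>

lemma finite_bad:
  assumes "t \<in> T"
  shows "finite (bad \<inter> convex hull t)"
proof -
  have "finite {q \<in> convex hull t. \<exists>s>0. x = q + s *\<^sub>R u}" for x
  proof -
    have "q = q'" if q: "q \<in> convex hull t" "q' \<in> convex hull t" "x = q + s *\<^sub>R u" "x = q' + s' *\<^sub>R u" for q q' s s'
    proof -
      have "q' = q + (s - s') *\<^sub>R u" using q(3,4) by (simp add: algebra_simps)
      then show ?thesis using not_vertical[OF assms, of q "s - s'"] q by simp
    qed
    then have "\<exists>q0. {q \<in> convex hull t. \<exists>s>0. x = q + s *\<^sub>R u} \<subseteq> {q0}" by blast
    then show ?thesis by (meson finite.emptyI finite.insertI finite_subset)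
  qed
  then have "finite (\<Union>x\<in>CX. {q \<in> convex hull t. \<exists>s>0. x = q + s *\<^sub>R u})"
    using finite_CX by blast
  then show ?thesis by (rule rev_finite_subset) (auto simp: bad_def)
qed

definition gen :: "real^3 \<Rightarrow> bool" where
  "gen q \<longleftrightarrow> (\<forall>e\<in>E. \<forall>s>0. q + s *\<^sub>R u \<notin> convex hull e)"

definition above :: "real^3 \<Rightarrow> nat" where
  "above q = card {t\<in>T. hit u t q}"

lemma gen_not_bad:
  assumes "gen q" shows "q \<notin> bad"
proof
  assume "q \<in> bad"
  then obtain x s where x: "x \<in> CX" "s > 0" "x = q + s *\<^sub>R u" by (auto simp: bad_def)
  have "\<exists>e\<in>E. x \<in> convex hull e"
  proof (cases "x \<in> \<Union>T")
    case True
    then obtain t where t: "t \<in> T" "x \<in> t" by auto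
    obtain y where "y \<in> t" "y \<noteq> x" using card3[OF t(1)] t
      by (metis card_1_singleton_iff is_singletonI' is_singleton_altdef numeral_eq_one_iff semiring_norm(86) empty_iff)
    then have "{x, y} \<in> E" using t by (auto simp: E_def)
    then show ?thesis using hull_inc[of x "{x, y}" convex] by blast
  next
    case False
    then show ?thesis using x by (auto simp: CX_def crossing_def)
  qed
  then show False using assms x by (auto simp: gen_def)
qed

lemma rel_interior_proper:
  assumes "t \<in> T" "s \<subset> t" "q \<in> rel_interior (convex hull t)"
  shows "q \<notin> convex hull s"
proof
  assume q: "q \<in> convex hull s"
  have f: "convex hull s face_of convex hull t"
    using face_of_convex_hull_affine_independent[OF indep[OF assms(1)]] assms(2) by blast
  have "convex hull s \<noteq> convex hull t"
  proof
    assume eq: "convex hull s = convex hull t"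
    obtain v where v: "v \<in> t" "v \<notin> s" using assms(2) by auto
    have "v \<in> convex hull s" using v hull_inc[of v t convex] eq by simp
    then have "v \<in> convex hull (t - {v})" using assms(2) v hull_mono[of s "t - {v}" convex] by blast
    then have "v \<in> affine hull (t - {v})" using convex_hull_subset_affine_hull by blast
    then show False using indep[OF assms(1)] v by (auto simp: affine_dependent_def)
  qed
  then show False using face_of_disjoint_rel_interior[OF f] q assms(3) by blast
qed

lemma rel_interior_other:
  assumes "t \<in> T" "t' \<in> T" "s' \<subseteq> t'" "\<not> t \<subseteq> s'" "q \<in> rel_interior (convex hull t)"
  shows "q \<notin> convex hull s'"
proof
  assume "q \<in> convex hull s'"
  moreover have "q \<in> convex hull t" using assms(5) rel_interior_subset by blast
  ultimately have "q \<in> convex hull (t \<inter> s')" using meet[of t t' t s'] assms by blast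
  moreover have "t \<inter> s' \<subset> t" using assms(4) by auto
  ultimately show False using rel_interior_proper assms by blast
qed

lemma tri_subset_eq: "t \<in> T \<Longrightarrow> t' \<in> T \<Longrightarrow> t \<subseteq> t' \<Longrightarrow> t = t'"
  using card3 fint by (metis card_subset_eq)

lemma rel_interior_edge:
  assumes "t \<in> T" "e \<in> E" "q \<in> rel_interior (convex hull t)"
  shows "q \<notin> convex hull e"
proof -
  obtain t' where "t' \<in> T" "e \<subseteq> t'" using assms by (auto simp: E_def)
  moreover have "\<not> t \<subseteq> e"
  proof
    assume "t \<subseteq> e"
    then have "card t \<le> card e" using assms(2) by (intro card_mono) (auto simp: E_def card_ge_0_finite)
    then show False using assms card3 by (auto simp: E_def)
  qed
  ultimately show ?thesis using rel_interior_other assms by blast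
qed

lemma hit_self: "t \<in> T \<Longrightarrow> q \<in> convex hull t \<Longrightarrow> \<not> hit u t q"
  using not_vertical by (fastforce simp: hit_def)

lemma hit_stable':
  assumes t: "t \<in> T" and q0: "q0 \<notin> convex hull t"
    and "\<And>e s. e \<in> E \<Longrightarrow> e \<subseteq> t \<Longrightarrow> s > 0 \<Longrightarrow> q0 + s *\<^sub>R u \<notin> convex hull e"
  shows "\<forall>\<^sub>F q in nhds q0. hit u t q \<longleftrightarrow> hit u t q0"
proof -
  obtain a b c where abc: "t = {a, b, c}" using card3[OF t] by (auto simp: card_3_iff)
  have d: "D u (b - a) (c - a) \<noteq> 0" using tri_D t abc by simp
  show ?thesis
    unfolding abc by (rule hit_stable[OF d]) (use assms edges_of_triangle[of a b c] in \<open>auto simp: abc\<close>)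
qed

lemma edge_miss_stable:
  assumes e: "e \<in> E" and "\<And>s. s \<ge> 0 \<Longrightarrow> q0 + s *\<^sub>R u \<notin> convex hull e"
  shows "\<forall>\<^sub>F q in nhds q0. \<forall>s\<ge>0. q + s *\<^sub>R u \<notin> convex hull e"
proof -
  obtain a b c where "e = {a, b}" "{a, b, c} \<in> T" using E_triangle[OF e] by metis
  then show ?thesis using ray_misses_edge_stable[of u b a c q0] tri_D(1)[of a b c] assms(2) by simp
qed

end

section \<open>Parity of the number of triangles above a point\<close>

context generic_embedded
begin

lemma eventually_segment:
  fixes m x :: "real^3"
  assumes "\<forall>\<^sub>F q in nhds m. P q"
  shows "\<forall>\<^sub>F d in at_right 0. P (m + d *\<^sub>R (x - m))"
proof -
  have "((\<lambda>d. m + d *\<^sub>R (x - m)) \<longlongrightarrow> m + 0 *\<^sub>R (x - m)) (at_right 0)"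
    by (intro tendsto_intros)
  then show ?thesis using assms by (simp add: filterlim_iff)
qed

lemma above_split:
  assumes "t1 \<in> T" "t2 \<in> T" "t1 \<noteq> t2"
  shows "above q = card {t \<in> T - {t1, t2}. hit u t q} + of_bool (hit u t1 q) + of_bool (hit u t2 q)"
proof -
  have c: "card {t\<in>A. hit u t q} = (\<Sum>t\<in>A. of_bool (hit u t q))" if "finite A" for A
    using that by (simp add: sum_of_bool_eq Int_def)
  have "above q = (\<Sum>t\<in>T. of_bool (hit u t q))"
    unfolding above_def using c finT by blast
  also have "\<dots> = of_bool (hit u t1 q) + (of_bool (hit u t2 q) + (\<Sum>t\<in>T - {t1} - {t2}. of_bool (hit u t q)))"
    using assms finT by (subst sum.remove[of T t1], simp, simp, subst sum.remove[of "T - {t1}" t2]) auto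
  also have "T - {t1} - {t2} = T - {t1, t2}" by auto
  finally show ?thesis using c[of "T - {t1, t2}"] finT by simp
qed

lemma edge_two:
  assumes "{a, b} \<in> E"
  shows "\<exists>c1 c2. {a, b, c1} \<in> T \<and> {a, b, c2} \<in> T \<and> {a, b, c1} \<noteq> {a, b, c2} \<and>
    {t\<in>T. {a, b} \<subseteq> t} = {{a, b, c1}, {a, b, c2}}"
proof -
  obtain t where "t \<in> T" "{a, b} \<subseteq> t" "card {a, b} = 2" using assms by (auto simp: E_def)
  then have "card {t\<in>T. {a, b} \<subseteq> t} = 2" by (rule two)
  then obtain t1 t2 where t: "{t\<in>T. {a, b} \<subseteq> t} = {t1, t2}" "t1 \<noteq> t2" by (meson card_2_iff)
  have third: "\<exists>c. t = {a, b, c}" if t: "t \<in> T" "{a, b} \<subseteq> t" for t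
  proof -
    obtain a' b' c where "{a, b} = {a', b'}" "t = {a', b', c}"
      using edge_triangle[OF assms t] by metis
    then have "t = insert c {a, b}" by auto
    then have "t = {a, b, c}" by auto
    then show ?thesis by blast
  qed
  have "t1 \<in> T" "{a, b} \<subseteq> t1" "t2 \<in> T" "{a, b} \<subseteq> t2" using t(1) by blast+
  then obtain c1 c2 where "t1 = {a, b, c1}" "t2 = {a, b, c2}" using third by metis
  then show ?thesis using t \<open>t1 \<in> T\<close> \<open>t2 \<in> T\<close> by (intro exI[of _ c1] exI[of _ c2]) simp
qed

text \<open>If all vertices of \<open>t\<close> lay in the vertical plane through the edge,
  genericity would make the sides of \<open>t\<close> parallel to the edge and \<open>t\<close>
  degenerate. The vertex found gives a direction in \<open>t\<close> that leaves the shadow of the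
  edge.\<close>

lemma transversal_vertex:
  assumes e: "{a, b} \<in> E" and t: "t \<in> T"
  shows "\<exists>v\<in>t. D u (b - a) (v - a) \<noteq> 0"
proof (rule ccontr)
  assume no: "\<not> ?thesis"
  obtain x y z where t': "t = {x, y, z}" using card3[OF t] by (auto simp: card_3_iff)
  define p where "p = b - a"
  have ab: "a \<noteq> b" "a \<in> \<Union>T" "b \<in> \<Union>T" using e by (auto simp: E_def)
  have "p \<noteq> 0" using ab by (simp add: p_def)
  have 0: "D u p (x - a) = 0" "D u p (y - a) = 0" "D u p (z - a) = 0"
    using no t' by (auto simp: p_def)
  have "D u p (y - x) = D u p (y - a) - D u p (x - a)" "D u p (z - x) = D u p (z - a) - D u p (x - a)"
    by (simp_all add: D_simps)
  then have d: "D u p (y - x) = 0" "D u p (z - x) = 0" using 0 by simp_all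
  have V: "x \<in> \<Union>T" "y \<in> \<Union>T" "z \<in> \<Union>T" using t t' by auto
  have "p \<times> (y - x) = 0" "p \<times> (z - x) = 0"
    using generic[of a b x y] generic[of a b x z] ab V d by (auto simp: p_def)
  then have "collinear {0, p, y - x}" "collinear {0, p, z - x}" by (simp_all add: cross_eq_0)
  then obtain k l where "y - x = k *\<^sub>R p" "z - x = l *\<^sub>R p"
    using \<open>p \<noteq> 0\<close> by (metis collinear_lemma scaleR_zero_left)
  then have "D u (y - x) (z - x) = 0" by (simp add: D_simps)
  then show False using tri_D(1)[of x y z] t t' by simp
qed

text \<open>How the number of triangles above a generic point varies across the vertical shadow of an
  edge: if the two triangles at the edge lie on the same side of the vertical plane through it, the
  number changes by two, otherwise it does not change.\<close>

lemma local_parity: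
  assumes t: "t \<in> T" and q0: "q0 \<in> rel_interior (convex hull t)" "q0 \<notin> bad"
  shows "\<exists>P. \<forall>\<^sub>F q in nhds q0. q \<in> convex hull t \<and> gen q \<longrightarrow> (even (above q) \<longleftrightarrow> P)"
    and "\<exists>v\<in>t. \<forall>\<^sub>F d in at_right 0. gen (q0 + d *\<^sub>R (v - q0))"
proof -
  have q0t: "q0 \<in> convex hull t" using q0(1) rel_interior_subset by blast
  have q0_other: "q0 \<notin> convex hull t'" if t': "t' \<in> T" "t' \<noteq> t" for t'
    using rel_interior_other[OF t t'(1) subset_refl _ q0(1)] tri_subset_eq[OF t t'(1)] t'(2) by blast
  have "(\<exists>P. \<forall>\<^sub>F q in nhds q0. q \<in> convex hull t \<and> gen q \<longrightarrow> (even (above q) \<longleftrightarrow> P)) \<and>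
    (\<exists>v\<in>t. \<forall>\<^sub>F d in at_right 0. gen (q0 + d *\<^sub>R (v - q0)))"
  proof (cases "gen q0")
    case True
    have "\<forall>\<^sub>F q in nhds q0. q \<in> convex hull t \<longrightarrow> (hit u t' q \<longleftrightarrow> hit u t' q0)" if t': "t' \<in> T" for t'
    proof (cases "t' = t")
      case True
      then show ?thesis using hit_self[OF t] q0t by auto
    next
      case False
      have "\<forall>\<^sub>F q in nhds q0. hit u t' q \<longleftrightarrow> hit u t' q0"
        using True t' False by (intro hit_stable' q0_other) (auto simp: gen_def)
      then show ?thesis by eventually_elim simp
    qed
    then have "\<forall>\<^sub>F q in nhds q0. \<forall>t'\<in>T. q \<in> convex hull t \<longrightarrow> (hit u t' q \<longleftrightarrow> hit u t' q0)"
      by (intro eventually_ball_finite[OF finT]) blast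
    then have "\<forall>\<^sub>F q in nhds q0. q \<in> convex hull t \<and> gen q \<longrightarrow> (even (above q) \<longleftrightarrow> even (above q0))"
    proof eventually_elim
      case (elim q)
      show ?case
      proof
        assume "q \<in> convex hull t \<and> gen q"
        then have "{t'\<in>T. hit u t' q} = {t'\<in>T. hit u t' q0}" using elim by blast
        then show "even (above q) \<longleftrightarrow> even (above q0)" by (simp add: above_def)
      qed
    qed
    moreover have "\<exists>v\<in>t. \<forall>\<^sub>F d in at_right 0. gen (q0 + d *\<^sub>R (v - q0))"
    proof -
      have "\<forall>\<^sub>F q in nhds q0. \<forall>s\<ge>0. q + s *\<^sub>R u \<notin> convex hull e" if e: "e \<in> E" for e
      proof (rule edge_miss_stable[OF e])
        fix s :: real assume "0 \<le> s"
        then show "q0 + s *\<^sub>R u \<notin> convex hull e"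
          using True e rel_interior_edge[OF t e q0(1)] by (cases "s = 0") (auto simp: gen_def)
      qed
      then have "\<forall>\<^sub>F q in nhds q0. \<forall>e\<in>E. \<forall>s\<ge>0. q + s *\<^sub>R u \<notin> convex hull e"
        by (intro eventually_ball_finite[OF finE]) blast
      then have "\<forall>\<^sub>F q in nhds q0. gen q" by eventually_elim (auto simp: gen_def)
      moreover obtain v where "v \<in> t" using card3[OF t] by (metis card.empty equals0I zero_neq_numeral)
      ultimately show ?thesis using eventually_segment by blast
    qed
    ultimately show ?thesis by blast
  next
    case False
    then obtain e s0 where e: "e \<in> E" "s0 > 0" "q0 + s0 *\<^sub>R u \<in> convex hull e"
      by (auto simp: gen_def)
    define m where "m = q0 + s0 *\<^sub>R u"
    have mCX: "m \<notin> CX" using q0(2) e(2) by (auto simp: bad_def m_def)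
    have me: "m \<in> convex hull e" using e by (simp add: m_def)
    have "m \<notin> \<Union>T" using mCX by (auto simp: CX_def)
    then have mv: "m \<notin> e" using e(1) by (auto simp: E_def)
    \<comment> \<open>As \<open>q0\<close> is not bad, only one edge lies above it: two edges
      meeting the ray at the same height share a vertex there, at different heights they give a
      crossing, and both kinds of points belong to \<open>CX\<close>.\<close>
    have uniq: "e' = e" if e': "e' \<in> E" "s > 0" "q0 + s *\<^sub>R u \<in> convex hull e'" for e' s
    proof (cases "s = s0")
      case True
      then have "m \<in> convex hull e'" using e' by (simp add: m_def)
      obtain t' where "t' \<in> T" "e' \<subseteq> t'" using e'(1) by (auto simp: E_def)
      then have "e \<subseteq> e'" using edge_inter_vertex[OF e(1)] me mv \<open>m \<in> convex hull e'\<close> by blast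
      moreover have "card e = card e'" "finite e'" using e(1) e'(1) by (auto simp: E_def card_ge_0_finite)
      ultimately show ?thesis using card_subset_eq[of e' e] by simp
    next
      case False
      have "m + (s - s0) *\<^sub>R u = q0 + s *\<^sub>R u" by (simp add: m_def algebra_simps)
      then have "m \<in> crossing e e'"
        using False e'(3) me by (auto simp: crossing_def intro!: exI[of _ "s - s0"])
      then show ?thesis using mCX e(1) e'(1) by (auto simp: CX_def)
    qed
    obtain a b where ab: "e = {a, b}" using E_triangle[OF e(1)] by metis
    obtain c1 c2 where c: "{a, b, c1} \<in> T" "{a, b, c2} \<in> T" "{a, b, c1} \<noteq> {a, b, c2}"
      "{t\<in>T. {a, b} \<subseteq> t} = {{a, b, c1}, {a, b, c2}}"
      using edge_two[of a b] e(1) unfolding ab by blast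
    define t1 t2 where "t1 = {a, b, c1}" and "t2 = {a, b, c2}"
    have other: "\<forall>\<^sub>F q in nhds q0. q \<in> convex hull t \<longrightarrow> (hit u t' q \<longleftrightarrow> hit u t' q0)"
      if t': "t' \<in> T - {t1, t2}" for t'
    proof (cases "t' = t")
      case True
      then show ?thesis using hit_self[OF t] q0t by auto
    next
      case False
      have "q0 + s *\<^sub>R u \<notin> convex hull e'" if "e' \<in> E" "e' \<subseteq> t'" "s > 0" for e' s
      proof
        assume "q0 + s *\<^sub>R u \<in> convex hull e'"
        then have "{a, b} \<subseteq> t'" using uniq[OF that(1,3)] that(2) ab by simp
        then have "t' \<in> {{a, b, c1}, {a, b, c2}}" using t' c(4) by blast
        then show False using t' by (simp add: t1_def t2_def)
      qed
      then have "\<forall>\<^sub>F q in nhds q0. hit u t' q \<longleftrightarrow> hit u t' q0"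
        using t' False by (intro hit_stable' q0_other) auto
      then show ?thesis by eventually_elim simp
    qed
    \<comment> \<open>Close to \<open>q0\<close> only the coordinate transverse to the edge can
      change its sign; so the triangle is hit on the side of the edge to which its third vertex
      projects.\<close>
    have side: "\<forall>\<^sub>F q in nhds q0. gen q \<longrightarrow> D u (b - a) (q - a) \<noteq> 0 \<and>
        (hit u {a, b, c} q \<longleftrightarrow> D u (b - a) (q - a) / D u (b - a) (c - a) > 0)"
      and zero: "D u (b - a) (q0 - a) = 0"
      if "{a, b, c} \<in> T" for c
    proof -
      have d: "D u (b - a) (c - a) \<noteq> 0" using tri_D(1)[OF that] .
      have mab: "q0 + s0 *\<^sub>R u \<in> convex hull {a, b}" "q0 + s0 *\<^sub>R u \<noteq> a" "q0 + s0 *\<^sub>R u \<noteq> b"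
        using me mv ab by (auto simp: m_def)
      have h0: "ht u a b c q0 > 0" "lam u a b c q0 = 0"
        using ray_mem_edge[OF d] mab(1) e(2) by simp_all
      then show "D u (b - a) (q0 - a) = 0" using d by (simp add: lam_def)
      have "\<forall>\<^sub>F q in nhds q0. ht u a b c q > 0"
        using order_tendstoD(1)[OF tendsto_ht h0(1)] .
      then show "\<forall>\<^sub>F q in nhds q0. gen q \<longrightarrow> D u (b - a) (q - a) \<noteq> 0 \<and>
        (hit u {a, b, c} q \<longleftrightarrow> D u (b - a) (q - a) / D u (b - a) (c - a) > 0)"
        using near_edge[OF d mab]
      proof eventually_elim
        case (elim q)
        show ?case
        proof
          assume g: "gen q"
          have "lam u a b c q \<noteq> 0"
          proof
            assume "lam u a b c q = 0"
            then have "q + ht u a b c q *\<^sub>R u \<in> convex hull {a, b}"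
              using ray_mem_edge[OF d] elim by simp
            then show False using g e(1) ab elim by (auto simp: gen_def)
          qed
          moreover from this have "hit u {a, b, c} q \<longleftrightarrow> lam u a b c q > 0"
            unfolding hit_iff[OF d] using elim by linarith
          ultimately show "D u (b - a) (q - a) \<noteq> 0 \<and> (hit u {a, b, c} q \<longleftrightarrow> D u (b - a) (q - a) / D u (b - a) (c - a) > 0)"
            unfolding lam_def by simp
        qed
      qed
    qed
    \<comment> \<open>For equal sides both triangles are hit or neither; for different sides exactly
      one is hit, which reverses the parity.\<close>
    define P where "P \<longleftrightarrow> (even (card {t' \<in> T - {t1, t2}. hit u t' q0}) \<longleftrightarrow>
      (D u (b - a) (c1 - a) > 0 \<longleftrightarrow> D u (b - a) (c2 - a) > 0))"
    have "\<forall>\<^sub>F q in nhds q0. \<forall>t' \<in> T - {t1, t2}. q \<in> convex hull t \<longrightarrow> (hit u t' q \<longleftrightarrow> hit u t' q0)"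
      by (rule eventually_ball_finite[OF finite_Diff[OF finT]], rule ballI, rule other)
    then have "\<forall>\<^sub>F q in nhds q0. q \<in> convex hull t \<and> gen q \<longrightarrow> (even (above q) \<longleftrightarrow> P)"
      using side[OF c(1)] side[OF c(2)]
    proof eventually_elim
      case (elim q)
      show ?case
      proof
        assume q: "q \<in> convex hull t \<and> gen q"
        have "{t' \<in> T - {t1, t2}. hit u t' q} = {t' \<in> T - {t1, t2}. hit u t' q0}"
          using elim(1) q by blast
        then have ab: "above q = card {t' \<in> T - {t1, t2}. hit u t' q0} + of_bool (hit u t1 q) + of_bool (hit u t2 q)"
          using above_split[of t1 t2 q] c(1-3) by (simp add: t1_def t2_def)
        have d: "D u (b - a) (c1 - a) \<noteq> 0" "D u (b - a) (c2 - a) \<noteq> 0"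
          using tri_D(1) c(1,2) by blast+
        have h: "hit u t1 q \<longleftrightarrow> D u (b - a) (q - a) / D u (b - a) (c1 - a) > 0"
          "hit u t2 q \<longleftrightarrow> D u (b - a) (q - a) / D u (b - a) (c2 - a) > 0" "D u (b - a) (q - a) \<noteq> 0"
          using elim(2,3) q by (simp_all add: t1_def t2_def)
        have "(hit u t1 q \<longleftrightarrow> hit u t2 q) \<longleftrightarrow> (D u (b - a) (c1 - a) > 0 \<longleftrightarrow> D u (b - a) (c2 - a) > 0)"
          unfolding h(1,2) using h(3) d by (auto simp: zero_less_divide_iff)
        then show "even (above q) \<longleftrightarrow> P"
          unfolding ab P_def by auto
      qed
    qed
    moreover have "\<exists>v\<in>t. \<forall>\<^sub>F d in at_right 0. gen (q0 + d *\<^sub>R (v - q0))"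
    proof -
      \<comment> \<open>Since \<open>q0\<close> lies in the vertical plane of the edge by
        \<open>zero\<close>, moving towards \<open>v\<close> leaves this plane immediately.\<close>
      obtain v where v: "v \<in> t" "D u (b - a) (v - a) \<noteq> 0"
        using transversal_vertex[of a b t] e(1) ab t by blast
      have "\<forall>\<^sub>F q in nhds q0. \<forall>s\<ge>0. q + s *\<^sub>R u \<notin> convex hull e'" if e': "e' \<in> E - {e}" for e'
      proof (rule edge_miss_stable)
        show "e' \<in> E" using e' by simp
        fix s :: real assume "0 \<le> s"
        then show "q0 + s *\<^sub>R u \<notin> convex hull e'"
          using uniq[of e' s] e' rel_interior_edge[OF t _ q0(1), of e'] by (cases "s = 0") auto
      qed
      then have "\<forall>\<^sub>F q in nhds q0. \<forall>e'\<in>E - {e}. \<forall>s\<ge>0. q + s *\<^sub>R u \<notin> convex hull e'"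
        by (intro eventually_ball_finite[OF finite_Diff[OF finE]]) blast
      then have "\<forall>\<^sub>F q in nhds q0. D u (b - a) (q - a) \<noteq> 0 \<longrightarrow> gen q"
      proof eventually_elim
        case (elim q)
        show ?case
        proof
          assume "D u (b - a) (q - a) \<noteq> 0"
          then have "q + s *\<^sub>R u \<notin> convex hull e" for s
            using ray_mem_edge[OF tri_D(1)[OF c(1)], of q s] tri_D(1)[OF c(1)] ab by (simp add: lam_def)
          then show "gen q" using elim unfolding gen_def by (metis Diff_iff less_eq_real_def singletonD)
        qed
      qed
      then have "\<forall>\<^sub>F d in at_right 0. D u (b - a) (q0 + d *\<^sub>R (v - q0) - a) \<noteq> 0 \<longrightarrow> gen (q0 + d *\<^sub>R (v - q0))"
        by (rule eventually_segment)
      moreover have "\<forall>\<^sub>F d::real in at_right 0. d > 0" by (rule eventually_at_right_less)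
      ultimately have "\<forall>\<^sub>F d in at_right 0. gen (q0 + d *\<^sub>R (v - q0))"
      proof eventually_elim
        case (elim d)
        have "q0 + d *\<^sub>R (v - q0) - a = (1 - d) *\<^sub>R (q0 - a) + d *\<^sub>R (v - a)"
          by (simp add: algebra_simps)
        then have "D u (b - a) (q0 + d *\<^sub>R (v - q0) - a) = (1 - d) * D u (b - a) (q0 - a) + d * D u (b - a) (v - a)"
          by (simp only: D_simps)
        then show ?case using elim v(2) zero[OF c(1)] by simp
      qed
      then show ?thesis using v(1) by blast
    qed
    ultimately show ?thesis by blast
  qed
  then show "\<exists>P. \<forall>\<^sub>F q in nhds q0. q \<in> convex hull t \<and> gen q \<longrightarrow> (even (above q) \<longleftrightarrow> P)"
    "\<exists>v\<in>t. \<forall>\<^sub>F d in at_right 0. gen (q0 + d *\<^sub>R (v - q0))"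
    by blast+
qed

text \<open>The shadows of edges may cut the triangle into pieces, so nongeneric points have to be
  bridged. A two-dimensional convex set stays connected after removal of the finitely many bad
  points, and on the rest generic points are dense with locally constant parity by
  \<open>local_parity\<close>.\<close>

lemma parity_const:
  assumes t: "t \<in> T" and q: "q \<in> rel_interior (convex hull t)" "gen q" "q' \<in> rel_interior (convex hull t)" "gen q'"
  shows "even (above q) \<longleftrightarrow> even (above q')"
proof -
  let ?U = "rel_interior (convex hull t)"
  let ?C = "?U - bad \<inter> convex hull t"
  have Ubad: "?C = ?U - bad" using rel_interior_subset by blast
  have conv: "convex ?U" by (simp add: convex_rel_interior)
  have "aff_dim t = 2" using aff_dim_affine_independent[OF indep[OF t]] card3[OF t] by simp
  then have "aff_dim ?U = 2" by (simp add: rel_interior_aff_dim aff_dim_convex_hull)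
  then have "\<not> collinear ?U" by (simp add: collinear_aff_dim)
  then have con: "connected ?C"
    using conv finite_bad[OF t] by (intro connected_convex_diff_countable) (simp_all add: countable_finite)
  show ?thesis
  proof (rule connected_equivalence_relation_gen[OF con, where P = gen and R = "\<lambda>q q'. even (above q) \<longleftrightarrow> even (above q')"])
    show "q \<in> ?C" "q' \<in> ?C" using q gen_not_bad by auto
    show "gen q" "gen q'" using q by auto
    show "even (above x) = even (above y) \<Longrightarrow> even (above y) = even (above z) \<Longrightarrow> even (above x) = even (above z)" for x y z
      by simp
  next
    fix W q0 assume W: "openin (top_of_set ?C) W" "q0 \<in> W"
    then obtain S where S: "open S" "W = ?C \<inter> S" by (auto simp: openin_open)
    have q0: "q0 \<in> ?U" "q0 \<notin> bad" using W S Ubad by auto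
    obtain v where v: "v \<in> t" "\<forall>\<^sub>F d in at_right 0. gen (q0 + d *\<^sub>R (v - q0))"
      using local_parity(2)[OF t q0] by blast
    have "\<forall>\<^sub>F x in nhds q0. x \<in> S" using S W eventually_nhds by blast
    then have "\<forall>\<^sub>F d in at_right 0. q0 + d *\<^sub>R (v - q0) \<in> S" by (rule eventually_segment)
    moreover have "\<forall>\<^sub>F d::real in at_right 0. d > 0" by (rule eventually_at_right_less)
    moreover have "\<forall>\<^sub>F d::real in at_right 0. d < 1"
      using eventually_at_right_field by (metis zero_less_one)
    ultimately have "\<forall>\<^sub>F d::real in at_right 0. \<exists>z. z \<in> W \<and> gen z"
      using v(2)
    proof eventually_elim
      case (elim d)
      let ?z = "q0 + d *\<^sub>R (v - q0)"
      have "v \<in> closure (convex hull t)" by (rule subsetD[OF closure_subset hull_inc[OF v(1)]])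
      then have "v - (1 - d) *\<^sub>R (v - q0) \<in> ?U"
        using elim q0 by (intro rel_interior_closure_convex_shrink) auto
      moreover have "v - (1 - d) *\<^sub>R (v - q0) = ?z" by (simp add: algebra_simps)
      ultimately have "?z \<in> ?U" by simp
      then show ?case using elim gen_not_bad S(2) by blast
    qed
    then show "\<exists>z. z \<in> W \<and> gen z" by (simp add: eventually_const_iff trivial_limit_at_right_real)
  next
    fix q0 assume "q0 \<in> ?C"
    then have q0: "q0 \<in> ?U" "q0 \<notin> bad" using Ubad by auto
    obtain P where "\<forall>\<^sub>F q in nhds q0. q \<in> convex hull t \<and> gen q \<longrightarrow> (even (above q) \<longleftrightarrow> P)"
      using local_parity(1)[OF t q0] by blast
    then obtain S where S: "open S" "q0 \<in> S" "\<And>q. q \<in> S \<Longrightarrow> q \<in> convex hull t \<and> gen q \<longrightarrow> (even (above q) \<longleftrightarrow> P)"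
      by (auto simp: eventually_nhds)
    show "\<exists>W. openin (top_of_set ?C) W \<and> q0 \<in> W \<and> (\<forall>x\<in>W. \<forall>y\<in>W. gen x \<and> gen y \<longrightarrow> even (above x) = even (above y))"
    proof (intro exI[of _ "?C \<inter> S"] conjI ballI impI)
      show "openin (top_of_set ?C) (?C \<inter> S)" using S(1) by (auto simp: openin_open)
      show "q0 \<in> ?C \<inter> S" using q0 S(2) by auto
      fix x y assume "x \<in> ?C \<inter> S" "y \<in> ?C \<inter> S" "gen x \<and> gen y"
      moreover from this have "x \<in> convex hull t" "y \<in> convex hull t" using rel_interior_subset by blast+
      ultimately show "even (above x) = even (above y)" using S(3)[of x] S(3)[of y] by auto
    qed
  qed
qed

end

section \<open>Comparison of the two triangles at an edge\<close>

context generic_embedded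
begin

lemma rel_interior_tri:
  assumes t: "{a, b, c} \<in> T" and xyz: "x > 0" "y > 0" "z > 0" "x + y + z = 1"
  shows "x *\<^sub>R a + y *\<^sub>R b + z *\<^sub>R c \<in> rel_interior (convex hull {a, b, c})"
proof -
  have n: "a \<noteq> b" "a \<noteq> c" "b \<noteq> c" using tri_D(2-4)[OF t] by auto
  show ?thesis
    unfolding rel_interior_convex_hull_explicit[OF indep[OF t]]
    using n xyz by (auto simp: add.assoc intro!: exI[of _ "\<lambda>v. if v = a then x else if v = b then y else z"])
qed

lemma scaled_quotient_sign:
  fixes x y d :: real
  assumes "d > 0" "x \<noteq> 0" "y \<noteq> 0"
  shows "0 \<le> d * (x / y) \<longleftrightarrow> 0 < x * y"
proof -
  have "0 \<le> d * (x / y) \<longleftrightarrow> 0 \<le> x / y"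
    using assms(1) zero_le_mult_iff[of d "x / y"] by (simp del: times_divide_eq_right)
  also have "\<dots> \<longleftrightarrow> 0 < x * y" using assms(2,3) by (auto simp: zero_le_divide_iff zero_less_mult_iff)
  finally show ?thesis .
qed

text \<open>Two points near a common point \<open>m\<close> of the edge, one in each triangle, see
  the same other triangles above them. If the two triangles project to different sides of the edge,
  neither point sees the other triangle; if to the same side, one triangle lies above the other near
  the edge, and exactly one of the points sees an additional triangle.\<close>

lemma parity_across_edge:
  assumes t1: "{a, b, c1} \<in> T" and t2: "{a, b, c2} \<in> T" and ne: "{a, b, c1} \<noteq> {a, b, c2}"
  shows "\<exists>q1\<in>rel_interior (convex hull {a, b, c1}). \<exists>q2\<in>rel_interior (convex hull {a, b, c2}). gen q1 \<and> gen q2 \<and>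
    (if even (above q1) = even (above q2) then D u (b - a) (c1 - a) * D u (b - a) (c2 - a) < 0
     else D u (b - a) (c1 - a) * D u (b - a) (c2 - a) > 0)"
proof -
  let ?d1 = "D u (b - a) (c1 - a)" and ?d2 = "D u (b - a) (c2 - a)"
  have ab: "a \<noteq> b" using tri_D(2)[OF t1] .
  have e: "{a, b} \<in> E" using ab t1 by (auto simp: E_def)
  have two_t: "t = {a, b, c1} \<or> t = {a, b, c2}" if "t \<in> T" "{a, b} \<subseteq> t" for t
  proof -
    obtain x y where xy: "{t\<in>T. {a, b} \<subseteq> t} = {{a, b, x}, {a, b, y}}" using edge_two[OF e] by blast
    have "{a, b, c1} \<in> {t\<in>T. {a, b} \<subseteq> t}" "{a, b, c2} \<in> {t\<in>T. {a, b} \<subseteq> t}" "t \<in> {t\<in>T. {a, b} \<subseteq> t}"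
      using t1 t2 that by blast+
    then show ?thesis unfolding xy using ne by (metis insertE singletonD)
  qed
  \<comment> \<open>Avoiding \<open>CX\<close> keeps \<open>m\<close> away from the vertices and
    leaves no other edge above or below it.\<close>
  have "infinite (convex hull {a, b})"
    using ab finite_closed_segment[of a b] by (simp add: segment_convex_hull)
  then have "infinite (convex hull {a, b} - CX)" using finite_CX by simp
  then obtain m where m: "m \<in> convex hull {a, b}" "m \<notin> CX" by (metis Diff_iff all_not_in_conv finite.emptyI)
  have mab: "m \<noteq> a" "m \<noteq> b" using m(2) t1 by (auto simp: CX_def)
  have m_other: "m \<notin> convex hull s" if "s \<subseteq> t" "t \<in> T" "\<not> {a, b} \<subseteq> s" for s t
    using edge_inter_vertex[OF e that(1,2,3) m(1)] mab by auto
  have genm: "m + s *\<^sub>R u \<notin> convex hull e'" if "e' \<in> E" "s > 0" for e' s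
  proof
    assume "m + s *\<^sub>R u \<in> convex hull e'"
    then have "m \<in> crossing {a, b} e'"
      unfolding crossing_def using m(1) that(2) by (auto intro!: exI[of _ s])
    then show False using m(2) e that(1) unfolding CX_def by blast
  qed
  have e'ab: "\<not> {a, b} \<subseteq> e'" if "e' \<in> E" "e' \<noteq> {a, b}" for e'
  proof
    assume "{a, b} \<subseteq> e'"
    moreover have "card e' = card {a, b}" "finite e'" using that e by (auto simp: E_def card_ge_0_finite)
    ultimately show False using that(2) card_subset_eq[of e' "{a, b}"] by simp
  qed
  have near_other: "\<forall>\<^sub>F q in nhds m. \<forall>e'\<in>E - {{a, b}}. \<forall>s\<ge>0. q + s *\<^sub>R u \<notin> convex hull e'"
  proof (rule eventually_ball_finite[OF finite_Diff[OF finE]], rule ballI)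
    fix e' assume e': "e' \<in> E - {{a, b}}"
    show "\<forall>\<^sub>F q in nhds m. \<forall>s\<ge>0. q + s *\<^sub>R u \<notin> convex hull e'"
    proof (rule edge_miss_stable)
      show "e' \<in> E" using e' by simp
      fix s :: real assume s: "0 \<le> s"
      obtain t where "t \<in> T" "e' \<subseteq> t" using e' by (auto simp: E_def)
      then have "m \<notin> convex hull e'" by (intro m_other[of e' t]) (use e'ab[of e'] e' in simp_all)
      then show "m + s *\<^sub>R u \<notin> convex hull e'" using genm[of e' s] e' s by (cases "s = 0") auto
    qed
  qed
  define n0 where "n0 = card {t \<in> T - {{a, b, c1}, {a, b, c2}}. hit u t m}"
  have near_n0: "\<forall>\<^sub>F q in nhds m. \<forall>t\<in>T - {{a, b, c1}, {a, b, c2}}. hit u t q \<longleftrightarrow> hit u t m"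
  proof (rule eventually_ball_finite[OF finite_Diff[OF finT]], rule ballI)
    fix t assume t: "t \<in> T - {{a, b, c1}, {a, b, c2}}"
    then have "\<not> {a, b} \<subseteq> t" using two_t[of t] by blast
    then have "m \<notin> convex hull t" using m_other[of t t] t by simp
    then show "\<forall>\<^sub>F q in nhds m. hit u t q \<longleftrightarrow> hit u t m"
      using t genm by (intro hit_stable') auto
  qed
  \<comment> \<open>The point is taken on the segment from \<open>m\<close> to \<open>c\<close>, so
    that the height of the plane of the other triangle over it is a positive multiple of the height
    over \<open>c\<close>.\<close>
  have side: "\<exists>q\<in>rel_interior (convex hull {a, b, c}). gen q \<and>
      above q = n0 + of_bool (D u (b - a) (c - a) * D u (b - a) (c' - a) > 0 \<and> ht u a b c' c > 0) \<and>
      (D u (b - a) (c - a) * D u (b - a) (c' - a) > 0 \<longrightarrow> ht u a b c' c \<noteq> 0)"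
    if c: "{a, b, c} \<in> T" "{a, b, c'} \<in> T" "{a, b, c} \<noteq> {a, b, c'}" "{{a, b, c1}, {a, b, c2}} = {{a, b, c}, {a, b, c'}}" for c c'
  proof -
    let ?d = "D u (b - a) (c - a)" and ?d' = "D u (b - a) (c' - a)"
    have d: "?d \<noteq> 0" "?d' \<noteq> 0" using tri_D(1) c by auto
    have m0: "m + 0 *\<^sub>R u \<in> convex hull {a, b}" "m + 0 *\<^sub>R u \<noteq> a" "m + 0 *\<^sub>R u \<noteq> b" using m mab by auto
    have "\<forall>\<^sub>F q in nhds m. lam u b c' a q > 0 \<and> lam u c' a b q > 0"
      by (rule near_edge[OF d(2) m0])
    then have "\<forall>\<^sub>F q in nhds m. lam u b c' a q > 0 \<and> lam u c' a b q > 0 \<and>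
        (\<forall>t\<in>T - {{a, b, c1}, {a, b, c2}}. hit u t q \<longleftrightarrow> hit u t m) \<and>
        (\<forall>e'\<in>E - {{a, b}}. \<forall>s\<ge>0. q + s *\<^sub>R u \<notin> convex hull e')"
      using near_other near_n0 by eventually_elim blast
    then have "\<forall>\<^sub>F d in at_right 0. (\<lambda>q. lam u b c' a q > 0 \<and> lam u c' a b q > 0 \<and>
        (\<forall>t\<in>T - {{a, b, c1}, {a, b, c2}}. hit u t q \<longleftrightarrow> hit u t m) \<and>
        (\<forall>e'\<in>E - {{a, b}}. \<forall>s\<ge>0. q + s *\<^sub>R u \<notin> convex hull e')) (m + d *\<^sub>R (c - m))"
      by (rule eventually_segment)
    moreover have "\<forall>\<^sub>F d::real in at_right 0. d > 0" by (rule eventually_at_right_less)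
    moreover have "\<forall>\<^sub>F d::real in at_right 0. d < 1"
      using eventually_at_right_field by (metis zero_less_one)
    ultimately have ev: "\<forall>\<^sub>F d in at_right 0. d > 0 \<and> d < 1 \<and> (\<lambda>q. lam u b c' a q > 0 \<and> lam u c' a b q > 0 \<and>
        (\<forall>t\<in>T - {{a, b, c1}, {a, b, c2}}. hit u t q \<longleftrightarrow> hit u t m) \<and>
        (\<forall>e'\<in>E - {{a, b}}. \<forall>s\<ge>0. q + s *\<^sub>R u \<notin> convex hull e')) (m + d *\<^sub>R (c - m))"
      by eventually_elim blast
    obtain \<delta> where \<delta>: "\<delta> > 0" "\<delta> < 1" and q: "lam u b c' a (m + \<delta> *\<^sub>R (c - m)) > 0" "lam u c' a b (m + \<delta> *\<^sub>R (c - m)) > 0"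
      "\<And>t. t \<in> T - {{a, b, c1}, {a, b, c2}} \<Longrightarrow> hit u t (m + \<delta> *\<^sub>R (c - m)) \<longleftrightarrow> hit u t m"
      "\<And>e' s. e' \<in> E - {{a, b}} \<Longrightarrow> s \<ge> 0 \<Longrightarrow> m + \<delta> *\<^sub>R (c - m) + s *\<^sub>R u \<notin> convex hull e'"
      using eventually_happens'[OF trivial_limit_at_right_real ev] by blast
    define q where "q = m + \<delta> *\<^sub>R (c - m)"
    have mem: "ht u a b c m = 0" "lam u a b c m = 0"
      using ray_mem_edge[OF d(1), of m 0] m0(1) by auto
    have mem': "ht u a b c' m = 0" "lam u a b c' m = 0"
      using ray_mem_edge[OF d(2), of m 0] m0(1) by auto
    obtain x y where xy: "m = x *\<^sub>R a + y *\<^sub>R b" "x + y = 1" "0 \<le> x" "0 \<le> y"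
      using m(1) by (auto simp: convex_hull_2)
    have "x \<noteq> 0" "y \<noteq> 0" using xy mab by auto
    then have mpos: "x > 0" "y > 0" using xy by auto
    have "q = ((1 - \<delta>) * x) *\<^sub>R a + ((1 - \<delta>) * y) *\<^sub>R b + \<delta> *\<^sub>R c"
      unfolding q_def xy(1) by (simp add: algebra_simps)
    moreover have "(1 - \<delta>) * x + (1 - \<delta>) * y + \<delta> = 1"
      using xy(2) by (simp add: distrib_left[symmetric])
    ultimately have qint: "q \<in> rel_interior (convex hull {a, b, c})"
      using rel_interior_tri[OF c(1)] mpos \<delta> by simp
    then have qt: "q \<in> convex hull {a, b, c}" using rel_interior_subset by blast
    have lamc: "lam u a b c q = \<delta>"
      using affine_segment[OF lam_affine, of u a b c m \<delta> c] mem d by (simp add: q_def lam_def)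
    have lamc': "lam u a b c' q = \<delta> * (?d / ?d')"
      using affine_segment[OF lam_affine, of u a b c' m \<delta> c] mem' by (simp add: q_def lam_def)
    have htc': "ht u a b c' q = \<delta> * ht u a b c' c"
      using affine_segment[OF ht_affine, of u a b c' m \<delta> c] mem' by (simp add: q_def)
    have "gen q"
      unfolding gen_def
    proof (intro ballI allI impI)
      fix e' and s :: real assume e': "e' \<in> E" "s > 0"
      show "q + s *\<^sub>R u \<notin> convex hull e'"
      proof (cases "e' = {a, b}")
        case True
        then show ?thesis using ray_mem_edge[OF d(1), of q s] lamc \<delta> by simp
      next
        case False
        then show ?thesis using q(4)[of e' s] e' by (simp add: q_def)
      qed
    qed
    have hit': "hit u {a, b, c'} q \<longleftrightarrow> ?d * ?d' > 0 \<and> ht u a b c' c > 0"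
      unfolding hit_iff[OF d(2)] htc' lamc' scaled_quotient_sign[OF \<delta>(1) d]
      using q(1,2) \<delta>(1) unfolding q_def[symmetric] by (auto simp: zero_less_mult_iff)
    have sets: "{t \<in> T - {{a, b, c}, {a, b, c'}}. hit u t q} = {t \<in> T - {{a, b, c1}, {a, b, c2}}. hit u t m}"
      unfolding c(4)[symmetric] by (intro Collect_cong conj_cong refl, unfold q_def, rule q(3))
    have "above q = n0 + of_bool (?d * ?d' > 0 \<and> ht u a b c' c > 0)"
      unfolding above_split[OF c(1,2,3)] sets n0_def hit' using hit_self[OF c(1) qt] by simp
    \<comment> \<open>Otherwise the other triangle would contain \<open>q\<close>, which is a
      relative interior point of the first.\<close>
    moreover have "ht u a b c' c \<noteq> 0" if "?d * ?d' > 0"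
    proof
      assume "ht u a b c' c = 0"
      then have "q + 0 *\<^sub>R u \<in> convex hull {a, b, c'}"
        unfolding ray_mem_triangle[OF d(2)] htc' lamc' scaled_quotient_sign[OF \<delta>(1) d]
        using q(1,2) that unfolding q_def[symmetric] by simp
      moreover have "\<not> {a, b, c} \<subseteq> {a, b, c'}" using tri_subset_eq[OF c(1,2)] c(3) by blast
      ultimately show False using rel_interior_other[OF c(1,2) subset_refl _ qint] by simp
    qed
    ultimately show ?thesis using qint \<open>gen q\<close> by blast
  qed
  obtain q1 where q1: "q1 \<in> rel_interior (convex hull {a, b, c1})" "gen q1"
    "above q1 = n0 + of_bool (?d1 * ?d2 > 0 \<and> ht u a b c2 c1 > 0)" "?d1 * ?d2 > 0 \<longrightarrow> ht u a b c2 c1 \<noteq> 0"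
    using side[OF t1 t2 ne refl] by blast
  have ne': "{a, b, c2} \<noteq> {a, b, c1}" using ne by simp
  have com: "{{a, b, c1}, {a, b, c2}} = {{a, b, c2}, {a, b, c1}}" by (rule insert_commute)
  obtain q2 where q2: "q2 \<in> rel_interior (convex hull {a, b, c2})" "gen q2"
    "above q2 = n0 + of_bool (?d2 * ?d1 > 0 \<and> ht u a b c1 c2 > 0)"
    using side[OF t2 t1 ne' com] by blast
  \<comment> \<open>Exchanging \<open>c1\<close> and \<open>c2\<close> reverses the sign of this
    determinant. When \<open>?d1\<close> and \<open>?d2\<close> have equal signs, exactly one of the
    two heights is therefore positive.\<close>
  define X where "X = ((b - a) \<times> (c2 - a)) \<bullet> (a - c1)"
  have X: "((b - a) \<times> (c1 - a)) \<bullet> (a - c2) = - X"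
  proof -
    have "((b - a) \<times> (c1 - a)) \<bullet> (c2 - a) = ((c2 - a) \<times> (b - a)) \<bullet> (c1 - a)" by (metis cross_triple)
    also have "\<dots> = - (((b - a) \<times> (c2 - a)) \<bullet> (c1 - a))"
      using cross_skew[of "c2 - a" "b - a"] by simp
    finally show ?thesis by (simp add: X_def inner_diff_right)
  qed
  have h: "ht u a b c2 c1 = X / ?d2" "ht u a b c1 c2 = - X / ?d1"
    using X by (simp_all add: ht_def X_def)
  have d: "?d1 \<noteq> 0" "?d2 \<noteq> 0" using tri_D(1) t1 t2 by auto
  have "if even (above q1) = even (above q2) then ?d1 * ?d2 < 0 else ?d1 * ?d2 > 0"
  proof (cases "?d1 * ?d2 > 0")
    case True
    then have "X \<noteq> 0" using q1(4) h by auto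
    then have "(ht u a b c2 c1 > 0) \<noteq> (ht u a b c1 c2 > 0)"
      unfolding h using True d by (auto simp: zero_less_divide_iff zero_less_mult_iff divide_less_0_iff)
    then show ?thesis using True q1(3) q2(3) by (auto simp: mult.commute)
  next
    case False
    then have "?d1 * ?d2 < 0" using d by (metis linorder_neqE_linordered_idom mult_eq_0_iff)
    then show ?thesis using False q1(3) q2(3) by (auto simp: mult.commute)
  qed
  then show ?thesis using q1(1,2) q2(1,2) by blast
qed

text \<open>The choice of the generic point is immaterial by \<open>parity_const\<close>.\<close>

definition sgm :: "(real^3) set \<Rightarrow> real" where
  "sgm t = (if even (above (SOME q. q \<in> rel_interior (convex hull t) \<and> gen q)) then 1 else - 1)"

lemma sgm:
  assumes "t \<in> T" "q \<in> rel_interior (convex hull t)" "gen q"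
  shows "sgm t = (if even (above q) then 1 else - 1)"
proof -
  have "\<exists>q. q \<in> rel_interior (convex hull t) \<and> gen q" using assms by blast
  from someI_ex[OF this] show ?thesis
    using parity_const[OF assms(1) _ _ assms(2,3)] unfolding sgm_def by simp
qed

text \<open>By \<open>parity_across_edge\<close> the correction differs on the two triangles exactly
  when their third vertices project to the same side of the edge.\<close>

lemma sgm_edge:
  assumes "{a, b, c1} \<in> T" "{a, b, c2} \<in> T" "{a, b, c1} \<noteq> {a, b, c2}"
  shows "(sgm {a, b, c1} * D u (b - a) (c1 - a)) * (sgm {a, b, c2} * D u (b - a) (c2 - a)) < 0"
proof -
  obtain q1 q2 where "q1 \<in> rel_interior (convex hull {a, b, c1})" "q2 \<in> rel_interior (convex hull {a, b, c2})" "gen q1" "gen q2"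
    and *: "if even (above q1) = even (above q2) then D u (b - a) (c1 - a) * D u (b - a) (c2 - a) < 0
     else D u (b - a) (c1 - a) * D u (b - a) (c2 - a) > 0"
    using parity_across_edge[OF assms] by blast
  then have "sgm {a, b, c1} = (if even (above q1) then 1 else - 1)" "sgm {a, b, c2} = (if even (above q2) then 1 else - 1)"
    using sgm assms by blast+
  then show ?thesis using * by (auto split: if_splits)
qed

section \<open>The coherent cyclic orders\<close>

definition nxt :: "(real^3) set \<Rightarrow> real^3 \<Rightarrow> real^3" where
  "nxt t v = (THE w. \<exists>x. t = {v, w, x} \<and> sgm t * D u (w - v) (x - v) > 0)"

lemma nxt_eq:
  assumes "t \<in> T" "t = {v, w, x}" "sgm t * D u (w - v) (x - v) > 0"
  shows "nxt t v = w"
  unfolding nxt_def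
proof (rule the_equality)
  show "\<exists>x. t = {v, w, x} \<and> sgm t * D u (w - v) (x - v) > 0" using assms by blast
  fix w' assume "\<exists>x. t = {v, w', x} \<and> sgm t * D u (w' - v) (x - v) > 0"
  then obtain x' where x': "t = {v, w', x'}" "sgm t * D u (w' - v) (x' - v) > 0" by blast
  show "w' = w"
  proof (rule ccontr)
    assume "w' \<noteq> w"
    have T: "{v, w, x} \<in> T" "{v, w', x'} \<in> T" using assms(1) unfolding assms(2) using x'(1) assms(2) by simp_all
    have mem: "w' \<in> {v, w, x}" "w \<in> {v, w', x'}" using assms(2) x'(1) by blast+
    have "w' = x" using mem(1) \<open>w' \<noteq> w\<close> tri_D(2)[OF T(2)] by blast
    moreover have "x' = w" using mem(2) \<open>w' \<noteq> w\<close> tri_D(2)[OF T(1)] by blast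
    ultimately show False using x'(2) assms(3) D_skew[of u "w - v" "x - v"] by simp
  qed
qed

lemma nxt_rep:
  assumes "t \<in> T" "v \<in> t"
  shows "\<exists>w x. t = {v, w, x} \<and> sgm t * D u (w - v) (x - v) > 0"
proof -
  have "card (t - {v}) = 2" using assms card3 fint by simp
  then obtain w x where "t - {v} = {w, x}" by (meson card_2_iff)
  then have t: "t = {v, w, x}" using assms(2) by auto
  then have "D u (w - v) (x - v) \<noteq> 0" using tri_D(1) assms(1) by blast
  moreover have "sgm t \<noteq> 0" by (simp add: sgm_def)
  ultimately consider "sgm t * D u (w - v) (x - v) > 0" | "sgm t * D u (w - v) (x - v) < 0"
    by (metis linorder_neqE_linordered_idom mult_eq_0_iff)
  then show ?thesis
  proof cases
    case 1
    then show ?thesis using t by blast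
  next
    case 2
    then have "sgm t * D u (x - v) (w - v) > 0" using D_skew[of u "x - v" "w - v"] by simp
    moreover have "t = {v, x, w}" using t by auto
    ultimately show ?thesis by blast
  qed
qed

lemma nxt_cycle:
  assumes "t \<in> T" "v \<in> t"
  shows "\<exists>w x. t = {v, w, x} \<and> nxt t v = w \<and> nxt t w = x \<and> nxt t x = v"
proof -
  obtain w x where t: "t = {v, w, x}" and p: "sgm t * D u (w - v) (x - v) > 0"
    using nxt_rep[OF assms] by blast
  have "nxt t v = w" by (rule nxt_eq[OF assms(1) t p])
  moreover have "nxt t w = x"
    by (rule nxt_eq[OF assms(1), of w x v]) (use t p D_rot[of u x w v] in auto)
  moreover have "nxt t x = v"
    by (rule nxt_eq[OF assms(1), of x v w]) (use t p D_rot[of u v x w] D_rot[of u x w v] in auto)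
  ultimately show ?thesis using t by blast
qed

lemma nxt_coherent:
  assumes "t \<in> T" "t' \<in> T" "t \<noteq> t'" "v \<in> t'" "v \<in> t" "nxt t v \<in> t'"
  shows "nxt t' (nxt t v) = v"
proof -
  obtain w x where t: "t = {v, w, x}" and p: "sgm t * D u (w - v) (x - v) > 0"
    using nxt_rep[OF assms(1,5)] by blast
  have w: "nxt t v = w" by (rule nxt_eq[OF assms(1) t p])
  have "v \<noteq> w" using tri_D(2) assms(1) t by blast
  then have "card (t' - {v, w}) = 1"
    using assms(2,4,6) w card3[of t'] by (subst card_Diff_subset) auto
  then obtain y where "t' - {v, w} = {y}" by (meson card_1_singletonE)
  then have t': "t' = {v, w, y}" using assms(4,6) w by auto
  have "(sgm t * D u (w - v) (x - v)) * (sgm t' * D u (w - v) (y - v)) < 0"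
    using sgm_edge[of v w x y] assms(1-3) t t' by simp
  then have "sgm t' * D u (w - v) (y - v) < 0"
    using p mult_nonneg_nonneg[of "sgm t * D u (w - v) (x - v)" "sgm t' * D u (w - v) (y - v)"] by linarith
  then have "sgm t' * D u (v - w) (y - w) > 0" using D_swap[of u v w y] by simp
  then have "nxt t' w = v" by (rule nxt_eq[OF assms(2), rotated]) (use t' in auto)
  then show ?thesis using w by simp
qed

end

theorem (in embedded) orientation:
  "\<exists>nxt. (\<forall>t\<in>T. \<forall>v\<in>t. nxt t v \<in> t \<and> nxt t v \<noteq> v \<and> nxt t (nxt t (nxt t v)) = v) \<and>
     (\<forall>t\<in>T. \<forall>t'\<in>T. \<forall>v\<in>t \<inter> t'. t \<noteq> t' \<longrightarrow> nxt t v \<in> t' \<longrightarrow> nxt t' (nxt t v) = v)"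
proof -
  obtain u where "generic_embedded T u" using generic_exists by blast
  then interpret generic_embedded T u .
  show ?thesis
  proof (intro exI[of _ nxt] conjI ballI impI)
    fix t v assume t: "t \<in> T" "v \<in> t"
    obtain w x where *: "t = {v, w, x}" "nxt t v = w" "nxt t w = x" "nxt t x = v"
      using nxt_cycle[OF t] by blast
    show "nxt t v \<in> t" using *(1,2) by simp
    show "nxt t v \<noteq> v" using *(2) tri_D(2)[of v w x] t *(1) by auto
    show "nxt t (nxt t (nxt t v)) = v" using * by simp
  next
    fix t t' v assume "t \<in> T" "t' \<in> T" "v \<in> t \<inter> t'" "t \<noteq> t'" "nxt t v \<in> t'"
    then show "nxt t' (nxt t v) = v" by (intro nxt_coherent) auto
  qed
qed

unbundle no cross3_syntax

section \<open>Triangulations and their vertex sets\<close>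

lemma cycle_graph_degree: "cycle_graph S \<Longrightarrow> v \<in> \<Union>S \<Longrightarrow> card {e\<in>S. v \<in> e} = 2"
  unfolding cycle_graph_def by (elim conjE) (erule bspec[of "\<Union>S"], assumption)

lemma cycle_graph_polygon:
  fixes vs :: "'a list"
  assumes n: "3 \<le> length vs" and d: "distinct vs"
  defines "f \<equiv> \<lambda>i. {vs ! i, vs ! (Suc i mod length vs)}"
  shows "cycle_graph (f ` {..<length vs})"
proof -
  let ?n = "length vs" and ?S = "f ` {..<length vs}"
  have eq: "vs ! i = vs ! j \<longleftrightarrow> i = j" if "i < ?n" "j < ?n" for i j
    using d that by (simp add: nth_eq_iff_index_eq)
  have suc: "Suc i mod ?n < ?n" for i using n by (intro mod_less_divisor) linarith
  have suc_neq: "Suc i mod ?n \<noteq> i" if "i < ?n" for i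
    using that n by (cases "Suc i = ?n") auto
  \<comment> \<open>With at least three vertices two steps never lead back, so an edge determines
    its first vertex.\<close>
  have suc2: "Suc (Suc i mod ?n) mod ?n \<noteq> i" if "i < ?n" for i
  proof (cases "Suc i = ?n")
    case True
    then show ?thesis using n by auto
  next
    case False
    then have "Suc i mod ?n = Suc i" using that by simp
    then show ?thesis using that n False by (cases "Suc (Suc i) = ?n") auto
  qed
  have suc_inj: "i = j" if "i < ?n" "j < ?n" "Suc i mod ?n = Suc j mod ?n" for i j
    using that by (cases "Suc i = ?n"; cases "Suc j = ?n") auto
  have inj: "inj_on f {..<?n}"
  proof (rule inj_onI)
    fix i j assume ij: "i \<in> {..<?n}" "j \<in> {..<?n}" "f i = f j"
    show "i = j"
    proof (rule ccontr)
      assume "i \<noteq> j"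
      then have "vs ! i = vs ! (Suc j mod ?n)" "vs ! (Suc i mod ?n) = vs ! j"
        using ij eq[of i j] by (auto simp: f_def doubleton_eq_iff)
      then have "i = Suc j mod ?n" "Suc i mod ?n = j" using eq suc ij by auto
      then show False using suc2[of j] ij by auto
    qed
  qed
  have Un: "\<Union>?S = set vs"
  proof
    show "\<Union>?S \<subseteq> set vs" using suc by (auto simp: f_def)
    show "set vs \<subseteq> \<Union>?S" by (auto simp: f_def in_set_conv_nth)
  qed
  have deg: "card {e\<in>?S. v \<in> e} = 2" if v: "v \<in> \<Union>?S" for v
  proof -
    obtain k where k: "k < ?n" "v = vs ! k" using v unfolding Un by (auto simp: in_set_conv_nth)
    define l where "l = (if k = 0 then ?n - 1 else k - 1)"
    have l: "l < ?n" "Suc l mod ?n = k" using k n by (auto simp: l_def)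
    have "{e\<in>?S. v \<in> e} = {f k, f l}"
    proof (intro equalityI subsetI)
      fix e assume "e \<in> {e\<in>?S. v \<in> e}"
      then obtain i where i: "i < ?n" "e = f i" "v \<in> f i" by auto
      then have "k = i \<or> k = Suc i mod ?n" using k eq suc by (auto simp: f_def)
      then show "e \<in> {f k, f l}"
      proof
        assume "k = Suc i mod ?n"
        then have "Suc i mod ?n = Suc l mod ?n" using l(2) by simp
        then have "i = l" by (rule suc_inj[OF i(1) l(1)])
        then show ?thesis using i(2) by simp
      qed (use i(2) in simp)
    next
      fix e assume "e \<in> {f k, f l}"
      then show "e \<in> {e\<in>?S. v \<in> e}" using k l by (auto simp: f_def)
    qed
    moreover have "f k \<noteq> f l"
    proof
      assume "f k = f l"
      then have "k = l" using inj k l by (auto dest: inj_onD)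
      then show False using suc_neq[OF l(1)] l(2) by simp
    qed
    ultimately show ?thesis by simp
  qed
  have con: "P b" if P: "\<And>e e'. e \<in> ?S \<Longrightarrow> e' \<in> ?S \<Longrightarrow> e \<inter> e' \<noteq> {} \<Longrightarrow> P e \<Longrightarrow> P e'" and ab: "a \<in> ?S" "b \<in> ?S" "P a" for P a b
  proof -
    have "i < ?n \<longrightarrow> (P (f i) \<longleftrightarrow> P (f 0))" for i
    proof (induction i)
      case (Suc i)
      show ?case
      proof
        assume i: "Suc i < ?n"
        have "vs ! Suc i \<in> f i \<inter> f (Suc i)" using i by (simp add: f_def)
        then have "P (f i) \<longleftrightarrow> P (f (Suc i))" using P[of "f i" "f (Suc i)"] P[of "f (Suc i)" "f i"] i by auto
        then show "P (f (Suc i)) \<longleftrightarrow> P (f 0)" using Suc i by simp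
      qed
    qed simp
    then show ?thesis using ab by auto
  qed
  have two: "card e = 2" if e: "e \<in> ?S" for e
  proof -
    obtain i where i: "i < ?n" "e = f i" using e by auto
    then have "vs ! i \<noteq> vs ! (Suc i mod ?n)" using eq[of i "Suc i mod ?n"] suc[of i] suc_neq[of i] by auto
    then show ?thesis by (simp add: i f_def)
  qed
  show ?thesis
    unfolding cycle_graph_def
  proof (intro conjI ballI allI impI)
    show "finite ?S" by simp
    have "f 0 \<in> ?S" using n by (intro imageI) auto
    then show "?S \<noteq> {}" by blast
    show "card ?S = card (\<Union>?S)" unfolding Un card_image[OF inj] using distinct_card[OF d] by simp
    show "card e = 2" if "e \<in> ?S" for e by (rule two[OF that])
    show "card {e\<in>?S. v \<in> e} = 2" if "v \<in> \<Union>?S" for v by (rule deg[OF that])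
    show "P b" if "\<forall>e\<in>?S. \<forall>e'\<in>?S. e \<inter> e' \<noteq> {} \<longrightarrow> P e \<longrightarrow> P e'" "a \<in> ?S" "b \<in> ?S" "P a" for P a b
      using con[where P = P and a = a and b = b] that by blast
  qed
qed

section \<open>Simplicial complexes through the vertex sets of their cells\<close>

lemma vertices_of_hull: "\<not> affine_dependent C \<Longrightarrow> vertices_of (convex hull C) = C"
  unfolding vertices_of_def using extreme_point_of_convex_hull_affine_independent[of C] by blast

locale complex =
  fixes K :: "'a::euclidean_space set set"
  assumes K: "simplicial_complex K"
begin

abbreviation "M \<equiv> vertices_of"

lemma simplex_M:
  assumes "\<sigma> \<in> K"
  shows "\<not> affine_dependent (M \<sigma>)" "\<sigma> = convex hull M \<sigma>" "int (card (M \<sigma>)) = aff_dim \<sigma> + 1"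
proof -
  obtain n where "n simplex \<sigma>" using K assms unfolding simplicial_complex_def by blast
  then obtain C where C: "\<not> affine_dependent C" "int (card C) = n + 1" "\<sigma> = convex hull C"
    unfolding simplex_def by blast
  then have "M \<sigma> = C" using vertices_of_hull by blast
  then show "\<not> affine_dependent (M \<sigma>)" "\<sigma> = convex hull M \<sigma>" using C by auto
  show "int (card (M \<sigma>)) = aff_dim \<sigma> + 1"
    using \<open>M \<sigma> = C\<close> C aff_dim_affine_independent[OF C(1)] by (simp add: aff_dim_convex_hull)
qed

lemma finK: "finite K" using K by (simp add: simplicial_complex_def)

lemma finM: "\<sigma> \<in> K \<Longrightarrow> finite (M \<sigma>)"
  using simplex_M(1) aff_independent_finite by blast

lemma face_K: "\<sigma> \<in> K \<Longrightarrow> s \<subseteq> M \<sigma> \<Longrightarrow> convex hull s \<in> K \<and> M (convex hull s) = s"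
proof
  assume s: "\<sigma> \<in> K" "s \<subseteq> M \<sigma>"
  have "convex hull s face_of \<sigma>"
    using face_of_convex_hull_affine_independent[OF simplex_M(1)[OF s(1)], of "convex hull s"] s(2) simplex_M(2)[OF s(1)] by auto
  then show "convex hull s \<in> K" using K s(1) unfolding simplicial_complex_def by blast
  show "M (convex hull s) = s"
    by (rule vertices_of_hull) (rule affine_independent_subset[OF simplex_M(1)[OF s(1)] s(2)])
qed

text \<open>The intersection is a face of both simplices. A face is spanned by some of the vertices,
  and these are recovered as its extreme points, so both descriptions use the same vertices.\<close>

lemma inter_K:
  assumes "\<sigma> \<in> K" "\<tau> \<in> K"
  shows "\<sigma> \<inter> \<tau> = convex hull (M \<sigma> \<inter> M \<tau>)"
proof
  have "\<sigma> \<inter> \<tau> face_of \<sigma>" "\<sigma> \<inter> \<tau> face_of \<tau>"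
    using K assms unfolding simplicial_complex_def by (blast, metis Int_commute)
  then obtain c c' where c: "c \<subseteq> M \<sigma>" "\<sigma> \<inter> \<tau> = convex hull c" "c' \<subseteq> M \<tau>" "\<sigma> \<inter> \<tau> = convex hull c'"
    using face_of_convex_hull_affine_independent[OF simplex_M(1)[OF assms(1)], of "\<sigma> \<inter> \<tau>"]
      face_of_convex_hull_affine_independent[OF simplex_M(1)[OF assms(2)], of "\<sigma> \<inter> \<tau>"]
      simplex_M(2)[OF assms(1)] simplex_M(2)[OF assms(2)] by auto
  have "c = c'" using face_K[OF assms(1) c(1)] face_K[OF assms(2) c(3)] c(2,4) by simp
  then show "\<sigma> \<inter> \<tau> \<subseteq> convex hull (M \<sigma> \<inter> M \<tau>)" using c hull_mono[of c "M \<sigma> \<inter> M \<tau>"] by auto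
  show "convex hull (M \<sigma> \<inter> M \<tau>) \<subseteq> \<sigma> \<inter> \<tau>"
    using hull_mono[of "M \<sigma> \<inter> M \<tau>" "M \<sigma>" convex] hull_mono[of "M \<sigma> \<inter> M \<tau>" "M \<tau>" convex]
      simplex_M(2)[OF assms(1)] simplex_M(2)[OF assms(2)] by auto
qed

lemma subset_M:
  assumes "\<sigma> \<in> K" "\<tau> \<in> K"
  shows "\<sigma> \<subseteq> \<tau> \<longleftrightarrow> M \<sigma> \<subseteq> M \<tau>"
proof
  assume "\<sigma> \<subseteq> \<tau>"
  then have "convex hull (M \<sigma> \<inter> M \<tau>) = \<sigma>" using inter_K[OF assms] by auto
  then show "M \<sigma> \<subseteq> M \<tau>" using face_K[OF assms(1), of "M \<sigma> \<inter> M \<tau>"] by auto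
next
  assume "M \<sigma> \<subseteq> M \<tau>"
  then have "convex hull M \<sigma> \<subseteq> convex hull M \<tau>" by (rule hull_mono)
  then show "\<sigma> \<subseteq> \<tau>" using simplex_M(2) assms by metis
qed

lemma inj_M: "inj_on M K"
  by (rule inj_onI) (metis simplex_M(2))

lemma meet_K:
  assumes "\<sigma> \<in> K" "\<tau> \<in> K" "s \<subseteq> M \<sigma>" "s' \<subseteq> M \<tau>"
  shows "convex hull s \<inter> convex hull s' = convex hull (s \<inter> s')"
  using inter_K[of "convex hull s" "convex hull s'"] face_K[OF assms(1,3)] face_K[OF assms(2,4)] by simp

lemma rel_interior_K:
  assumes "\<sigma> \<in> K" "\<tau> \<in> K" "x \<in> rel_interior \<sigma>" "x \<in> \<tau>"
  shows "\<sigma> \<subseteq> \<tau>"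
proof -
  have f: "\<sigma> \<inter> \<tau> face_of \<sigma>" using K assms unfolding simplicial_complex_def by blast
  have "x \<in> \<sigma>" using assms(3) rel_interior_subset by blast
  then have "\<sigma> \<inter> \<tau> = \<sigma>" using face_of_disjoint_rel_interior[OF f] assms(3,4) by blast
  then show ?thesis by blast
qed

lemma convex_K: "\<sigma> \<in> K \<Longrightarrow> convex \<sigma>" using simplex_M(2) convex_convex_hull by metis
lemma compact_K: "\<sigma> \<in> K \<Longrightarrow> compact \<sigma>"
  by (rule ssubst[where P = compact, OF simplex_M(2)]) (simp_all add: finite_imp_compact_convex_hull finM)
lemma rel_interior_ne: "\<sigma> \<in> K \<Longrightarrow> \<sigma> \<noteq> {} \<Longrightarrow> rel_interior \<sigma> \<noteq> {}"
  using convex_K rel_interior_eq_empty by blast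

text \<open>A relative interior point of \<open>\<sigma>\<close> lies in some cell of
  \<open>X\<close>, and a cell meeting the relative interior of \<open>\<sigma>\<close> contains
  \<open>\<sigma>\<close>.\<close>

lemma cover_K:
  assumes "\<sigma> \<in> K" "\<sigma> \<noteq> {}" "X \<subseteq> K" "\<sigma> \<subseteq> \<Union>X"
  shows "\<exists>x\<in>X. \<sigma> \<subseteq> x"
proof -
  obtain y where y: "y \<in> rel_interior \<sigma>" using rel_interior_ne assms by blast
  then have "y \<in> \<Union>X" using rel_interior_subset assms(4) by blast
  then obtain x where "x \<in> X" "y \<in> x" by blast
  then show ?thesis using rel_interior_K[OF assms(1) _ y] assms(3) by blast
qed

end

section \<open>Closed PL surfaces as abstract oriented surfaces\<close>

locale pl_surface =
  fixes K :: "cell set"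
  assumes surf: "closed_PL_surface K"

sublocale pl_surface \<subseteq> complex K
  by unfold_locales (use surf in \<open>simp add: closed_PL_surface_def\<close>)

context pl_surface
begin

definition T :: "point set set" where "T = M ` triangles K"

lemma triangle_K: "t \<in> triangles K \<Longrightarrow> t \<in> K" by (simp add: triangles_def)
lemma edge_K: "e \<in> edges K \<Longrightarrow> e \<in> K" by (simp add: edges_def)

lemma triangles_iff: "t \<in> triangles K \<longleftrightarrow> t \<in> K \<and> card (M t) = 3"
  using simplex_M(3)[of t] by (auto simp: triangles_def)

lemma edges_iff: "e \<in> edges K \<longleftrightarrow> e \<in> K \<and> card (M e) = 2"
  using simplex_M(3)[of e] by (auto simp: edges_def)

lemma T_hull:
  assumes "t \<in> T" shows "convex hull t \<in> triangles K \<and> M (convex hull t) = t"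
proof -
  obtain \<tau> where \<tau>: "\<tau> \<in> triangles K" "t = M \<tau>" using assms by (auto simp: T_def)
  then have "convex hull t = \<tau>" using simplex_M(2)[OF triangle_K[OF \<tau>(1)]] by simp
  then show ?thesis using \<tau> by simp
qed

lemma M_T: "t \<in> triangles K \<Longrightarrow> M t \<in> T" by (simp add: T_def)

lemma pure: "\<sigma> \<in> K \<Longrightarrow> \<exists>t\<in>triangles K. \<sigma> \<subseteq> t"
  using surf by (simp add: closed_PL_surface_def)

lemma M_pure: "\<sigma> \<in> K \<Longrightarrow> \<exists>t\<in>T. M \<sigma> \<subseteq> t"
  using pure[of \<sigma>] subset_M triangle_K M_T by blast

lemma sub_T: "s \<subseteq> t \<Longrightarrow> t \<in> T \<Longrightarrow> convex hull s \<in> K \<and> M (convex hull s) = s"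
  using T_hull[of t] face_K[of "convex hull t" s] triangle_K by simp

lemma es_T: "e \<in> es T \<longleftrightarrow> convex hull e \<in> edges K \<and> M (convex hull e) = e"
proof
  assume "e \<in> es T"
  then obtain t where "t \<in> T" "e \<subseteq> t" "card e = 2" by (auto simp: es_def)
  then show "convex hull e \<in> edges K \<and> M (convex hull e) = e" using sub_T[of e t] by (simp add: edges_iff)
next
  assume "convex hull e \<in> edges K \<and> M (convex hull e) = e"
  then show "e \<in> es T" using M_pure[of "convex hull e"] by (auto simp: edges_iff es_def)
qed

lemma M_edges: "e \<in> edges K \<Longrightarrow> M e \<in> es T"
  by (simp add: es_T simplex_M(2)[OF edge_K, symmetric])

lemma vertex_K: "{v} \<in> K \<longleftrightarrow> v \<in> \<Union>T"
proof
  assume "{v} \<in> K"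
  moreover have "M {v} = {v}" using vertices_of_hull[of "{v}"] by simp
  ultimately show "v \<in> \<Union>T" using M_pure[of "{v}"] by auto
next
  assume "v \<in> \<Union>T"
  then show "{v} \<in> K" using sub_T[of "{v}"] by auto
qed

lemma vertex_mem: "\<sigma> \<in> K \<Longrightarrow> {v} \<in> K \<Longrightarrow> v \<in> \<sigma> \<longleftrightarrow> v \<in> M \<sigma>"
  using subset_M[of "{v}" \<sigma>] vertices_of_hull[of "{v}"] by simp

lemma cycle_graph_M:
  assumes "edge_cycle S" shows "cycle_graph (M ` S)"
proof -
  obtain vs where vs: "3 \<le> length vs" "distinct vs" "S = (\<lambda>i. convex hull {vs ! i, vs ! (Suc i mod length vs)}) ` {..<length vs}"
    using assms unfolding edge_cycle_def by blast
  have "M (convex hull {vs ! i, vs ! (Suc i mod length vs)}) = {vs ! i, vs ! (Suc i mod length vs)}" for i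
    by (rule vertices_of_hull) (rule affine_independent_2)
  then have "M ` S = (\<lambda>i. {vs ! i, vs ! (Suc i mod length vs)}) ` {..<length vs}"
    unfolding vs(3) by (simp add: image_image)
  then show ?thesis using cycle_graph_polygon[OF vs(1,2)] by simp
qed

lemma link_M:
  assumes v: "{v} \<in> K"
  shows "M ` link_edges K v = {d. v \<notin> d \<and> insert v d \<in> T}"
proof (intro equalityI subsetI)
  fix d assume "d \<in> M ` link_edges K v"
  then obtain e where e: "d = M e" "e \<in> edges K" "v \<notin> e" "convex hull (insert v e) \<in> triangles K"
    unfolding link_edges_def by auto
  have eq: "convex hull (insert v e) = convex hull (insert v d)"
    using simplex_M(2)[of e] e(1,2) edge_K hull_insert[of convex v d] by simp
  then have t: "convex hull (insert v d) \<in> triangles K" using e by simp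
  \<comment> \<open>The hull of at most three points can be a triangle only if all of them are
    vertices and there are three.\<close>
  have sub: "M (convex hull (insert v d)) \<subseteq> insert v d"
    unfolding vertices_of_def using extreme_point_of_convex_hull by blast
  have "finite (insert v d)" "card (insert v d) \<le> 3"
    using e edges_iff finM[OF edge_K[OF e(2)]] by (auto simp: card_insert_if)
  then have "M (convex hull (insert v d)) = insert v d"
    using sub t triangles_iff by (intro card_seteq) auto
  then have "insert v d \<in> T" using M_T[OF t] by simp
  moreover have "v \<notin> d" using vertex_mem[OF edge_K[OF e(2)] v] e by simp
  ultimately show "d \<in> {d. v \<notin> d \<and> insert v d \<in> T}" by simp
next
  fix d assume "d \<in> {d. v \<notin> d \<and> insert v d \<in> T}"
  then have d: "v \<notin> d" "insert v d \<in> T" by auto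
  have 1: "convex hull d \<in> K" "M (convex hull d) = d" using sub_T[OF subset_insertI d(2)] by auto
  have t: "convex hull (insert v d) \<in> triangles K" "card (insert v d) = 3" using T_hull[OF d(2)] triangles_iff by auto
  have "card d = 2" using t(2) d(1) by (cases "finite d") auto
  then have e: "convex hull d \<in> edges K" using 1 by (simp add: edges_iff)
  have "convex hull (insert v (convex hull d)) \<in> triangles K" using t(1) hull_insert[of convex v d] by simp
  moreover have "v \<notin> convex hull d" using vertex_mem[OF 1(1) v] 1(2) d(1) by simp
  ultimately have "convex hull d \<in> link_edges K v" using e by (simp add: link_edges_def)
  then show "d \<in> M ` link_edges K v" using 1(2) by (metis image_eqI)
qed

lemma link_cycle:
  assumes "v \<in> \<Union>T" shows "cycle_graph {d. v \<notin> d \<and> insert v d \<in> T}"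
proof -
  have v: "{v} \<in> K" using assms vertex_K by blast
  then have "edge_cycle (link_edges K v)" using surf by (simp add: closed_PL_surface_def)
  then show ?thesis using cycle_graph_M link_M[OF v] by metis
qed

lemma card_T: "t \<in> T \<Longrightarrow> card t = 3"
  using T_hull[of t] triangles_iff by metis

lemma finite_T: "finite T"
  unfolding T_def using finK by (simp add: triangles_def)

text \<open>The triangles at the edge \<open>{v, w}\<close> correspond to the edges at
  \<open>w\<close> of the link of \<open>v\<close>, which is a polygon.\<close>

lemma two_T:
  assumes t: "t \<in> T" "e \<subseteq> t" "card e = 2"
  shows "card {t'\<in>T. e \<subseteq> t'} = 2"
proof -
  obtain v w where e: "e = {v, w}" "v \<noteq> w" using t(3) by (auto simp: card_2_iff)
  let ?L = "{d. v \<notin> d \<and> insert v d \<in> T}"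
  have vt: "v \<in> t" "w \<in> t" using e t(2) by auto
  then have L: "cycle_graph ?L" using link_cycle t(1) by blast
  have "t - {v} \<in> ?L" using vt t(1) by (simp add: insert_absorb)
  then have "w \<in> \<Union>?L" using vt e(2) by blast
  then have c: "card {d\<in>?L. w \<in> d} = 2" by (rule cycle_graph_degree[OF L])
  have bij: "bij_betw (insert v) {d\<in>?L. w \<in> d} {t'\<in>T. e \<subseteq> t'}"
  proof (rule bij_betw_byWitness[of _ "\<lambda>t. t - {v}"])
    show "\<forall>d\<in>{d\<in>?L. w \<in> d}. insert v d - {v} = d" by auto
    show "\<forall>t'\<in>{t'\<in>T. e \<subseteq> t'}. insert v (t' - {v}) = t'" using e by auto
    show "insert v ` {d\<in>?L. w \<in> d} \<subseteq> {t'\<in>T. e \<subseteq> t'}" using e by auto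
    show "(\<lambda>t. t - {v}) ` {t'\<in>T. e \<subseteq> t'} \<subseteq> {d\<in>?L. w \<in> d}"
      using e by (auto simp: insert_absorb)
  qed
  show ?thesis by (rule trans[OF bij_betw_same_card[OF bij, symmetric] c])
qed

text \<open>Meeting edges of the link of \<open>v\<close> belong to triangles with a common edge at
  \<open>v\<close>; so a path along the link polygon becomes a rotation around
  \<open>v\<close>.\<close>

lemma link_T:
  assumes t: "t \<in> T" "t' \<in> T" "v \<in> t" "v \<in> t'"
  shows "(t, t') \<in> {(s, s'). s \<in> T \<and> s' \<in> T \<and> card (s \<inter> s') = 2 \<and> v \<in> s \<inter> s'}\<^sup>*" (is "_ \<in> ?R\<^sup>*")
proof -
  let ?L = "{d. v \<notin> d \<and> insert v d \<in> T}"
  define P where "P d \<longleftrightarrow> (t, insert v d) \<in> ?R\<^sup>*" for d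
  have L: "cycle_graph ?L" using link_cycle t by blast
  have ins: "insert v (t - {v}) = t" "insert v (t' - {v}) = t'" using t by auto
  have "P (t' - {v})"
  proof (rule cycle_graph_connected[where P = P, OF L])
    show "t - {v} \<in> ?L" "t' - {v} \<in> ?L" using ins t by auto
    show "P (t - {v})" unfolding P_def ins by simp
    fix d d' assume d: "d \<in> ?L" "d' \<in> ?L" "d \<inter> d' \<noteq> {}" "P d"
    show "P d'"
    proof (cases "d = d'")
      case True
      then show ?thesis using d(4) by simp
    next
      case False
      obtain w where w: "w \<in> d" "w \<in> d'" using d(3) by blast
      let ?s = "insert v d" and ?s' = "insert v d'"
      have T: "?s \<in> T" "?s' \<in> T" using d by auto
      have f: "finite ?s" "finite ?s'" using card_T T by (metis card.infinite zero_neq_numeral)+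
      have ne: "?s \<noteq> ?s'" using False d by auto
      have "{v, w} \<subseteq> ?s \<inter> ?s'" "v \<noteq> w" using w d by auto
      then have "2 \<le> card (?s \<inter> ?s')" using f card_mono[of "?s \<inter> ?s'" "{v, w}"] by simp
      moreover have "card (?s \<inter> ?s') < 3"
      proof (rule ccontr)
        assume "\<not> card (?s \<inter> ?s') < 3"
        then have c: "card ?s \<le> card (?s \<inter> ?s')" "card ?s' \<le> card (?s \<inter> ?s')"
          using card_T[OF T(1)] card_T[OF T(2)] by linarith+
        show False
          using card_seteq[OF f(1) Int_lower1 c(1)] card_seteq[OF f(2) Int_lower2 c(2)] ne by metis
      qed
      ultimately have "card (?s \<inter> ?s') = 2" by simp
      then have "(?s, ?s') \<in> ?R" using T by simp
      then show ?thesis using d(4) unfolding P_def by (rule rtrancl_into_rtrancl[rotated])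
    qed
  qed
  then show ?thesis unfolding P_def ins .
qed

lemma surface_T: "surface T"
  by unfold_locales (fact finite_T, fact card_T, fact two_T, fact link_T)

lemma embedded_T: "embedded T"
proof unfold_locales
  show "\<not> affine_dependent t" if "t \<in> T" for t
    using simplex_M(1)[of "convex hull t"] T_hull[OF that] triangle_K by simp
  show "convex hull s \<inter> convex hull s' = convex hull (s \<inter> s')"
    if "t \<in> T" "t' \<in> T" "s \<subseteq> t" "s' \<subseteq> t'" for t t' s s'
    using meet_K[of "convex hull t" "convex hull t'" s s'] T_hull[OF that(1)] T_hull[OF that(2)] that triangle_K by simp
qed (fact finite_T, fact card_T, fact two_T)

lemma oriented_T: "\<exists>nxt. oriented_surface T nxt"
proof -
  obtain nxt where n: "\<forall>t\<in>T. \<forall>v\<in>t. nxt t v \<in> t \<and> nxt t v \<noteq> v \<and> nxt t (nxt t (nxt t v)) = v"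
     "\<forall>t\<in>T. \<forall>t'\<in>T. \<forall>v\<in>t \<inter> t'. t \<noteq> t' \<longrightarrow> nxt t v \<in> t' \<longrightarrow> nxt t' (nxt t v) = v"
    using embedded.orientation[OF embedded_T] by blast
  have "oriented_surface T nxt"
    by (intro oriented_surface.intro surface_T oriented_surface_axioms.intro) (use n in blast)+
  then show ?thesis by blast
qed

end

section \<open>Seamed surfaces\<close>

lemma euler_sum:
  assumes "finite A" "\<And>t. t \<in> A \<Longrightarrow> card t = 3"
  shows "(\<Sum>\<sigma>\<in>(\<lambda>v. {v}) ` \<Union>A \<union> es A \<union> A. (-1) ^ (card \<sigma> - 1)) = chi A"
proof -
  have fin: "finite t" if "t \<in> A" for t using assms(2)[OF that] by (metis card.infinite zero_neq_numeral)
  have "finite (es A)"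
    using assms(1) fin by (intro finite_subset[of "es A" "Pow (\<Union>A)"]) (auto simp: es_def)
  then have f: "finite ((\<lambda>v. {v}) ` \<Union>A)" "finite (es A)" "finite A"
    using assms(1) fin by auto
  have d1: "(\<lambda>v. {v}) ` \<Union>A \<inter> es A = {}" by (auto simp: es_def)
  have d2: "((\<lambda>v. {v}) ` \<Union>A \<union> es A) \<inter> A = {}"
  proof (rule ccontr)
    assume "\<not> ?thesis"
    then obtain t where t: "t \<in> A" "t \<in> (\<lambda>v. {v}) ` \<Union>A \<union> es A" by blast
    then have "card t = 1 \<or> card t = 2" by (auto simp: es_def)
    then show False using assms(2)[OF t(1)] by simp
  qed
  have "(\<Sum>\<sigma>\<in>(\<lambda>v. {v}) ` \<Union>A. (-1::int) ^ (card \<sigma> - 1)) = int (card (\<Union>A))"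
    by (subst sum.reindex) auto
  moreover have "(\<Sum>\<sigma>\<in>es A. (-1::int) ^ (card \<sigma> - 1)) = (\<Sum>\<sigma>\<in>es A. -1)"
    by (intro sum.cong) (auto simp: es_def)
  moreover have "(\<Sum>\<sigma>\<in>A. (-1::int) ^ (card \<sigma> - 1)) = (\<Sum>\<sigma>\<in>A. 1)"
    by (intro sum.cong) (auto simp: assms(2))
  ultimately show ?thesis
    using f by (subst sum.union_disjoint[OF _ _ d2], simp, simp, subst sum.union_disjoint[OF _ _ d1]) (simp_all add: chi_def)
qed

section \<open>Facets, seams and colorings in terms of triangles\<close>

locale seamed_PL_surface =
  fixes F :: seamed_surface
  assumes F: "closed_seamed_surface F"

sublocale seamed_PL_surface \<subseteq> pl_surface "tri F"
  by unfold_locales (use F in \<open>simp add: closed_seamed_surface_def\<close>)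

context seamed_PL_surface
begin

abbreviation "K \<equiv> tri F"
abbreviation "X \<equiv> carrier F - seam_points F"

definition SS :: "point set set set" where "SS = (\<lambda>S. M ` S) ` seams F"
definition sd :: "point set \<Rightarrow> point set" where "sd e = M (side F (convex hull e))"
text \<open>A dot may lie in several triangles, but off the seams these belong to the same facet, so
  any choice serves.\<close>

definition tr :: "point \<Rightarrow> point set" where "tr p = M (SOME t. t \<in> triangles K \<and> p \<in> t)"
definition fc :: "point set \<Rightarrow> point set" where "fc t = facet_at F (rel_interior (convex hull t))"

lemma seam:
  assumes "S \<in> seams F"
  shows "S \<subseteq> edges K" "edge_cycle S" "co_orientation K S (side F)"
  using F assms by (simp_all add: closed_seamed_surface_def)

lemma seam_disj: "S \<in> seams F \<Longrightarrow> S' \<in> seams F \<Longrightarrow> S \<noteq> S' \<Longrightarrow> \<Union>S \<inter> \<Union>S' = {}"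
  using F by (simp add: closed_seamed_surface_def)

lemma seam_edge: "e \<in> \<Union>(seams F) \<Longrightarrow> e \<in> edges K"
  using seam(1) by blast

lemma M_hull: "\<sigma> \<in> K \<Longrightarrow> convex hull M \<sigma> = \<sigma>"
  by (rule simplex_M(2)[symmetric])

lemma M_subset: "M \<sigma> \<subseteq> \<sigma>"
  by (auto simp: vertices_of_def extreme_point_of_def)

lemma inj_seams: "inj_on ((`) M) (seams F)"
proof (rule inj_onI)
  fix S S' assume S: "S \<in> seams F" "S' \<in> seams F" "M ` S = M ` S'"
  have "S \<subseteq> K" "S' \<subseteq> K" using seam(1)[OF S(1)] seam(1)[OF S(2)] edge_K by auto
  then show "S = S'" using inj_on_image_eq_iff[OF inj_M] S(3) by blast
qed

lemma finite_seams: "finite (seams F)"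
proof (rule finite_subset)
  show "seams F \<subseteq> Pow K" using seam(1) edge_K by blast
qed (simp add: finK)

lemma mem_SS: "e \<in> \<Union>SS \<longleftrightarrow> (\<exists>\<epsilon>\<in>\<Union>(seams F). e = M \<epsilon>)"
  by (auto simp: SS_def)

lemma seamed_T:
  assumes "oriented_surface T nxt"
  shows "seamed T nxt SS sd"
proof (intro seamed.intro assms seamed_axioms.intro)
  show "finite SS" using finite_seams by (simp add: SS_def)
  show "cycle_graph S" if "S \<in> SS" for S
    using that cycle_graph_M seam(2) by (auto simp: SS_def)
  show "\<Union>S \<inter> \<Union>S' = {}" if "S \<in> SS" "S' \<in> SS" "S \<noteq> S'" for S S'
  proof -
    obtain R R' where R: "R \<in> seams F" "S = M ` R" "R' \<in> seams F" "S' = M ` R'" using \<open>S \<in> SS\<close> \<open>S' \<in> SS\<close> by (auto simp: SS_def)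
    then have "\<Union>R \<inter> \<Union>R' = {}" using seam_disj[of R R'] \<open>S \<noteq> S'\<close> by blast
    moreover have "\<Union>S \<subseteq> \<Union>R" "\<Union>S' \<subseteq> \<Union>R'" using M_subset R(2,4) by blast+
    ultimately show ?thesis by blast
  qed
  show "\<Union>SS \<subseteq> es T"
  proof
    fix e assume "e \<in> \<Union>SS"
    then obtain \<epsilon> where "\<epsilon> \<in> \<Union>(seams F)" "e = M \<epsilon>" using mem_SS by blast
    then show "e \<in> es T" using M_edges[OF seam_edge] by simp
  qed
  show "sd e \<in> T \<and> e \<subseteq> sd e" if "S \<in> SS" "e \<in> S" for S e
  proof -
    obtain R \<epsilon> where R: "R \<in> seams F" "S = M ` R" "\<epsilon> \<in> R" "e = M \<epsilon>" using \<open>S \<in> SS\<close> \<open>e \<in> S\<close> by (auto simp: SS_def)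
    have \<epsilon>: "\<epsilon> \<in> K" using R seam(1) edge_K by blast
    have "side F \<epsilon> \<in> triangles K" "\<epsilon> \<subseteq> side F \<epsilon>" using seam(3)[OF R(1)] R(3) by (auto simp: co_orientation_def)
    then show ?thesis
      unfolding sd_def R(4) M_hull[OF \<epsilon>] using subset_M[OF \<epsilon>] triangle_K M_T by blast
  qed
  show "(sd e, sd e') \<in> {(t, t'). t \<in> T \<and> t' \<in> T \<and> (\<exists>a. card a = 2 \<and> v \<in> a \<and> a \<notin> S \<and> a \<subseteq> t \<and> a \<subseteq> t')}\<^sup>*"
    (is "_ \<in> ?R\<^sup>*") if "S \<in> SS" "e \<in> S" "e' \<in> S" "v \<in> e" "v \<in> e'" for S e e' v
  proof -
    obtain R \<epsilon> \<epsilon>' where R: "R \<in> seams F" "S = M ` R" "\<epsilon> \<in> R" "e = M \<epsilon>" "\<epsilon>' \<in> R" "e' = M \<epsilon>'"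
      using \<open>S \<in> SS\<close> \<open>e \<in> S\<close> \<open>e' \<in> S\<close> by (auto simp: SS_def)
    have \<epsilon>: "\<epsilon> \<in> K" "\<epsilon>' \<in> K" using R seam(1) edge_K by blast+
    have "e \<in> es T" using M_edges seam_edge R by blast
    then have "v \<in> \<Union>T" using \<open>v \<in> e\<close> by (auto simp: es_def)
    then have v: "{v} \<in> K" using vertex_K by simp
    have "v \<in> \<epsilon> \<inter> \<epsilon>'" using \<open>v \<in> e\<close> \<open>v \<in> e'\<close> R M_subset by blast
    then have "(side F \<epsilon>, side F \<epsilon>') \<in> same_side K R v"
      using seam(3)[OF R(1)] R(3,5) v unfolding co_orientation_def by blast
    then have "(M (side F \<epsilon>), M (side F \<epsilon>')) \<in> ?R\<^sup>*"
      unfolding same_side_def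
    proof (induction rule: rtrancl_induct)
      case base
      show ?case by simp
    next
      case (step y z)
      then obtain a where a: "y \<in> triangles K" "z \<in> triangles K" "a \<in> edges K" "v \<in> a" "a \<notin> R" "a \<subseteq> y" "a \<subseteq> z" by blast
      have "M a \<notin> S"
      proof
        assume "M a \<in> S"
        then obtain b where b: "b \<in> R" "M a = M b" unfolding R(2) by blast
        then have "b \<in> K" using R(1) seam(1) edge_K by blast
        then have "a = b" using b inj_M edge_K[OF a(3)] by (auto dest: inj_onD)
        then show False using a(5) b by simp
      qed
      moreover have "M a \<subseteq> M y" "M a \<subseteq> M z"
        using subset_M[OF edge_K[OF a(3)] triangle_K[OF a(1)]] subset_M[OF edge_K[OF a(3)] triangle_K[OF a(2)]] a(6,7) by simp_all
      moreover have "v \<in> M a" using vertex_mem[OF edge_K[OF a(3)] v] a(4) by simp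
      moreover have "card (M a) = 2" using a(3) edges_iff by simp
      ultimately have "(M y, M z) \<in> ?R" using M_T a(1,2) by blast
      then show ?case using step.IH by (rule rtrancl_into_rtrancl[rotated])
    qed
    then show ?thesis unfolding sd_def R(4,6) M_hull[OF \<epsilon>(1)] M_hull[OF \<epsilon>(2)] .
  qed
qed

lemma facet_at_eq:
  assumes "f \<in> facets F" "Y \<subseteq> f" "Y \<noteq> {}"
  shows "facet_at F Y = f"
  unfolding facet_at_def
proof (rule the_equality)
  fix g assume g: "g \<in> facets F \<and> Y \<subseteq> g"
  then have "g \<inter> f \<noteq> {}" using assms by blast
  then show "g = f" using g assms(1) components_eq[of g X f] unfolding facets_def by blast
qed (use assms in blast)

lemma facet_at_ex:
  assumes "connected Y" "Y \<subseteq> X" "Y \<noteq> {}"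
  shows "facet_at F Y \<in> facets F \<and> Y \<subseteq> facet_at F Y"
proof -
  obtain f where f: "f \<in> components X" "Y \<subseteq> f"
    using exists_component_superset[of Y X] assms by blast
  then have "facet_at F Y = f" using facet_at_eq[of f Y] assms(3) by (simp add: facets_def)
  then show ?thesis using f by (simp add: facets_def)
qed

lemma not_seam_point:
  assumes "\<sigma> \<in> K" "x \<in> rel_interior \<sigma>" "\<And>e. e \<in> \<Union>(seams F) \<Longrightarrow> \<not> \<sigma> \<subseteq> e"
  shows "x \<in> X"
proof -
  have "x \<in> \<sigma>" using assms(2) rel_interior_subset by blast
  then have "x \<in> carrier F" using assms(1) by (auto simp: carrier_def)
  moreover have "x \<notin> seam_points F"
  proof
    assume "x \<in> seam_points F"
    then obtain e where e: "e \<in> \<Union>(seams F)" "x \<in> e" by (auto simp: seam_points_def)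
    then show False using rel_interior_K[OF assms(1) edge_K[OF seam_edge[OF e(1)]] assms(2) e(2)] assms(3) by blast
  qed
  ultimately show ?thesis by blast
qed

lemma rel_interior_X:
  assumes "t \<in> T" shows "rel_interior (convex hull t) \<subseteq> X"
proof
  fix x assume x: "x \<in> rel_interior (convex hull t)"
  have t: "convex hull t \<in> K" "M (convex hull t) = t" using T_hull[OF assms] triangle_K by auto
  show "x \<in> X"
  proof (rule not_seam_point[OF t(1) x])
    fix e assume e: "e \<in> \<Union>(seams F)"
    have eK: "e \<in> K" "card (M e) = 2" using seam_edge[OF e] edges_iff by auto
    show "\<not> convex hull t \<subseteq> e"
    proof
      assume "convex hull t \<subseteq> e"
      then have "t \<subseteq> M e" using subset_M[OF t(1) eK(1)] t(2) by simp
      then have "card t \<le> 2" using eK finM card_mono by metis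
      then show False using card_T[OF assms] by simp
    qed
  qed
qed

lemma rel_interior_T: "t \<in> T \<Longrightarrow> rel_interior (convex hull t) \<noteq> {}"
  using rel_interior_eq_empty[OF convex_convex_hull, of t] card_T[of t] by auto

lemma fc_T:
  assumes "t \<in> T" shows "fc t \<in> facets F" "rel_interior (convex hull t) \<subseteq> fc t"
proof -
  have "connected (rel_interior (convex hull t))"
    by (rule convex_connected) (simp add: convex_rel_interior)
  from facet_at_ex[OF this rel_interior_X[OF assms] rel_interior_T[OF assms]]
  show "fc t \<in> facets F" "rel_interior (convex hull t) \<subseteq> fc t" by (simp_all add: fc_def)
qed

text \<open>A connected set stays connected when a point of its closure is added, so
  \<open>p\<close> and the interior of \<open>t\<close> lie in one facet.\<close>

lemma fc_point:
  assumes t: "t \<in> T" and p: "p \<in> convex hull t" "p \<in> X"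
  shows "facet_at F {p} = fc t" "p \<in> fc t"
proof -
  let ?I = "rel_interior (convex hull t)"
  have "connected (insert p ?I)"
  proof (rule connected_intermediate_closure)
    show "connected ?I" by (rule convex_connected) (simp add: convex_rel_interior)
    have "closure ?I = closure (convex hull t)" by (simp add: convex_closure_rel_interior)
    then have "p \<in> closure ?I" using p(1) closure_subset[of "convex hull t"] by blast
    then show "insert p ?I \<subseteq> closure ?I" using closure_subset by blast
  qed blast
  moreover have "insert p ?I \<subseteq> X" using p(2) rel_interior_X[OF t] by blast
  ultimately have f: "facet_at F (insert p ?I) \<in> facets F" "insert p ?I \<subseteq> facet_at F (insert p ?I)"
    using facet_at_ex[of "insert p ?I"] by blast+
  have "fc t = facet_at F (insert p ?I)"
    unfolding fc_def using facet_at_eq[OF f(1)] f(2) rel_interior_T[OF t] by blast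
  then show "p \<in> fc t" using f(2) by blast
  then show "facet_at F {p} = fc t" using facet_at_eq[of "fc t" "{p}"] fc_T(1)[OF t] by blast
qed

text \<open>A relative interior point of an edge off the seams lies on no seam and belongs to both
  triangles.\<close>

lemma fc_edge:
  assumes "t \<in> T" "t' \<in> T" "e \<in> es T" "e \<subseteq> t" "e \<subseteq> t'" "e \<notin> \<Union>SS"
  shows "fc t = fc t'"
proof -
  have e: "convex hull e \<in> edges K" "M (convex hull e) = e" using assms(3) es_T by auto
  have "card e = 2" using assms(3) by (simp add: es_def)
  then have "convex hull e \<noteq> {}" by auto
  then obtain p where p: "p \<in> rel_interior (convex hull e)" using rel_interior_ne[OF edge_K[OF e(1)]] by blast
  have "p \<in> X"
  proof (rule not_seam_point[OF edge_K[OF e(1)] p])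
    fix \<epsilon> assume \<epsilon>: "\<epsilon> \<in> \<Union>(seams F)"
    have \<epsilon>K: "\<epsilon> \<in> K" "card (M \<epsilon>) = 2" using seam_edge[OF \<epsilon>] edges_iff by auto
    show "\<not> convex hull e \<subseteq> \<epsilon>"
    proof
      assume "convex hull e \<subseteq> \<epsilon>"
      then have "e \<subseteq> M \<epsilon>" using subset_M[OF edge_K[OF e(1)] \<epsilon>K(1)] e(2) by simp
      then have "e = M \<epsilon>" using \<open>card e = 2\<close> \<epsilon>K finM[OF \<epsilon>K(1)] by (metis card_subset_eq)
      then show False using assms(6) mem_SS \<epsilon> by blast
    qed
  qed
  moreover have "p \<in> convex hull t" "p \<in> convex hull t'"
    using p rel_interior_subset hull_mono[OF assms(4), of convex] hull_mono[OF assms(5), of convex] by blast+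
  ultimately show ?thesis using fc_point(1)[OF assms(1)] fc_point(1)[OF assms(2)] by metis
qed

lemma carrier_T: "carrier F = (\<Union>t\<in>T. convex hull t)"
proof
  show "carrier F \<subseteq> (\<Union>t\<in>T. convex hull t)"
  proof
    fix p assume "p \<in> carrier F"
    then obtain \<sigma> where "\<sigma> \<in> K" "p \<in> \<sigma>" by (auto simp: carrier_def)
    then obtain t where t: "t \<in> triangles K" "p \<in> t" using pure by blast
    then have "p \<in> convex hull (M t)" using M_hull[OF triangle_K[OF t(1)]] by simp
    then show "p \<in> (\<Union>t\<in>T. convex hull t)" using M_T[OF t(1)] by blast
  qed
  show "(\<Union>t\<in>T. convex hull t) \<subseteq> carrier F"
    using T_hull triangle_K unfolding carrier_def by blast
qed

lemma facet_T:
  assumes "f \<in> facets F" shows "\<exists>t\<in>T. f = fc t"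
proof -
  obtain p where p: "p \<in> f" using assms in_components_nonempty unfolding facets_def by blast
  have fX: "f \<subseteq> X" using assms in_components_subset unfolding facets_def by blast
  then obtain t where t: "t \<in> T" "p \<in> convex hull t" using carrier_T p by blast
  then have "facet_at F {p} = fc t" using fc_point(1) p fX by blast
  then show ?thesis using facet_at_eq[OF assms, of "{p}"] p t(1) by auto
qed

text \<open>The facet lies between the interiors of its triangles and the closed triangles, and
  these have the same closure.\<close>

lemma closure_facet:
  assumes f: "f \<in> facets F" shows "closure f = (\<Union>t\<in>{t\<in>T. fc t = f}. convex hull t)"
proof
  have fX: "f \<subseteq> X" using f in_components_subset unfolding facets_def by blast
  have fin: "finite {t\<in>T. fc t = f}" using finite_T by simp
  have cl: "closed (convex hull t)" if "t \<in> T" for t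
    using T_hull[OF that] triangle_K compact_K compact_imp_closed by blast
  have "f \<subseteq> (\<Union>t\<in>{t\<in>T. fc t = f}. convex hull t)"
  proof
    fix p assume p: "p \<in> f"
    then obtain t where t: "t \<in> T" "p \<in> convex hull t" using carrier_T fX by blast
    then have "fc t = f" using fc_point(1)[OF t] facet_at_eq[OF f, of "{p}"] p fX by auto
    then show "p \<in> (\<Union>t\<in>{t\<in>T. fc t = f}. convex hull t)" using t by blast
  qed
  then show "closure f \<subseteq> (\<Union>t\<in>{t\<in>T. fc t = f}. convex hull t)"
    by (rule closure_minimal) (use fin cl in \<open>auto intro!: closed_UN\<close>)
  show "(\<Union>t\<in>{t\<in>T. fc t = f}. convex hull t) \<subseteq> closure f"
  proof
    fix p assume "p \<in> (\<Union>t\<in>{t\<in>T. fc t = f}. convex hull t)"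
    then obtain t where t: "t \<in> T" "fc t = f" "p \<in> convex hull t" by blast
    have "closure (rel_interior (convex hull t)) \<subseteq> closure f" using fc_T(2)[OF t(1)] t(2) closure_mono by blast
    then show "p \<in> closure f"
      using t(3) closure_subset[of "convex hull t"] convex_closure_rel_interior[OF convex_convex_hull, of t] by blast
  qed
qed

definition AA :: "coloring \<Rightarrow> point set set" where "AA c = {t\<in>T. c (fc t) = 1}"

lemma colored_part_T: "colored_part F c i = (\<Union>t\<in>{t\<in>T. c (fc t) = i}. convex hull t)"
proof
  show "colored_part F c i \<subseteq> (\<Union>t\<in>{t\<in>T. c (fc t) = i}. convex hull t)"
    unfolding colored_part_def using closure_facet by fastforce
  show "(\<Union>t\<in>{t\<in>T. c (fc t) = i}. convex hull t) \<subseteq> colored_part F c i"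
  proof
    fix p assume "p \<in> (\<Union>t\<in>{t\<in>T. c (fc t) = i}. convex hull t)"
    then obtain t where t: "t \<in> T" "c (fc t) = i" "p \<in> convex hull t" by blast
    then have "p \<in> closure (fc t)" using closure_facet[OF fc_T(1)[OF t(1)]] by blast
    then show "p \<in> colored_part F c i" unfolding colored_part_def using fc_T(1)[OF t(1)] t(2) by blast
  qed
qed

lemma fc_M: "t \<in> triangles K \<Longrightarrow> fc (M t) = facet_at F (rel_interior t)"
  by (simp add: fc_def M_hull triangle_K)

lemma adm_iff:
  "c \<in> adm F \<longleftrightarrow> c \<in> facets F \<rightarrow>\<^sub>E {1, 2} \<and>
    (\<forall>e\<in>\<Union>SS. \<forall>t\<in>T. \<forall>t'\<in>T. e \<subseteq> t \<and> e \<subseteq> t' \<and> t \<noteq> t' \<longrightarrow> c (fc t) \<noteq> c (fc t'))"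
proof -
  have sub: "M e \<subseteq> M t \<longleftrightarrow> e \<subseteq> t" if "e \<in> \<Union>(seams F)" "t \<in> triangles K" for e t
    using subset_M[OF edge_K[OF seam_edge[OF that(1)]] triangle_K[OF that(2)]] by simp
  have inj: "M t = M t' \<longleftrightarrow> t = t'" if "t \<in> triangles K" "t' \<in> triangles K" for t t'
    using inj_M triangle_K that by (auto dest: inj_onD)
  have "(\<forall>e\<in>\<Union>SS. \<forall>t\<in>T. \<forall>t'\<in>T. e \<subseteq> t \<and> e \<subseteq> t' \<and> t \<noteq> t' \<longrightarrow> c (fc t) \<noteq> c (fc t')) \<longleftrightarrow>
    (\<forall>e\<in>\<Union>(seams F). \<forall>t\<in>triangles K. \<forall>t'\<in>triangles K. M e \<subseteq> M t \<and> M e \<subseteq> M t' \<and> M t \<noteq> M t' \<longrightarrow> c (fc (M t)) \<noteq> c (fc (M t')))"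
    unfolding SS_def T_def by blast
  also have "\<dots> \<longleftrightarrow> (\<forall>e\<in>\<Union>(seams F). \<forall>t\<in>triangles K. \<forall>t'\<in>triangles K. e \<subseteq> t \<and> e \<subseteq> t' \<and> t \<noteq> t' \<longrightarrow>
      c (facet_at F (rel_interior t)) \<noteq> c (facet_at F (rel_interior t')))"
    by (intro ball_cong refl) (simp only: sub inj fc_M)
  finally have eq: "(\<forall>e\<in>\<Union>SS. \<forall>t\<in>T. \<forall>t'\<in>T. e \<subseteq> t \<and> e \<subseteq> t' \<and> t \<noteq> t' \<longrightarrow> c (fc t) \<noteq> c (fc t')) \<longleftrightarrow>
    (\<forall>e\<in>\<Union>(seams F). \<forall>t\<in>triangles K. \<forall>t'\<in>triangles K. e \<subseteq> t \<and> e \<subseteq> t' \<and> t \<noteq> t' \<longrightarrow>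
      c (facet_at F (rel_interior t)) \<noteq> c (facet_at F (rel_interior t')))" .
  show ?thesis unfolding adm_def mem_Collect_eq eq by (rule refl)
qed

lemma adm_values: "c \<in> adm F \<Longrightarrow> t \<in> T \<Longrightarrow> c (fc t) = 1 \<or> c (fc t) = 2"
proof -
  assume "c \<in> adm F" "t \<in> T"
  then have "c \<in> facets F \<rightarrow>\<^sub>E {1, 2}" using adm_iff[of c] by blast
  from PiE_mem[OF this fc_T(1)[OF \<open>t \<in> T\<close>]] show ?thesis by simp
qed

section \<open>Euler characteristics of the surface and of the capped part\<close>

lemma cells:
  assumes "A \<subseteq> T"
  shows "{M \<sigma> | \<sigma>. \<sigma> \<in> K \<and> \<sigma> \<noteq> {} \<and> (\<exists>t\<in>A. M \<sigma> \<subseteq> t)} = (\<lambda>v. {v}) ` \<Union>A \<union> es A \<union> A"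
proof (intro equalityI subsetI)
  fix s assume "s \<in> {M \<sigma> | \<sigma>. \<sigma> \<in> K \<and> \<sigma> \<noteq> {} \<and> (\<exists>t\<in>A. M \<sigma> \<subseteq> t)}"
  then obtain \<sigma> t where s: "s = M \<sigma>" "\<sigma> \<in> K" "\<sigma> \<noteq> {}" "t \<in> A" "s \<subseteq> t" by blast
  have "s \<noteq> {}" using M_hull[OF s(2)] s(1,3) by auto
  have t: "card t = 3" "finite t" using card_T s(4) assms by (auto simp: card_ge_0_finite)
  then have fs: "finite s" using s(5) finite_subset by blast
  have "card s \<le> 3" "card s \<noteq> 0" using card_mono[OF t(2) s(5)] t(1) fs \<open>s \<noteq> {}\<close> by auto
  then consider "card s = 1" | "card s = 2" | "card s = 3" by linarith
  then show "s \<in> (\<lambda>v. {v}) ` \<Union>A \<union> es A \<union> A"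
  proof cases
    case 1
    then obtain v where "s = {v}" by (meson card_1_singletonE)
    then show ?thesis using s(4,5) by blast
  next
    case 2
    then show ?thesis using s(4,5) by (auto simp: es_def)
  next
    case 3
    then have "s = t" using card_subset_eq[OF t(2) s(5)] t(1) by simp
    then show ?thesis using s(4) by blast
  qed
next
  fix s assume s: "s \<in> (\<lambda>v. {v}) ` \<Union>A \<union> es A \<union> A"
  then have ne: "s \<noteq> {}" using card_T[of "{}"] assms by (auto simp: es_def)
  obtain t where t: "t \<in> A" "s \<subseteq> t" using s by (auto simp: es_def)
  have "convex hull s \<in> K" "M (convex hull s) = s" using sub_T[OF t(2)] t(1) assms by blast+
  moreover have "convex hull s \<noteq> {}" using ne by simp
  ultimately show "s \<in> {M \<sigma> | \<sigma>. \<sigma> \<in> K \<and> \<sigma> \<noteq> {} \<and> (\<exists>t\<in>A. M \<sigma> \<subseteq> t)}" using t by (metis (mono_tags, lifting) mem_Collect_eq)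
qed

lemma surface_euler: "surface_euler_char F = chi T"
proof -
  have "vertex_scheme K - {{}} = {M \<sigma> | \<sigma>. \<sigma> \<in> K \<and> \<sigma> \<noteq> {} \<and> (\<exists>t\<in>T. M \<sigma> \<subseteq> t)}"
  proof (intro equalityI subsetI)
    fix s assume "s \<in> vertex_scheme K - {{}}"
    then obtain \<sigma> where s: "s = M \<sigma>" "\<sigma> \<in> K" "s \<noteq> {}" by (auto simp: vertex_scheme_def)
    then have "\<sigma> \<noteq> {}" using M_subset by auto
    then show "s \<in> {M \<sigma> | \<sigma>. \<sigma> \<in> K \<and> \<sigma> \<noteq> {} \<and> (\<exists>t\<in>T. M \<sigma> \<subseteq> t)}" using s M_pure[OF s(2)] by blast
  next
    fix s assume "s \<in> {M \<sigma> | \<sigma>. \<sigma> \<in> K \<and> \<sigma> \<noteq> {} \<and> (\<exists>t\<in>T. M \<sigma> \<subseteq> t)}"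
    then obtain \<sigma> where s: "s = M \<sigma>" "\<sigma> \<in> K" "\<sigma> \<noteq> {}" by blast
    then have "s \<noteq> {}" using M_hull[OF s(2)] by auto
    then show "s \<in> vertex_scheme K - {{}}" using s by (auto simp: vertex_scheme_def)
  qed
  then show ?thesis
    unfolding surface_euler_char_def euler_char_def cells[OF subset_refl]
    using euler_sum[OF finite_T card_T] by simp
qed

text \<open>The empty simplex is kept, since the cone over it is the apex of the capping
  disk.\<close>

lemma seam_cells:
  assumes S: "S \<in> seams F"
  shows "{M \<tau> | \<tau>. \<tau> \<in> K \<and> \<tau> \<subseteq> \<Union>S} = insert {} ((\<lambda>v. {v}) ` \<Union>(M ` S) \<union> M ` S)"
proof (intro equalityI subsetI)
  have SK: "S \<subseteq> K" using seam(1)[OF S] edge_K by blast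
  fix s assume "s \<in> {M \<tau> | \<tau>. \<tau> \<in> K \<and> \<tau> \<subseteq> \<Union>S}"
  then obtain \<tau> where s: "s = M \<tau>" "\<tau> \<in> K" "\<tau> \<subseteq> \<Union>S" by blast
  show "s \<in> insert {} ((\<lambda>v. {v}) ` \<Union>(M ` S) \<union> M ` S)"
  proof (cases "\<tau> = {}")
    case True
    then show ?thesis using M_subset[of \<tau>] s(1) by auto
  next
    case False
    obtain e where e: "e \<in> S" "\<tau> \<subseteq> e" using cover_K[OF s(2) False SK s(3)] by blast
    have eK: "e \<in> K" using e SK by blast
    have sub: "s \<subseteq> M e" using subset_M[OF s(2) eK] e(2) s(1) by simp
    have c: "card (M e) = 2" "finite (M e)" using seam(1)[OF S] e(1) edges_iff finM[OF eK] by auto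
    have "card s \<le> 2" using card_mono[OF c(2) sub] c(1) by simp
    moreover have "finite s" using sub c(2) finite_subset by blast
    ultimately consider "s = {}" | "card s = 1" | "card s = 2" by (metis One_nat_def Suc_1 card_0_eq le_SucE le_zero_eq)
    then show ?thesis
    proof cases
      case 2
      then obtain v where "s = {v}" by (meson card_1_singletonE)
      then show ?thesis using sub e(1) by blast
    next
      case 3
      then have "s = M e" using card_subset_eq[OF c(2) sub] c(1) by simp
      then show ?thesis using e(1) by blast
    qed simp
  qed
next
  fix s assume s: "s \<in> insert {} ((\<lambda>v. {v}) ` \<Union>(M ` S) \<union> M ` S)"
  have ne: "S \<noteq> {}" using cycle_graph_M[OF seam(2)[OF S]] by (auto simp: cycle_graph_def)
  have "\<exists>e\<in>S. s \<subseteq> M e" using s ne by blast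
  then obtain e where e: "e \<in> S" "s \<subseteq> M e" by blast
  then have eK: "e \<in> K" using seam(1)[OF S] edge_K by blast
  have "convex hull s \<in> K" "M (convex hull s) = s" using face_K[OF eK e(2)] by blast+
  moreover have "convex hull s \<subseteq> \<Union>S" using hull_mono[OF e(2), of convex] M_hull[OF eK] e(1) by auto
  ultimately show "s \<in> {M \<tau> | \<tau>. \<tau> \<in> K \<and> \<tau> \<subseteq> \<Union>S}"
    by (intro CollectI exI[of _ "convex hull s"] conjI) simp_all
qed

text \<open>Coning raises the dimension by one, which accounts for the exponent
  \<open>card \<mu>\<close>. The apex gives 1, while the cones over vertices and over edges cancel,
  a polygon having as many vertices as edges.\<close>

lemma seam_cone_sum:
  assumes S: "S \<in> seams F"
  shows "(\<Sum>\<mu>\<in>{M \<tau> | \<tau>. \<tau> \<in> K \<and> \<tau> \<subseteq> \<Union>S}. (-1::int) ^ card \<mu>) = 1"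
proof -
  have g: "cycle_graph (M ` S)" by (rule cycle_graph_M[OF seam(2)[OF S]])
  have two: "card e = 2" if "e \<in> M ` S" for e by (rule cycle_graph_card2[OF g that])
  have c: "finite (M ` S)" "card (M ` S) = card (\<Union>(M ` S))" using g by (simp_all add: cycle_graph_def)
  have "finite (\<Union>(M ` S))" using c(1) two by (intro finite_Union) (auto simp: card_ge_0_finite)
  then have f: "finite ((\<lambda>v. {v}) ` \<Union>(M ` S))" by simp
  have d: "(\<lambda>v. {v}) ` \<Union>(M ` S) \<inter> M ` S = {}"
  proof (rule ccontr)
    assume "\<not> ?thesis"
    then obtain s where s: "s \<in> (\<lambda>v. {v}) ` \<Union>(M ` S)" "s \<in> M ` S" by blast
    from s(1) have "card s = 1" by auto
    then show False using two[OF s(2)] by simp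
  qed
  have n: "{} \<notin> (\<lambda>v. {v}) ` \<Union>(M ` S) \<union> M ` S"
  proof
    assume "{} \<in> (\<lambda>v. {v}) ` \<Union>(M ` S) \<union> M ` S"
    then have "{} \<in> M ` S" by blast
    from two[OF this] show False by simp
  qed
  have "(\<Sum>\<mu>\<in>(\<lambda>v. {v}) ` \<Union>(M ` S). (-1::int) ^ card \<mu>) = - int (card (\<Union>(M ` S)))"
    by (subst sum.reindex) auto
  moreover have "(\<Sum>\<mu>\<in>M ` S. (-1::int) ^ card \<mu>) = (\<Sum>\<mu>\<in>M ` S. 1)"
    by (intro sum.cong refl) (simp add: two)
  ultimately show ?thesis
    unfolding seam_cells[OF S] using n f c
    by (subst sum.insert, simp, simp, subst sum.union_disjoint[OF _ _ d]) simp_all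
qed

text \<open>The simplices of the capped part that do not come from the colored part are those
  containing an apex, and they add 1 for each seam.\<close>

lemma capped_euler:
  shows "euler_char (capped_part F c 1) = chi (AA c) + int (card SS)"
proof -
  let ?A = "AA c"
  have AT: "?A \<subseteq> T" by (auto simp: AA_def)
  let ?C = "(\<lambda>v. {v}) ` \<Union>?A \<union> es ?A \<union> ?A"
  let ?N = "\<lambda>S. {M \<tau> | \<tau>. \<tau> \<in> K \<and> \<tau> \<subseteq> \<Union>S}"
  let ?g = "\<lambda>(S, \<mu>). insert (Inr S) (Inl ` \<mu>) :: (point + cell set) set"
  have in_part: "\<sigma> \<subseteq> colored_part F c 1 \<longleftrightarrow> (\<exists>t\<in>?A. M \<sigma> \<subseteq> t)" if \<sigma>: "\<sigma> \<in> K" "\<sigma> \<noteq> {}" for \<sigma>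
  proof
    assume "\<sigma> \<subseteq> colored_part F c 1"
    then have s: "\<sigma> \<subseteq> \<Union>((hull) convex ` ?A)" by (simp add: colored_part_T AA_def)
    have hK: "(hull) convex ` ?A \<subseteq> K" using AT T_hull triangle_K by blast
    obtain t where t: "t \<in> ?A" "\<sigma> \<subseteq> convex hull t" using cover_K[OF \<sigma> hK s] by blast
    then have "convex hull t \<in> K" "M (convex hull t) = t" using AT T_hull triangle_K by blast+
    then show "\<exists>t\<in>?A. M \<sigma> \<subseteq> t" using subset_M[OF \<sigma>(1), of "convex hull t"] t by auto
  next
    assume "\<exists>t\<in>?A. M \<sigma> \<subseteq> t"
    then obtain t where t: "t \<in> ?A" "M \<sigma> \<subseteq> t" by blast
    then have "\<sigma> \<subseteq> convex hull t" using hull_mono[OF t(2), of convex] M_hull[OF \<sigma>(1)] by simp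
    then show "\<sigma> \<subseteq> colored_part F c 1" using t(1) by (auto simp: colored_part_T AA_def)
  qed
  have eq: "capped_part F c 1 - {{}} = (`) Inl ` ?C \<union> ?g ` (SIGMA S:seams F. ?N S)" (is "?L = ?R1 \<union> ?R2")
  proof (intro equalityI subsetI)
    fix s assume "s \<in> ?L"
    then consider \<sigma> where "s = Inl ` M \<sigma>" "\<sigma> \<in> K" "\<sigma> \<subseteq> colored_part F c 1" "s \<noteq> {}"
      | S \<tau> where "s = insert (Inr S) (Inl ` M \<tau>)" "S \<in> seams F" "\<tau> \<in> K" "\<tau> \<subseteq> \<Union>S"
      unfolding capped_part_def by blast
    then show "s \<in> ?R1 \<union> ?R2"
    proof cases
      case 1
      then have ne: "\<sigma> \<noteq> {}" using M_subset[of \<sigma>] by auto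
      then have "M \<sigma> \<in> ?C" unfolding cells[OF AT, symmetric] using in_part[OF 1(2) ne] 1(2,3) by blast
      then show ?thesis using 1(1) by blast
    next
      case 2
      then have "(S, M \<tau>) \<in> (SIGMA S:seams F. ?N S)" by blast
      moreover have "s = ?g (S, M \<tau>)" using 2(1) by simp
      ultimately show ?thesis by blast
    qed
  next
    fix s assume "s \<in> ?R1 \<union> ?R2"
    then show "s \<in> ?L"
    proof
      assume "s \<in> ?R1"
      then obtain \<sigma> where \<sigma>: "s = Inl ` M \<sigma>" "\<sigma> \<in> K" "\<sigma> \<noteq> {}" "\<exists>t\<in>?A. M \<sigma> \<subseteq> t"
        unfolding cells[OF AT, symmetric] by blast
      then have "M \<sigma> \<noteq> {}" using M_hull[OF \<sigma>(2)] by auto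
      then show ?thesis unfolding capped_part_def using \<sigma> in_part[OF \<sigma>(2,3)] by blast
    next
      assume "s \<in> ?R2"
      then obtain S \<tau> where "s = insert (Inr S) (Inl ` M \<tau>)" "S \<in> seams F" "\<tau> \<in> K" "\<tau> \<subseteq> \<Union>S" by auto
      then show ?thesis unfolding capped_part_def by blast
    qed
  qed
  have finC: "finite ?C"
  proof -
    have "finite ?A" using finite_T AT finite_subset by blast
    moreover have "finite (\<Union>?A)" using calculation card_T AT by (intro finite_Union) (auto simp: card_ge_0_finite)
    moreover have "finite (es ?A)" by (rule finite_subset[of _ "Pow (\<Union>?A)"]) (use calculation(2) in \<open>auto simp: es_def\<close>)
    ultimately show ?thesis by simp
  qed
  have finN: "finite (?N S)" for S
    by (rule finite_subset[of _ "M ` K"]) (auto simp: finK)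
  have finNmu: "finite \<mu>" if "\<mu> \<in> ?N S" for \<mu> S using that finM by blast
  have disj: "?R1 \<inter> ?R2 = {}" by auto
  have inj1: "inj_on ((`) Inl :: point set \<Rightarrow> (point + cell set) set) ?C" by (rule inj_on_image) (simp add: inj_on_def)
  have inj2: "inj_on ?g (SIGMA S:seams F. ?N S)"
  proof (rule inj_onI, clarify)
    fix S \<mu>1 S' \<mu>2 assume eq: "insert (Inr S) (Inl ` M \<mu>1) = (insert (Inr S') (Inl ` M \<mu>2) :: (point + cell set) set)"
    have "Inr S \<in> (insert (Inr S') (Inl ` M \<mu>2) :: (point + cell set) set)" unfolding eq[symmetric] by blast
    then have "S = S'" by auto
    moreover have "Inl ` M \<mu>1 = (Inl ` M \<mu>2 :: (point + cell set) set)"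
    proof -
      have "Inl ` M \<mu>1 = (insert (Inr S) (Inl ` M \<mu>1) - {Inr S} :: (point + cell set) set)" by auto
      also have "\<dots> = insert (Inr S') (Inl ` M \<mu>2) - {Inr S'}" using eq \<open>S = S'\<close> by simp
      also have "\<dots> = Inl ` M \<mu>2" by auto
      finally show ?thesis .
    qed
    then have "M \<mu>1 = M \<mu>2" by (simp add: inj_image_eq_iff)
    ultimately show "S = S' \<and> M \<mu>1 = M \<mu>2" by simp
  qed
  have s1: "(\<Sum>\<sigma>\<in>?R1. (-1::int) ^ (card \<sigma> - 1)) = chi ?A"
  proof -
    have "(\<Sum>\<sigma>\<in>?R1. (-1::int) ^ (card \<sigma> - 1)) = (\<Sum>\<sigma>\<in>?C. (-1) ^ (card \<sigma> - 1))"
      unfolding sum.reindex[OF inj1] by (intro sum.cong refl) (simp add: card_image)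
    also have "\<dots> = chi ?A"
      using finite_T AT card_T by (intro euler_sum) (auto intro: finite_subset)
    finally show ?thesis .
  qed
  have s2: "(\<Sum>\<sigma>\<in>?R2. (-1::int) ^ (card \<sigma> - 1)) = int (card (seams F))"
  proof -
    have "(\<Sum>\<sigma>\<in>?R2. (-1::int) ^ (card \<sigma> - 1)) = (\<Sum>(S, \<mu>)\<in>(SIGMA S:seams F. ?N S). (-1) ^ card \<mu>)"
      unfolding sum.reindex[OF inj2]
    proof (intro sum.cong refl, clarify)
      fix S \<tau> assume "\<tau> \<in> K"
      then have "finite (Inl ` M \<tau> :: (point + cell set) set)" using finM by blast
      then show "((\<lambda>\<sigma>. (-1::int) ^ (card \<sigma> - 1)) \<circ> ?g) (S, M \<tau>) = (-1) ^ card (M \<tau>)"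
        by (simp add: card_insert_if image_iff card_image)
    qed
    also have "\<dots> = (\<Sum>S\<in>seams F. \<Sum>\<mu>\<in>?N S. (-1) ^ card \<mu>)"
      by (subst sum.Sigma[OF finite_seams]) (use finN in auto)
    also have "\<dots> = (\<Sum>S\<in>seams F. 1)" by (intro sum.cong refl seam_cone_sum)
    finally show ?thesis by simp
  qed
  have finR1: "finite ?R1" using finC by (rule finite_imageI)
  have finR2: "finite ?R2" by (intro finite_imageI finite_SigmaI finite_seams finN)
  have "card SS = card (seams F)" unfolding SS_def by (rule card_image[OF inj_seams])
  then show ?thesis
    unfolding euler_char_def eq sum.union_disjoint[OF finR1 finR2 disj] s1 s2 by simp
qed

section \<open>Counting dots and seams by color\<close>

lemma tr_dot:
  assumes "p \<in> dots F"
  shows "tr p \<in> T" "facet_at F {p} = fc (tr p)"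
proof -
  have pX: "p \<in> X" using F assms by (auto simp: closed_seamed_surface_def)
  then obtain t where "t \<in> T" "p \<in> convex hull t" using carrier_T by blast
  then have "\<exists>t. t \<in> triangles K \<and> p \<in> t" using T_hull by blast
  from someI_ex[OF this] have s: "(SOME t. t \<in> triangles K \<and> p \<in> t) \<in> triangles K" "p \<in> (SOME t. t \<in> triangles K \<and> p \<in> t)" by blast+
  then show "tr p \<in> T" unfolding tr_def by (intro M_T)
  have "p \<in> convex hull (tr p)" unfolding tr_def using s M_hull[OF triangle_K[OF s(1)]] by simp
  then show "facet_at F {p} = fc (tr p)" using fc_point(1)[OF \<open>tr p \<in> T\<close>] pX by blast
qed

lemma num_dots_T:
  assumes "c \<in> adm F"
  shows "num_dots F c 1 = card {p\<in>dots F. tr p \<in> AA c}" "num_dots F c 2 = card {p\<in>dots F. tr p \<in> T - AA c}"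
proof -
  have "{p\<in>dots F. c (facet_at F {p}) = 1} = {p\<in>dots F. tr p \<in> AA c}" 
    using tr_dot by (auto simp: AA_def)
  then show "num_dots F c 1 = card {p\<in>dots F. tr p \<in> AA c}" by (simp add: num_dots_def)
  have "{p\<in>dots F. c (facet_at F {p}) = 2} = {p\<in>dots F. tr p \<in> T - AA c}"
    using tr_dot adm_values[OF assms] by (auto simp: AA_def) (metis numeral_eq_one_iff semiring_norm(86) tr_dot(1))+
  then show "num_dots F c 2 = card {p\<in>dots F. tr p \<in> T - AA c}" by (simp add: num_dots_def)
qed

lemma num_seams_T: "num_seams F c 1 = card {S\<in>SS. \<forall>e\<in>S. sd e \<in> AA c}"
proof -
  have side: "sd (M e) \<in> AA c \<longleftrightarrow> c (facet_at F (rel_interior (side F e))) = 1" if "S \<in> seams F" "e \<in> S" for S e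
  proof -
    have "e \<in> K" using that seam(1) edge_K by blast
    moreover have "side F e \<in> triangles K" using seam(3)[OF that(1)] that(2) by (auto simp: co_orientation_def)
    ultimately show ?thesis unfolding sd_def AA_def by (simp add: M_hull M_T fc_M)
  qed
  have "{S\<in>SS. \<forall>e\<in>S. sd e \<in> AA c} = (`) M ` {S\<in>seams F. \<forall>e\<in>M ` S. sd e \<in> AA c}"
    unfolding SS_def by blast
  also have "{S\<in>seams F. \<forall>e\<in>M ` S. sd e \<in> AA c} = {S\<in>seams F. \<forall>e\<in>S. c (facet_at F (rel_interior (side F e))) = 1}"
    by (intro Collect_cong conj_cong refl) (simp add: side)
  finally have "{S\<in>SS. \<forall>e\<in>S. sd e \<in> AA c} = (`) M ` {S\<in>seams F. \<forall>e\<in>S. c (facet_at F (rel_interior (side F e))) = 1}" .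
  moreover have "inj_on ((`) M) {S\<in>seams F. \<forall>e\<in>S. c (facet_at F (rel_interior (side F e))) = 1}"
    using inj_seams by (rule inj_on_subset) blast
  ultimately show ?thesis unfolding num_seams_def by (simp add: card_image)
qed

end

section \<open>From colorings to the symmetric polynomial\<close>

context seamed
begin

text \<open>\<open>chi_split\<close>, \<open>side_count\<close> and the evenness of both capped
  parts combine to the parity hypothesis of \<open>component_factor\<close>, and
  \<open>chi_le_2\<close> provides the bound on the exponent.\<close>

lemma component_symmetric:
  assumes A: "checker A" and P: "finite P" and q: "q \<in> Q"
  shows "symmetric_homogen (int (card {p\<in>P. tr p \<in> q}) - chi q div 2)
    (factor (to_fract \<alpha>1) (to_fract \<alpha>2) P tr (A \<inter> q) q + factor (to_fract \<alpha>1) (to_fract \<alpha>2) P tr (q - A) q)"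
proof -
  let ?a = "card {p\<in>P. tr p \<in> A \<inter> q}" and ?b = "card {p\<in>P. tr p \<in> q - A}"
  have sets: "q - A \<inter> q = q - A" "q - (q - A) = A \<inter> q" by blast+
  have "card ({p\<in>P. tr p \<in> A \<inter> q} \<union> {p\<in>P. tr p \<in> q - A}) = ?a + ?b"
    by (rule card_Un_disjoint) (use P in auto)
  moreover have "{p\<in>P. tr p \<in> A \<inter> q} \<union> {p\<in>P. tr p \<in> q - A} = {p\<in>P. tr p \<in> q}" by blast
  ultimately have ab: "card {p\<in>P. tr p \<in> q} = ?a + ?b" by simp
  have k: "chi q div 2 \<le> 1" using chi_le_2[OF q] by linarith
  obtain m n where mn: "chi (A \<inter> q) + int (card (SSq q)) = 2 * m" "chi (q - A) + int (card (SSq q)) = 2 * n"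
    using even_chi_q[OF A q] by (elim evenE)
  have "chi q = 2 * (m + n - int (card (SSq q)))" using chi_split[OF A q] mn by simp
  then have "sexp (A \<inter> q) q + sexp (q - A) q - chi q div 2 = 2 * int (card (SSq q))"
    using side_count[OF A q] unfolding sexp_def mn by simp
  then have "even (sexp (A \<inter> q) q + sexp (q - A) q - chi q div 2)" by simp
  from component_factor[OF k this, of ?a ?b] show ?thesis
    unfolding factor_def sets ab .
qed

end

locale oriented_seamed_PL_surface = seamed_PL_surface +
  fixes nxt
  assumes nxt: "oriented_surface T nxt"

sublocale oriented_seamed_PL_surface \<subseteq> seamed T nxt SS sd
  by (rule seamed_T[OF nxt])

context oriented_seamed_PL_surface
begin

text \<open>Triangles of different components share no vertex, hence no point, so a component
  occupies a closed set disjoint from the closed set of the others. A connected facet cannot meet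
  both.\<close>

lemma fc_connected:
  assumes t: "t \<in> T" "t' \<in> T" "fc t = fc t'"
  shows "(t, t') \<in> adj\<^sup>*"
proof (rule ccontr)
  assume no: "(t, t') \<notin> adj\<^sup>*"
  define q where "q = component t"
  have q: "q \<in> Q" "t \<in> q" "t' \<notin> q"
    using t no component_self by (auto simp: q_def Q_def component_def)
  let ?U = "\<Union>s\<in>q. convex hull s" and ?W = "\<Union>s\<in>T - q. convex hull s"
  have qT: "q \<subseteq> T" by (rule Q_subset[OF q(1)])
  have cl: "closed (convex hull s)" if "s \<in> T" for s
    using T_hull[OF that] triangle_K compact_K compact_imp_closed by blast
  have closed: "closed ?U" "closed ?W"
    using cl qT finite_T finite_subset[OF qT finite_T] by (auto intro!: closed_UN)
  have disj: "?U \<inter> ?W = {}"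
  proof (rule ccontr)
    assume "?U \<inter> ?W \<noteq> {}"
    then obtain x s s' where s: "s \<in> q" "s' \<in> T" "s' \<notin> q" "x \<in> convex hull s" "x \<in> convex hull s'" by blast
    have "convex hull s \<inter> convex hull s' = convex hull (s \<inter> s')"
      using embedded.meet[OF embedded_T, of s s' s s'] s(1,2) qT by blast
    then have "s \<inter> s' \<noteq> {}" using s(4,5) by auto
    then obtain v where v: "v \<in> s" "v \<in> s'" by blast
    have "(s, s') \<in> adj\<^sup>*" using vertex_adj[OF _ s(2) v] s(1) qT by blast
    then show False using Q_adj[OF q(1) s(1,2)] s(3) by blast
  qed
  have f: "connected (fc t)" "fc t \<subseteq> X"
    using fc_T(1)[OF t(1)] in_components_connected in_components_subset unfolding facets_def by blast+
  have cover: "fc t \<subseteq> ?U \<union> ?W" using f(2) carrier_T by blast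
  have "rel_interior (convex hull t) \<subseteq> fc t \<inter> ?U"
    using fc_T(2)[OF t(1)] rel_interior_subset q(2) by blast
  then have 1: "?U \<inter> fc t \<noteq> {}" using rel_interior_T[OF t(1)] by blast
  have "rel_interior (convex hull t') \<subseteq> fc t \<inter> ?W"
    using fc_T(2)[OF t(2)] rel_interior_subset q(3) t(2,3) by blast
  then have 2: "?W \<inter> fc t \<noteq> {}" using rel_interior_T[OF t(2)] by blast
  have "?U \<inter> ?W \<inter> fc t = {}" using disj by blast
  from connected_closedD[OF f(1) this cover closed] 1 2 show False by blast
qed

lemma checker_AA:
  assumes c: "c \<in> adm F" shows "checker (AA c)"
proof (rule checkerI)
  show "AA c \<subseteq> T" by (auto simp: AA_def)
  fix t t' e assume t: "t \<in> T" "t' \<in> T" "t \<noteq> t'" "e \<subseteq> t" "e \<subseteq> t'" "card e = 2"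
  have mem: "s \<in> AA c \<longleftrightarrow> c (fc s) = 1" if "s \<in> T" for s using that by (simp add: AA_def)
  show "e \<in> \<Union>SS \<longleftrightarrow> (t \<in> AA c) \<noteq> (t' \<in> AA c)"
  proof (cases "e \<in> \<Union>SS")
    case True
    have "\<forall>e\<in>\<Union>SS. \<forall>t\<in>T. \<forall>t'\<in>T. e \<subseteq> t \<and> e \<subseteq> t' \<and> t \<noteq> t' \<longrightarrow> c (fc t) \<noteq> c (fc t')"
      using c adm_iff[of c] by blast
    then have "c (fc t) \<noteq> c (fc t')" using True t by blast
    then show ?thesis
      using True adm_values[OF c t(1)] adm_values[OF c t(2)] unfolding mem[OF t(1)] mem[OF t(2)] by auto
  next
    case False
    have "e \<in> es T" using t by (auto simp: es_def)
    then have "fc t = fc t'" using fc_edge[OF t(1,2) _ t(4,5) False] by blast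
    then show ?thesis using False unfolding mem[OF t(1)] mem[OF t(2)] by simp
  qed
qed

text \<open>Every facet contains the interior of a triangle, and elements of \<open>adm F\<close>
  have a fixed value outside \<open>facets F\<close>.\<close>

lemma inj_AA: "inj_on AA (adm F)"
proof (rule inj_onI)
  fix c c' assume c: "c \<in> adm F" "c' \<in> adm F" "AA c = AA c'"
  have E: "c \<in> facets F \<rightarrow>\<^sub>E {1, 2}" "c' \<in> facets F \<rightarrow>\<^sub>E {1, 2}" using c adm_iff by blast+
  show "c = c'"
  proof (rule PiE_ext[OF E])
    fix f assume "f \<in> facets F"
    then obtain t where t: "t \<in> T" "f = fc t" using facet_T by blast
    have "c (fc t) = 1 \<longleftrightarrow> c' (fc t) = 1" using c(3) t(1) unfolding AA_def by blast
    then show "c f = c' f"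
      using adm_values[OF c(1) t(1)] adm_values[OF c(2) t(1)] t(2) by auto
  qed
qed

text \<open>A set of triangles comes from a coloring only if it is constant on facets. A checker is,
  because it arises from \<open>AA c0\<close> by exchanging colors on whole components and each
  facet lies within one component; so no chains of triangles inside a facet have to be
  constructed.\<close>

lemma surj_AA:
  assumes c0: "c0 \<in> adm F" and B: "checker B"
  shows "\<exists>c\<in>adm F. AA c = B"
proof -
  obtain J where J: "J \<subseteq> Q" "B = switch (AA c0) J"
    using checker_eq_switch[OF checker_AA[OF c0] B] by blast
  have const: "t' \<in> B" if t: "t \<in> B" "t' \<in> T" "fc t = fc t'" for t t'
  proof -
    have tT: "t \<in> T" using checker_subset[OF B] t(1) by blast
    have adj: "(t, t') \<in> adj\<^sup>*" "(t', t) \<in> adj\<^sup>*"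
      using fc_connected[OF tT t(2,3)] fc_connected[OF t(2) tT t(3)[symmetric]] .
    have "t \<in> \<Union>J \<longleftrightarrow> t' \<in> \<Union>J"
      using J(1) Q_adj[OF _ _ t(2) adj(1)] Q_adj[OF _ _ tT adj(2)] by blast
    moreover have "t \<in> AA c0 \<longleftrightarrow> t' \<in> AA c0" using t(2,3) tT by (simp add: AA_def)
    ultimately show ?thesis using t(1) unfolding J(2) switch_def by blast
  qed
  define c where "c = (\<lambda>f\<in>facets F. if \<exists>t\<in>B. fc t = f then 1 else 2 :: nat)"
  have val: "c (fc t) = (if t \<in> B then 1 else 2)" if "t \<in> T" for t
    using fc_T(1)[OF that] const[of _ t] that by (auto simp: c_def)
  have "c \<in> adm F"
    unfolding adm_iff
  proof (intro conjI ballI impI)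
    show "c \<in> facets F \<rightarrow>\<^sub>E {1, 2}" by (auto simp: c_def)
    fix e t t' assume e: "e \<in> \<Union>SS" "t \<in> T" "t' \<in> T" "e \<subseteq> t \<and> e \<subseteq> t' \<and> t \<noteq> t'"
    have "card e = 2" using e(1) SS_es by (auto simp: es_def)
    then have "(t \<in> B) \<noteq> (t' \<in> B)" using checker_adj[OF B e(2,3)] e(1,4) by blast
    then show "c (fc t) \<noteq> c (fc t')" unfolding val[OF e(2)] val[OF e(3)] by auto
  qed
  moreover have "AA c = B"
    using val checker_subset[OF B] by (auto simp: AA_def split: if_splits)
  ultimately show ?thesis by blast
qed

lemma colored_evaluation_weight:
  assumes "c \<in> adm F"
  shows "colored_evaluation F c = weight (to_fract \<alpha>1) (to_fract \<alpha>2) (dots F) tr (AA c)"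
  unfolding colored_evaluation_def sign_exponent_def weight_def capped_euler num_seams_T surface_euler
    num_dots_T[OF assms] ..

lemma evaluation_symmetric:
  assumes c0: "c0 \<in> adm F"
  shows "symmetric_homogen (int (card (dots F)) - chi T div 2) (evaluation F)"
    and "even (chi T)"
proof -
  let ?x = "to_fract \<alpha>1" and ?y = "to_fract \<alpha>2" and ?P = "dots F"
  let ?A = "AA c0"
  note A = checker_AA[OF c0]
  have P: "finite ?P" using F by (simp add: closed_seamed_surface_def)
  have img: "AA ` adm F = {B. checker B}" using checker_AA surj_AA[OF c0] by blast
  have "evaluation F = (\<Sum>c\<in>adm F. weight ?x ?y ?P tr (AA c))"
    unfolding evaluation_def by (intro sum.cong refl colored_evaluation_weight)
  also have "\<dots> = (\<Sum>B | checker B. weight ?x ?y ?P tr B)"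
    unfolding img[symmetric] by (rule sum.reindex[OF inj_AA, unfolded o_def, symmetric])
  also have "\<dots> = (\<Prod>q\<in>Q. factor ?x ?y ?P tr (?A \<inter> q) q + factor ?x ?y ?P tr (q - ?A) q)"
    by (rule sum_weights[OF A P alpha_neq])
  finally have ev: "evaluation F = \<dots>" .
  have "symmetric_homogen (\<Sum>q\<in>Q. int (card {p\<in>?P. tr p \<in> q}) - chi q div 2) (evaluation F)"
    unfolding ev by (rule symmetric_homogen_prod) (rule component_symmetric[OF A P])
  moreover have "card ?P = (\<Sum>q\<in>Q. card {p\<in>?P. tr p \<in> q})"
  proof -
    have "{p\<in>?P. tr p \<in> T \<inter> T} = ?P" using tr_dot(1) by blast
    then have "card ?P = (\<Sum>q\<in>Q. card {p\<in>?P. tr p \<in> T \<inter> q})"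
      using card_P_sum[OF P, of tr T] by simp
    also have "\<dots> = (\<Sum>q\<in>Q. card {p\<in>?P. tr p \<in> q})"
      by (intro sum.cong refl) (use Q_subset in \<open>simp add: Int_absorb1\<close>)
    finally show ?thesis .
  qed
  moreover have "chi T div 2 = (\<Sum>q\<in>Q. chi q div 2)"
    unfolding chi_T using even_chi_component[OF A] by (rule sum_div_2)
  ultimately show "symmetric_homogen (int (card ?P) - chi T div 2) (evaluation F)"
    by (simp add: sum_subtractf)
  show "even (chi T)" unfolding chi_T using even_chi_component[OF A] by (rule dvd_sum)
qed

end

theorem lemma3p3:
  fixes F :: seamed_surface
  assumes "closed_seamed_surface F"
  shows "\<exists>p :: int poly poly.
           evaluation F = to_fract p \<and>
           symmetric_poly p \<and>
           homogeneous_of_degree p (surface_degree F)"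
proof (cases "adm F = {}")
  \<comment> \<open>The sum is empty. Evenness of the Euler characteristics is derived from a
    coloring, so this case is set apart.\<close>
  case True
  then show ?thesis
    by (intro exI[of _ 0]) (simp add: evaluation_def symmetric_poly_def homogeneous_of_degree_def)
next
  case False
  then obtain c0 where c0: "c0 \<in> adm F" by blast
  interpret seamed_PL_surface F by unfold_locales (rule assms)
  obtain nxt where nxt: "oriented_surface T nxt" using oriented_T by blast
  interpret oriented_seamed_PL_surface F nxt
    by (rule oriented_seamed_PL_surface.intro[OF seamed_PL_surface_axioms oriented_seamed_PL_surface_axioms.intro[OF nxt]])
  obtain p where p: "evaluation F = to_fract p" "signed_symmetric 1 p"
    "\<forall>i j. bc p i j \<noteq> 0 \<longrightarrow> int (i + j) = int (card (dots F)) - chi T div 2"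
    using evaluation_symmetric(1)[OF c0] unfolding symmetric_homogen_def by blast
  have "symmetric_poly p"
    using p(2) unfolding symmetric_poly_def signed_symmetric_def bc_def mult_1 .
  moreover have "homogeneous_of_degree p (surface_degree F)"
    unfolding homogeneous_of_degree_def
  proof (intro allI impI)
    fix i j assume "coeff (coeff p j) i \<noteq> 0"
    then have "int (i + j) = int (card (dots F)) - chi T div 2" using p(3) unfolding bc_def by blast
    \<comment> \<open>Doubling recovers \<open>chi T\<close> from its half because it is
      even.\<close>
    then show "int (2 * i + 2 * j) = surface_degree F"
      using evaluation_symmetric(2)[OF c0] unfolding surface_degree_def surface_euler by (auto elim!: evenE)
  qed
  ultimately show ?thesis using p(1) by blast
qed

end
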